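(* The following hold (for all parameters for which the groups are defined): (i) $d'(M_{p^n})=\frac{(n-2)(p+1)+4}{(n-1)(p+1)+2}$; (ii) $d'(G_{p,q,n})=\frac{2n}{2n+p-1}$; (iii) $d'(D_{2^n})=\frac{3n-1}{2^n+n-1}$ (for $n\geq 3$); (iv) $d'(He_p)=\frac{2p+5}{p^2+2p+4}$. Moreover, the sequences $(d'(M_{p^n}))_{n\geq 3}$ (for each fixed odd prime $p$), $(d'(M_{2^n}))_{n\geq 4}$ and $(d'(G_{p,q,n}))_{n\geq 2}$ (for fixed $p,q$) are strictly increasing, while the sequences $(d'(D_{2^n}))_{n\geq 3}$ and $(d'(He_p))_{p\geq 3}$ (indexed by the odd primes $p$) are strictly decreasing.
   Context: All groups are finite. For a finite group $G$, $L(G)$ denotes the set (lattice) of all subgroups of $G$, $k'(G)$ the number of conjugacy classes of subgroups of $G$, and $d'(G)=\frac{k'(G)}{|L(G)|}$. For a prime $p$ and an integer $n$ with $n\geq 4$ if $p=2$ and $n\geq 3$ if $p$ is odd, $M_{p^n}=\langle x,y\mid x^{p^{n-1}}=y^p=1,\ yx=x^{p^{n-2}+1}y\rangle$ (of order $p^n$). For primes $p,q$ with $q\mid p-1$ and an integer $n\geq 2$, $G_{p,q,n}=N\rtimes P$ is a non-abelian split extension with $N\cong C_p$, $P\cong C_{q^{n-1}}$ and $[N,\Phi(P)]=1$, where $\Phi(P)$ is the Frattini subgroup of $P$ and $C_m$ is the cyclic group of order $m$. $D_{2^n}$ ($n\geq 3$) is the dihedral group of order $2^n$. For an odd prime $p$,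 $He_p=\langle x,y,z\mid x^p=y^p=z^p=1,\ [x,z]=[y,z]=1,\ [x,y]=z\rangle$ is the Heisenberg group modulo $p$, of order $p^3$. *)

theory Defs
  imports
    "HOL-Algebra.Group_Action"
    "HOL-Algebra.Generated_Groups"
    "HOL-Algebra.Elementary_Groups"
    "HOL-Computational_Algebra.Primes"
    Complex_Main
begin

section \<open>The ratio of conjugacy classes of subgroups to subgroups\<close>

definition subgroup_lattice :: "('a, 'b) monoid_scheme \<Rightarrow> 'a set set" where
  "subgroup_lattice G = {H. subgroup H G}"

definition num_subgroup_classes :: "('a, 'b) monoid_scheme \<Rightarrow> nat" where
  "num_subgroup_classes G =
     card (orbits G {H. subgroup H G}
       (\<lambda>g. \<lambda>H \<in> {H. subgroup H G}. g <#\<^bsub>G\<^esub> H #>\<^bsub>G\<^esub> inv\<^bsub>G\<^esub> g))"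

definition d' :: "('a, 'b) monoid_scheme \<Rightarrow> real" where
  "d' G = real (num_subgroup_classes G) / real (card (subgroup_lattice G))"


section \<open>Groups given by generators and relations\<close>

text \<open>
  The letter \<open>(g, True)\<close> stands for the generator \<open>g\<close> and \<open>(g, False)\<close> for its formal
  inverse. The generators of a presentation are all elements of the type \<open>'g\<close>, and a
  relation \<open>u = v\<close> is the pair \<open>(u, v)\<close>.
\<close>

type_synonym 'g word = "('g \<times> bool) list"

definition gen :: "'g \<Rightarrow> 'g word" where
  "gen g = [(g, True)]"

definition word_pow :: "'g word \<Rightarrow> nat \<Rightarrow> 'g word" where
  "word_pow w k = concat (replicate k w)"

definition word_inv :: "'g word \<Rightarrow> 'g word" where
  "word_inv w = rev (map (\<lambda>(g, b). (g, \<not> b)) w)"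

definition word_comm :: "'g word \<Rightarrow> 'g word \<Rightarrow> 'g word" where
  "word_comm u v = u @ v @ word_inv u @ word_inv v"

inductive pres_eq :: "('g word \<times> 'g word) set \<Rightarrow> 'g word \<Rightarrow> 'g word \<Rightarrow> bool" for R where
  refl: "pres_eq R w w"
| sym: "pres_eq R u v \<Longrightarrow> pres_eq R v u"
| trans: "pres_eq R u v \<Longrightarrow> pres_eq R v w \<Longrightarrow> pres_eq R u w"
| cancel: "pres_eq R (u @ [(g, b), (g, \<not> b)] @ v) (u @ v)"
| rel: "(l, r) \<in> R \<Longrightarrow> pres_eq R (u @ l @ v) (u @ r @ v)"

definition word_class :: "('g word \<times> 'g word) set \<Rightarrow> 'g word \<Rightarrow> 'g word set" where
  "word_class R w = {v. pres_eq R w v}"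

definition presented_group :: "('g word \<times> 'g word) set \<Rightarrow> 'g word set monoid" where
  "presented_group R =
     \<lparr>carrier = range (word_class R),
      monoid.mult = (\<lambda>A B. \<Union>u\<in>A. \<Union>v\<in>B. word_class R (u @ v)),
      one = word_class R []\<rparr>"

lemma word_class_eq_iff: "word_class R u = word_class R v \<longleftrightarrow> pres_eq R u v"
  unfolding word_class_def
  by (auto intro: pres_eq.refl pres_eq.sym pres_eq.trans)

lemma pres_eq_context: "pres_eq R u v \<Longrightarrow> pres_eq R (a @ u @ b) (a @ v @ b)"
proof (induction rule: pres_eq.induct)
  case (cancel u g c v)
  show ?case using pres_eq.cancel[of R "a @ u" g c "v @ b"] by simp
next
  case (rel l r u v)
  show ?case using pres_eq.rel[OF rel, of "a @ u" "v @ b"] by simp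
qed (auto intro: pres_eq.intros)

lemma pres_eq_append:
  assumes "pres_eq R u u'" "pres_eq R v v'"
  shows "pres_eq R (u @ v) (u' @ v')"
  using pres_eq_context[OF assms(1), of "[]" v] pres_eq_context[OF assms(2), of u' "[]"]
  by (auto intro: pres_eq.trans)

lemma word_inv_left: "pres_eq R (word_inv w @ w) []"
proof (induction w)
  case Nil
  show ?case by (simp add: word_inv_def pres_eq.refl)
next
  case (Cons x w)
  obtain g b where x: "x = (g, b)" by fastforce
  have "pres_eq R (word_inv (x # w) @ (x # w)) (word_inv w @ w)"
    using pres_eq.cancel[of R "word_inv w" g "\<not> b" w] by (simp add: word_inv_def x)
  then show ?case using Cons by (rule pres_eq.trans)
qed

lemma mult_presented_group:
  "word_class R u \<otimes>\<^bsub>presented_group R\<^esub> word_class R v = word_class R (u @ v)"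
proof -
  have *: "word_class R (u' @ v') = word_class R (u @ v)"
    if "u' \<in> word_class R u" "v' \<in> word_class R v" for u' v'
  proof -
    have "pres_eq R u u'" "pres_eq R v v'" using that by (simp_all add: word_class_def)
    then show ?thesis unfolding word_class_eq_iff by (intro pres_eq.sym[OF pres_eq_append])
  qed
  have "u \<in> word_class R u" "v \<in> word_class R v"
    by (simp_all add: word_class_def pres_eq.refl)
  then have "(\<Union>u'\<in>word_class R u. \<Union>v'\<in>word_class R v. word_class R (u' @ v')) = word_class R (u @ v)"
    using * by blast
  then show ?thesis by (simp add: presented_group_def)
qed

lemma group_presented_group: "group (presented_group R)"
proof -
  have car: "carrier (presented_group R) = range (word_class R)"
    and one: "\<one>\<^bsub>presented_group R\<^esub> = word_class R []"
    by (simp_all add: presented_group_def)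
  show ?thesis
  proof (rule groupI)
    fix x assume "x \<in> carrier (presented_group R)"
    then obtain u where u: "x = word_class R u" by (auto simp: car)
    show "\<exists>y\<in>carrier (presented_group R). y \<otimes>\<^bsub>presented_group R\<^esub> x = \<one>\<^bsub>presented_group R\<^esub>"
      using word_inv_left[of R u]
      by (auto simp: u one car mult_presented_group word_class_eq_iff)
  qed (auto simp: car one mult_presented_group)
qed


section \<open>The families of groups\<close>

datatype gen2 = gx | gy

definition modular_group :: "nat \<Rightarrow> nat \<Rightarrow> gen2 word set monoid" where
  "modular_group p n = presented_group
     {(word_pow (gen gx) (p ^ (n - 1)), []),
      (word_pow (gen gy) p, []),
      (gen gy @ gen gx, word_pow (gen gx) (p ^ (n - 2) + 1) @ gen gy)}"

text \<open>The dihedral group of order \<open>2 * m\<close>.\<close>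

definition dihedral_group :: "nat \<Rightarrow> gen2 word set monoid" where
  "dihedral_group m = presented_group
     {(word_pow (gen gx) m, []),
      (word_pow (gen gy) 2, []),
      (gen gy @ gen gx @ word_inv (gen gy), word_inv (gen gx))}"

datatype gen3 = hx | hy | hz

definition heisenberg_group :: "nat \<Rightarrow> gen3 word set monoid" where
  "heisenberg_group p = presented_group
     {(word_pow (gen hx) p, []),
      (word_pow (gen hy) p, []),
      (word_pow (gen hz) p, []),
      (word_comm (gen hx) (gen hz), []),
      (word_comm (gen hy) (gen hz), []),
      (word_comm (gen hx) (gen hy), gen hz)}"

definition maximal_subgroup :: "'a set \<Rightarrow> ('a, 'b) monoid_scheme \<Rightarrow> bool" where
  "maximal_subgroup M G \<longleftrightarrow> subgroup M G \<and> M \<noteq> carrier G \<and>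
     (\<forall>K. subgroup K G \<and> M \<subseteq> K \<longrightarrow> K = M \<or> K = carrier G)"

definition frattini :: "('a, 'b) monoid_scheme \<Rightarrow> 'a set" where
  "frattini G = carrier G \<inter> \<Inter> {M. maximal_subgroup M G}"

definition commutator_subgroup :: "('a, 'b) monoid_scheme \<Rightarrow> 'a set \<Rightarrow> 'a set \<Rightarrow> 'a set" where
  "commutator_subgroup G H K =
     generate G {h \<otimes>\<^bsub>G\<^esub> k \<otimes>\<^bsub>G\<^esub> inv\<^bsub>G\<^esub> h \<otimes>\<^bsub>G\<^esub> inv\<^bsub>G\<^esub> k | h k. h \<in> H \<and> k \<in> K}"

definition split_extension :: "('a, 'b) monoid_scheme \<Rightarrow> 'a set \<Rightarrow> 'a set \<Rightarrow> bool" where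
  "split_extension G N P \<longleftrightarrow> N \<lhd> G \<and> subgroup P G \<and>
     N \<inter> P = {\<one>\<^bsub>G\<^esub>} \<and> N <#>\<^bsub>G\<^esub> P = carrier G"

text \<open>\<open>G\<close> is a group of the kind denoted \<open>G\<^bsub>p,q,n\<^esub>\<close>.\<close>

definition is_Gpqn :: "nat \<Rightarrow> nat \<Rightarrow> nat \<Rightarrow> ('a, 'b) monoid_scheme \<Rightarrow> bool" where
  "is_Gpqn p q n G \<longleftrightarrow> group G \<and> \<not> comm_group G \<and>
     (\<exists>N P. split_extension G N P \<and>
        G\<lparr>carrier := N\<rparr> \<cong> integer_mod_group p \<and>
        G\<lparr>carrier := P\<rparr> \<cong> integer_mod_group (q ^ (n - 1)) \<and>
        commutator_subgroup G N (frattini (G\<lparr>carrier := P\<rparr>)) = {\<one>\<^bsub>G\<^esub>})"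

end

theory Submission
  imports Defs "HOL-Number_Theory.Cong"
begin

text \<open>
  The groups of (i)--(iii) are metacyclic: they are generated by \<open>x\<close> of order \<open>m\<close> and \<open>y\<close> of order
  \<open>k\<close> with \<open>y x y\<^sup>-\<^sup>1 = x\<^sup>r\<close> and \<open>\<langle>x\<rangle> \<inter> \<langle>y\<rangle> = 1\<close>. A subgroup \<open>H\<close> is determined by the divisor \<open>d\<close> of \<open>m\<close>
  with \<open>H \<inter> \<langle>x\<rangle> = \<langle>x\<^sup>d\<rangle>\<close>, the divisor \<open>e\<close> of \<open>k\<close> such that \<open>H\<close> projects onto \<open>\<langle>y\<^sup>e\<rangle>\<close>, and the residue
  \<open>j\<close> modulo \<open>d\<close> with \<open>x\<^sup>j y\<^sup>e \<in> H\<close>. The triple occurs if and only if \<open>d\<close> divides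
  \<open>j (1 + r\<^sup>e + r\<^bsup>2e\<^esup> + \<dots>)\<close> with \<open>k/e\<close> summands, and conjugation by \<open>x\<^sup>u y\<^sup>v\<close> replaces \<open>j\<close> by
  \<open>r\<^sup>v j + u (1 - r\<^sup>e)\<close>. So both counts reduce to congruences.

  In the Heisenberg group, a change of the third coordinate (possible because 2 is invertible) turns
  powers into scalar multiples. The subgroups are then the subspaces of \<open>\<int>\<^sub>p\<^sup>3\<close> that contain the centre
  or on which the commutator form \<open>a b' - b a'\<close> vanishes, and conjugation by \<open>(u, v, w)\<close> maps \<open>(a, b, c)\<close> to
  \<open>(a, b, c + u b - v a)\<close>.
\<close>

section \<open>Conjugacy classes of subgroups\<close>

text \<open>A presentation bounds its group only from above: rewriting gives every element a normal
  form, but does not show that distinct normal forms stay distinct. The missing half comes from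
  letting the generators act on the box of all coordinate tuples, by the formulas that left
  multiplication ought to obey. Once these maps respect the relations, a normal form applied to the
  zero tuple returns its own coordinates. The groups of (ii) are not presented; there both halves
  come from the split extension.

  In (i) and (ii) the two counts differ by p - 1 for every n: exactly one pair (d, e) carries
  distinct conjugate subgroups, namely d = m and e = 1, a single class of p complements of <x>. In
  the dihedral case the values of j for e = 1 split by parity, into two classes for each d > 1.

  The bound n >= 4 for p = 2 enters through the geometric sum 1 + r, which must be twice an odd
  number modulo m; for n = 3 it vanishes modulo m, as in the dihedral group of order 8.\<close>

lemma (in group) conj_eqI:
  assumes "g \<in> carrier G" "H \<subseteq> carrier G" "H' \<subseteq> carrier G"
    and "\<And>h. h \<in> H \<Longrightarrow> \<exists>h'\<in>H'. g \<otimes> h = h' \<otimes> g"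
    and "\<And>h'. h' \<in> H' \<Longrightarrow> \<exists>h\<in>H. g \<otimes> h = h' \<otimes> g"
  shows "g <# H #> inv g = H'"
proof -
  \<comment> \<open>Conjugation is phrased as \<open>g \<otimes> h = h' \<otimes> g\<close>, without
    inverses, so that in coordinates it becomes a comparison of two products.\<close>
  have *: "g \<otimes> h \<otimes> inv g = h'" if "g \<otimes> h = h' \<otimes> g" "h \<in> H" "h' \<in> H'" for h h'
    using that assms(1-3) by (auto simp: m_assoc subset_iff)
  have "g <# H #> inv g = (\<lambda>h. g \<otimes> h \<otimes> inv g) ` H"
    by (auto simp: l_coset_def r_coset_def)
  also have "\<dots> = H'"
  proof (intro equalityI subsetI)
    fix z assume "z \<in> (\<lambda>h. g \<otimes> h \<otimes> inv g) ` H"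
    then obtain h where "h \<in> H" "z = g \<otimes> h \<otimes> inv g" by blast
    then show "z \<in> H'" using * assms(4) by metis
  next
    fix h' assume "h' \<in> H'"
    then obtain h where "h \<in> H" "g \<otimes> h = h' \<otimes> g" using assms(5) by blast
    then have "h' = g \<otimes> h \<otimes> inv g" using * \<open>h' \<in> H'\<close> by simp
    then show "h' \<in> (\<lambda>h. g \<otimes> h \<otimes> inv g) ` H" using \<open>h \<in> H\<close> by blast
  qed
  finally show ?thesis .
qed

text \<open>Once \<open>f\<close> parametrises the subgroups, each orbit is the
  \<open>f\<close>-image of a fibre of the complete invariant \<open>c\<close>. Nonempty fibres over
  different values differ, so the orbits are counted by the values of \<open>c\<close>.\<close>

lemma (in group) num_subgroup_classes_eq:
  assumes bij: "bij_betw f T {H. subgroup H G}"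
    and c: "\<And>t t'. t \<in> T \<Longrightarrow> t' \<in> T \<Longrightarrow>
      c t = c t' \<longleftrightarrow> (\<exists>g\<in>carrier G. f t' = g <# f t #> inv g)"
  shows "num_subgroup_classes G = card (c ` T)"
proof -
  let ?E = "{H. subgroup H G}"
  let ?\<phi> = "\<lambda>g. \<lambda>H\<in>?E. g <# H #> inv g"
  interpret act: group_action G ?E ?\<phi>
    by (rule action_by_conjugation_on_subgroups_set)
  have f: "f ` T = ?E" "inj_on f T" using bij by (auto simp: bij_betw_def)
  have orb: "orbit G ?\<phi> (f t) = f ` {t'\<in>T. c t' = c t}" if t: "t \<in> T" for t
  proof -
    have ft: "f t \<in> ?E" using f t by blast
    have "orbit G ?\<phi> (f t) = {H \<in> ?E. \<exists>g\<in>carrier G. H = g <# f t #> inv g}"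
      using ft act.element_image[OF _ ft] by (fastforce simp: orbit_def)
    also have "\<dots> = f ` {t'\<in>T. \<exists>g\<in>carrier G. f t' = g <# f t #> inv g}"
      unfolding f(1)[symmetric] by blast
    also have "\<dots> = f ` {t'\<in>T. c t' = c t}"
      using c[OF t] by (metis (mono_tags, lifting))
    finally show ?thesis .
  qed
  have "orbits G ?E ?\<phi> = (\<lambda>t. f ` {t'\<in>T. c t' = c t}) ` T"
    unfolding orbits_def f(1)[symmetric] using orb[unfolded f(1)[symmetric]] by blast
  also have "\<dots> = (\<lambda>v. f ` {t'\<in>T. c t' = v}) ` (c ` T)"
    by blast
  finally have "num_subgroup_classes G = card ((\<lambda>v. f ` {t'\<in>T. c t' = v}) ` (c ` T))"
    by (simp add: num_subgroup_classes_def)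
  also have "\<dots> = card (c ` T)"
  proof (rule card_image, rule inj_onI)
    fix v w assume v: "v \<in> c ` T" and "w \<in> c ` T"
      and eq: "f ` {t'\<in>T. c t' = v} = f ` {t'\<in>T. c t' = w}"
    have "{t'\<in>T. c t' = v} = {t'\<in>T. c t' = w}"
      using inj_on_image_eq_iff[OF f(2), of "{t'\<in>T. c t' = v}" "{t'\<in>T. c t' = w}"] eq by simp
    then show "v = w" using v by blast
  qed
  finally show ?thesis .
qed

section \<open>Actions of presented groups\<close>

text \<open>A formal inverse acts by inverting \<open>\<pi> g\<close> on \<open>X\<close>, so an
  action is specified by the forward maps of the generators alone.\<close>

definition letter_act :: "('g \<Rightarrow> 's \<Rightarrow> 's) \<Rightarrow> 's set \<Rightarrow> 'g \<times> bool \<Rightarrow> 's \<Rightarrow> 's" where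
  "letter_act \<pi> X = (\<lambda>(g, b). if b then \<pi> g else inv_into X (\<pi> g))"

definition word_act :: "('g \<Rightarrow> 's \<Rightarrow> 's) \<Rightarrow> 's set \<Rightarrow> 'g word \<Rightarrow> 's \<Rightarrow> 's" where
  "word_act \<pi> X = foldr (letter_act \<pi> X)"

lemma word_act_simps [simp]:
  "word_act \<pi> X [] s = s"
  "word_act \<pi> X (l # w) s = letter_act \<pi> X l (word_act \<pi> X w s)"
  "word_act \<pi> X (u @ v) s = word_act \<pi> X u (word_act \<pi> X v s)"
  "word_act \<pi> X (gen g) s = \<pi> g s"
  by (simp_all add: word_act_def letter_act_def gen_def)

lemma word_act_word_pow:
  "word_act \<pi> X (word_pow w k) s = (word_act \<pi> X w ^^ k) s"
  by (induction k) (simp_all add: word_pow_def)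

lemma word_act_inv_gen:
  "word_act \<pi> X (word_inv (gen g)) s = inv_into X (\<pi> g) s"
  by (simp add: word_inv_def gen_def letter_act_def)

lemma word_act_closed:
  assumes "\<And>g. bij_betw (\<pi> g) X X" "s \<in> X"
  shows "word_act \<pi> X w s \<in> X"
proof (induction w)
  case (Cons l w)
  obtain g b where l: "l = (g, b)" by fastforce
  have "\<pi> g ` X = X" using assms(1) by (simp add: bij_betw_def)
  then show ?case using Cons by (auto simp: l letter_act_def inv_into_into)
qed (use assms in simp)

text \<open>Serves to show that words are distinct in a presented group.\<close>

lemma pres_eq_word_act:
  assumes bij: "\<And>g. bij_betw (\<pi> g) X X"
    and R: "\<And>l r s. (l, r) \<in> R \<Longrightarrow> s \<in> X \<Longrightarrow> word_act \<pi> X l s = word_act \<pi> X r s"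
  shows "pres_eq R u v \<Longrightarrow> s \<in> X \<Longrightarrow> word_act \<pi> X u s = word_act \<pi> X v s"
proof (induction arbitrary: s rule: pres_eq.induct)
  case (cancel u g b v)
  have "word_act \<pi> X v s \<in> X" using bij cancel.prems by (rule word_act_closed)
  then show ?case using bij[of g]
    by (simp add: letter_act_def bij_betw_inv_into_left bij_betw_inv_into_right)
next
  case (rel l r u v)
  have "word_act \<pi> X v s \<in> X" using bij rel.prems by (rule word_act_closed)
  then show ?case using R[OF rel.hyps] by simp
qed simp_all

lemma one_presented_group: "\<one>\<^bsub>presented_group R\<^esub> = word_class R []"
  by (simp add: presented_group_def)

lemma word_class_in_carrier [simp]: "word_class R w \<in> carrier (presented_group R)"
  by (simp add: presented_group_def)

lemma word_class_word_pow:
  "word_class R (word_pow w k) = word_class R w [^]\<^bsub>presented_group R\<^esub> k"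
proof -
  interpret group "presented_group R" by (rule group_presented_group)
  show ?thesis
  proof (induction k)
    case 0
    then show ?case by (simp add: word_pow_def one_presented_group)
  next
    case (Suc k)
    have "word_class R (word_pow w (Suc k)) =
        word_class R w \<otimes>\<^bsub>presented_group R\<^esub> word_class R (word_pow w k)"
      by (simp add: word_pow_def mult_presented_group)
    then show ?case using Suc by (simp only: nat_pow_Suc2 word_class_in_carrier)
  qed
qed

lemma word_class_word_inv:
  "word_class R (word_inv w) = inv\<^bsub>presented_group R\<^esub> word_class R w"
proof -
  interpret group "presented_group R" by (rule group_presented_group)
  have "word_class R (word_inv w) \<otimes>\<^bsub>presented_group R\<^esub> word_class R w = \<one>\<^bsub>presented_group R\<^esub>"
    by (simp add: mult_presented_group one_presented_group word_class_eq_iff word_inv_left)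
  then show ?thesis by (simp add: inv_equality)
qed

lemma word_class_rel:
  assumes "(l, r) \<in> R"
  shows "word_class R l = word_class R r"
  using pres_eq.rel[OF assms, of "[]" "[]"] by (simp add: word_class_eq_iff)

text \<open>Induction on a representing word. It serves to show that a set of normal forms exhausts
  the group: the set only has to be stable under left multiplication by the generators and their
  inverses.\<close>

lemma presented_group_induct:
  assumes "A \<in> carrier (presented_group R)" "P \<one>\<^bsub>presented_group R\<^esub>"
    and gen: "\<And>g B. B \<in> carrier (presented_group R) \<Longrightarrow> P B \<Longrightarrow>
      P (word_class R (gen g) \<otimes>\<^bsub>presented_group R\<^esub> B)"
    and inv: "\<And>g B. B \<in> carrier (presented_group R) \<Longrightarrow> P B \<Longrightarrow>
      P (inv\<^bsub>presented_group R\<^esub> word_class R (gen g) \<otimes>\<^bsub>presented_group R\<^esub> B)"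
  shows "P A"
proof -
  obtain w where A: "A = word_class R w" using assms(1) by (auto simp: presented_group_def)
  show ?thesis unfolding A
  proof (induction w)
    case Nil
    then show ?case using assms(2) by (simp add: one_presented_group)
  next
    case (Cons l w)
    obtain g b where l: "l = (g, b)" by fastforce
    have "word_class R (l # w) = word_class R [l] \<otimes>\<^bsub>presented_group R\<^esub> word_class R w"
      by (simp add: mult_presented_group)
    also have "word_class R [l] =
        (if b then word_class R (gen g) else inv\<^bsub>presented_group R\<^esub> word_class R (gen g))"
      by (simp add: l gen_def flip: word_class_word_inv) (simp add: word_inv_def)
    finally show ?case using gen inv Cons by (simp split: if_splits)
  qed
qed

section \<open>Subgroups of metacyclic groups\<close>

text \<open>Division with remainder by the least positive element \<open>d\<close>. Closure under
  differences already yields all integer multiples, and \<open>a0\<close> guarantees that a positive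
  element exists.\<close>

lemma int_subgroup_dvd:
  fixes D :: "int set"
  assumes "a0 \<in> D" "a0 > 0" and diff: "\<And>a b. a \<in> D \<Longrightarrow> b \<in> D \<Longrightarrow> a - b \<in> D"
  obtains d :: nat where "d > 0" "D = {a. int d dvd a}"
proof -
  have zero: "0 \<in> D" using diff[OF assms(1,1)] by simp
  have add: "a + b \<in> D" if "a \<in> D" "b \<in> D" for a b
    using diff[OF that(1) diff[OF zero that(2)]] by simp
  have nat_mult: "int n * a \<in> D" if "a \<in> D" for n a
    by (induction n) (use zero add that in \<open>auto simp: algebra_simps\<close>)
  have mult: "c * a \<in> D" if "a \<in> D" for c a
    using nat_mult[OF that, of "nat c"] diff[OF zero nat_mult[OF that, of "nat (-c)"]]
    by (cases "c \<ge> 0") auto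
  define d where "d = (LEAST n. n > 0 \<and> int n \<in> D)"
  have ex: "nat a0 > 0 \<and> int (nat a0) \<in> D" using assms by simp
  have d: "d > 0" "int d \<in> D"
    using LeastI[of "\<lambda>n. n > 0 \<and> int n \<in> D", OF ex] by (auto simp: d_def)
  have "int d dvd a" if a: "a \<in> D" for a
  proof (rule ccontr)
    assume "\<not> int d dvd a"
    then have "a mod int d \<noteq> 0" by auto
    moreover have "a mod int d \<ge> 0" using d by simp
    ultimately have pos: "nat (a mod int d) > 0" by linarith
    have "a mod int d = a - (a div int d) * int d" by (simp add: minus_div_mult_eq_mod)
    also have "\<dots> \<in> D" using diff[OF a mult[OF d(2)]] .
    finally have "int (nat (a mod int d)) \<in> D" using d by simp
    then have "d \<le> nat (a mod int d)" using pos unfolding d_def by (intro Least_le) auto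
    moreover have "nat (a mod int d) < d" using d by (simp add: nat_less_iff)
    ultimately show False by simp
  qed
  moreover have "a \<in> D" if "int d dvd a" for a
    using that mult[OF d(2)] by (auto simp: dvd_def mult.commute)
  ultimately show ?thesis using that d(1) by blast
qed

lemma cong_nat_leE:
  fixes i i' k :: nat
  assumes "[i = i'] (mod k)" "i \<le> i'"
  obtains t where "i' = i + k * t"
proof -
  have "k dvd i' - i" using assms by (simp add: cong_def flip: mod_eq_dvd_iff_nat)
  then obtain t where "i' - i = k * t" by (elim dvdE)
  then show ?thesis using that[of t] assms(2) by simp
qed

text \<open>The hypothesis says that conjugation by \<open>g\<close> carries \<open>u\<close> to
  \<open>w\<close>, and conjugation respects powers.\<close>

lemma (in group) intertwine_int_pow:
  assumes "g \<in> carrier G" "u \<in> carrier G" "w \<in> carrier G" and gu: "g \<otimes> u = w \<otimes> g"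
  shows "g \<otimes> u [^] (n::int) = w [^] n \<otimes> g"
proof -
  have nat: "g \<otimes> u [^] k = w [^] k \<otimes> g" for k :: nat
  proof (induction k)
    case (Suc k)
    have "g \<otimes> u [^] Suc k = (g \<otimes> u [^] k) \<otimes> u" using assms by (simp add: m_assoc)
    also have "\<dots> = w [^] k \<otimes> (g \<otimes> u)" using assms(1-3) by (simp add: Suc m_assoc)
    also have "\<dots> = w [^] Suc k \<otimes> g" using assms(1-3) by (simp add: gu m_assoc)
    finally show ?case .
  qed (use assms in simp)
  show ?thesis
  proof (cases n rule: int_cases2)
    case (nonneg k)
    then show ?thesis using nat[of k] by (simp add: int_pow_int)
  next
    case (nonpos k)
    \<comment> \<open>For the exponent \<open>- k\<close>, both sides are compared after
      multiplication by \<open>w [^] k\<close> on the left, which brings the natural case into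
      play.\<close>
    have "w [^] k \<otimes> (g \<otimes> u [^] n) = (g \<otimes> u [^] k) \<otimes> u [^] n"
      using assms(1-3) by (simp add: nat m_assoc)
    also have "\<dots> = g" using assms(1-3) by (simp add: nonpos m_assoc int_pow_neg int_pow_int)
    also have "\<dots> = w [^] k \<otimes> (w [^] n \<otimes> g)"
      using assms(1-3) by (simp add: nonpos int_pow_neg int_pow_int m_assoc[symmetric])
    finally show ?thesis using assms(1-3) by simp
  qed
qed

section \<open>Normal forms in metacyclic groups\<close>

locale metacyclic_relations = group G for G (structure) +
  fixes x y :: 'a and m k :: nat and r :: int
  assumes x [simp]: "x \<in> carrier G" and y [simp]: "y \<in> carrier G"
    and m_pos: "m > 0" and k_pos: "k > 0"
    and x_pow: "x [^] m = \<one>" and y_pow: "y [^] k = \<one>"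
    and yx: "y \<otimes> x = x [^] r \<otimes> y"
begin

text \<open>The exponent of \<open>y\<close> is natural because the product law involves
  \<open>r ^ i\<close>, which has no meaning for negative \<open>i\<close>. Inverses of powers of
  \<open>y\<close> are therefore written with the factor \<open>k - 1\<close>.\<close>

definition E :: "int \<Rightarrow> nat \<Rightarrow> 'a" where
  "E a i = x [^] a \<otimes> y [^] i"

lemma E_closed [simp]: "E a i \<in> carrier G"
  by (simp add: E_def)

lemma y_x_int_pow: "y \<otimes> x [^] (a::int) = x [^] (r * a) \<otimes> y"
  using intertwine_int_pow[OF y x _ yx, of a] by (simp add: int_pow_pow)

lemma y_pow_x_int_pow: "y [^] i \<otimes> x [^] (a::int) = x [^] (r ^ i * a) \<otimes> y [^] (i::nat)"
proof (induction i)
  case (Suc i)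
  have "y [^] Suc i \<otimes> x [^] a = y \<otimes> (y [^] i \<otimes> x [^] a)"
    unfolding nat_pow_Suc2[OF y] by (simp add: m_assoc)
  also have "\<dots> = (y \<otimes> x [^] (r ^ i * a)) \<otimes> y [^] i"
    by (simp add: Suc m_assoc)
  also have "\<dots> = x [^] (r ^ Suc i * a) \<otimes> (y \<otimes> y [^] i)"
    by (simp add: y_x_int_pow m_assoc mult.assoc)
  finally show ?case unfolding nat_pow_Suc2[OF y] .
qed simp

lemma E_mult: "E a i \<otimes> E b j = E (a + r ^ i * b) (i + j)"
proof -
  have "E a i \<otimes> E b j = x [^] a \<otimes> (y [^] i \<otimes> x [^] b) \<otimes> y [^] j"
    by (simp add: E_def m_assoc)
  also have "\<dots> = (x [^] a \<otimes> x [^] (r ^ i * b)) \<otimes> (y [^] i \<otimes> y [^] j)"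
    by (simp add: y_pow_x_int_pow m_assoc)
  finally show ?thesis by (simp add: E_def nat_pow_mult int_pow_mult)
qed

lemma E_one: "E 0 0 = \<one>" "E a 0 = x [^] a" "E 0 i = y [^] i" "E 1 0 = x" "E 0 1 = y"
  by (simp_all add: E_def)

lemma inv_x: "inv x = E (-1) 0"
  by (simp add: E_def int_pow_neg)

lemma inv_y: "inv y = E 0 (k - 1)"
proof (rule inv_equality)
  show "E 0 (k - 1) \<otimes> y = \<one>"
    using y_pow k_pos nat_pow_Suc[of y "k - 1"] by (simp add: E_def)
qed simp_all

lemma E_cong:
  assumes "[a = b] (mod int m)" "[i = j] (mod k)"
  shows "E a i = E b j"
proof -
  have *: "z [^] (a::int) = z [^] b" if "[a = b] (mod int n)" "z [^] n = \<one>" "z \<in> carrier G"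
    for z a b and n :: nat
  proof -
    obtain t where "a = b + int n * t" using \<open>[a = b] (mod int n)\<close> by (metis cong_iff_lin cong_sym)
    then show ?thesis using that(2,3)
      by (simp add: int_pow_mult int_pow_pow[symmetric] int_pow_int)
  qed
  have "x [^] a = x [^] b" using *[OF assms(1) x_pow] by simp
  moreover have "y [^] int i = y [^] int j" using *[of "int i" "int j" k y] assms(2) y_pow
    by (simp add: cong_int_iff)
  ultimately show ?thesis by (simp add: E_def int_pow_int)
qed

end

text \<open>The relations alone persist in every quotient. Generation bounds the order from above by
  \<open>m * k\<close> and \<open>kernel\<close> bounds it from below, so \<open>a\<close> modulo
  \<open>m\<close> and \<open>i\<close> modulo \<open>k\<close> become genuine coordinates.\<close>

locale metacyclic = metacyclic_relations +
  assumes generated: "carrier G \<subseteq> range (\<lambda>(a, i). E a i)"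
    and kernel: "E a i = \<one> \<Longrightarrow> int m dvd a \<and> k dvd i"
begin

lemma carrierE:
  assumes "g \<in> carrier G"
  obtains a i where "g = E a i"
proof -
  have "g \<in> range (\<lambda>(a, i). E a i)" using assms generated by (rule subsetD[rotated])
  then show ?thesis using that by (elim imageE) (simp add: split_beta)
qed

lemma E_eq_iff: "E a i = E b j \<longleftrightarrow> [a = b] (mod int m) \<and> [i = j] (mod k)"
proof
  assume eq: "E a i = E b j"
  \<comment> \<open>The outer factors are the inverse of \<open>x [^] b\<close> on the left and that
    of \<open>y [^] j\<close>, with a natural exponent, on the right.\<close>
  have "E (a - b) (i + (k - 1) * j) = E (-b) 0 \<otimes> (E a i \<otimes> E 0 ((k - 1) * j))"
    by (simp add: E_mult)
  also have "\<dots> = E (-b) 0 \<otimes> (E b j \<otimes> E 0 ((k - 1) * j))" by (simp add: eq)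
  also have "\<dots> = E 0 (k * j)"
    using k_pos by (simp add: E_mult) (simp add: algebra_simps)
  also have "\<dots> = E 0 0" by (rule E_cong) (simp_all add: cong_def)
  finally have "E (a - b) (i + (k - 1) * j) = \<one>" by (simp add: E_one)
  from kernel[OF this] have "int m dvd a - b" and dvd: "k dvd i + (k - 1) * j" by auto
  have "int (i + (k - 1) * j) = (int i - int j) + int k * int j"
    using k_pos by (cases k) (simp_all add: algebra_simps)
  moreover have "int k dvd int (i + (k - 1) * j)" using dvd by (simp only: int_dvd_int_iff)
  ultimately have "int k dvd (int i - int j) + int k * int j" by metis
  then have "int k dvd int i - int j" by (simp only: dvd_add_left_iff dvd_triv_left)
  then have "[i = j] (mod k)" by (simp add: cong_iff_dvd_diff flip: cong_int_iff)
  with \<open>int m dvd a - b\<close> show "[a = b] (mod int m) \<and> [i = j] (mod k)"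
    by (simp add: cong_iff_dvd_diff)
qed (use E_cong in blast)

text \<open>Conjugation by \<open>y [^] k\<close> raises \<open>x\<close> to the power
  \<open>r ^ k\<close>, but \<open>y [^] k\<close> is trivial.\<close>

lemma r_pow_k: "[r ^ k = 1] (mod int m)"
proof -
  have "E (r ^ k) k = E 0 k \<otimes> E 1 0" by (simp add: E_mult)
  also have "E 0 k = \<one>" by (simp add: E_one y_pow)
  finally have "E (r ^ k) k = E 1 0" by simp
  then show ?thesis by (simp add: E_eq_iff)
qed

lemma r_pow_k_mult: "[r ^ (k * n) = 1] (mod int m)"
  using cong_pow[OF r_pow_k, of n] by (simp add: power_mult)

text \<open>The geometric sum that governs powers: the \<open>s\<close>-th power of
  \<open>E j e\<close> is \<open>E (j * S e s) (e * s)\<close>.\<close>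

definition S :: "nat \<Rightarrow> nat \<Rightarrow> int" where
  "S e s = (\<Sum>l<s. r ^ (e * l))"

lemma S_0 [simp]: "S e 0 = 0" and S_1 [simp]: "S e 1 = 1" "S e (Suc 0) = 1"
  by (simp_all add: S_def)

lemma S_Suc: "S e (Suc s) = S e s + r ^ (e * s)"
  by (simp add: S_def)

lemma S_add: "S e (s + u) = S e s + r ^ (e * s) * S e u"
proof (induction u)
  case (Suc u)
  have "S e (s + Suc u) = S e (s + u) + r ^ (e * (s + u))" by (simp add: S_Suc)
  then show ?case by (simp add: Suc S_Suc algebra_simps power_add)
qed simp

text \<open>The sum telescopes. The product form is kept because \<open>1 - r ^ e\<close> may be
  zero, or a zero divisor modulo \<open>d\<close>.\<close>

lemma S_geometric: "(1 - r ^ e) * S e s = 1 - r ^ (e * s)"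
proof (induction s)
  case (Suc s)
  have "(1 - r ^ e) * S e (Suc s) = (1 - r ^ e) * S e s + (1 - r ^ e) * r ^ (e * s)"
    by (simp add: S_Suc distrib_left)
  then show ?case unfolding Suc by (simp add: algebra_simps power_add)
qed simp

section \<open>The subgroups as a parametrised family\<close>

text \<open>The subgroup meeting \<open>\<langle>x\<rangle>\<close> in \<open>\<langle>x\<^sup>d\<rangle>\<close>, projecting onto \<open>\<langle>y\<^sup>e\<rangle>\<close> and containing \<open>x\<^sup>j y\<^sup>e\<close>.\<close>

definition Hsub :: "nat \<Rightarrow> nat \<Rightarrow> int \<Rightarrow> 'a set" where
  "Hsub d e j = {E a i | a i. e dvd i \<and> [a = j * S e (i div e)] (mod int d)}"

text \<open>The last condition says that \<open>(x\<^sup>j y\<^sup>e)\<^bsup>k/e\<^esup>\<close> lies in \<open>\<langle>x\<^sup>d\<rangle>\<close>.\<close>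

definition J :: "nat \<Rightarrow> nat \<Rightarrow> int set" where
  "J d e = {j. 0 \<le> j \<and> j < int d \<and> int d dvd j * S e (k div e)}"

lemma finite_J: "finite (J d e)"
  by (rule finite_subset[of _ "{0..<int d}"]) (auto simp: J_def)

text \<open>Replacing \<open>i\<close> by \<open>i + k\<close> does not change
  \<open>y [^] i\<close>, so it must not change membership in \<open>Hsub\<close> either. A full
  period contributes \<open>j * S e (k div e)\<close>, which vanishes modulo \<open>d\<close>, and
  multiplies the rest by \<open>r ^ k\<close>, which is 1 modulo \<open>d\<close>.\<close>

lemma S_periodic:
  assumes "d dvd m" "e dvd k" "e dvd i" "int d dvd j * S e (k div e)"
  shows "[j * S e ((i + k * t) div e) = j * S e (i div e)] (mod int d)"
proof (induction t)
  case (Suc t)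
  have e: "e > 0" using assms(2) k_pos by (auto intro: Nat.gr0I)
  have "(i + k * Suc t) div e = k div e + (i + k * t) div e"
    using assms(2,3) e by (auto simp: dvd_def algebra_simps)
  then have "j * S e ((i + k * Suc t) div e) =
      j * S e (k div e) + r ^ k * (j * S e ((i + k * t) div e))"
    using assms(2) by (simp add: S_add algebra_simps)
  also have "[\<dots> = 0 + 1 * (j * S e ((i + k * t) div e))] (mod int d)"
    using assms(1,4) r_pow_k
    by (intro cong_add cong_mult cong_refl)
      (auto simp: cong_0_iff intro: cong_dvd_modulus)
  finally show ?case using Suc by (auto intro: cong_trans)
qed simp

text \<open>\<open>Hsub\<close> only asks for some pair of coordinates satisfying the condition. The
  requirement in \<open>J\<close> makes the condition independent of the chosen pair, by
  periodicity.\<close>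

lemma E_in_Hsub_iff:
  assumes "d dvd m" "e dvd k" "j \<in> J d e"
  shows "E a i \<in> Hsub d e j \<longleftrightarrow> e dvd i \<and> [a = j * S e (i div e)] (mod int d)"
proof
  assume "E a i \<in> Hsub d e j"
  then obtain b i' where eq: "E a i = E b i'" and b: "e dvd i'" "[b = j * S e (i' div e)] (mod int d)"
    by (auto simp: Hsub_def)
  have ab: "[a = b] (mod int d)" and ii: "[i = i'] (mod k)"
    using eq assms(1) by (auto simp: E_eq_iff intro: cong_dvd_modulus)
  have "[i = i'] (mod e)" using ii assms(2) by (rule cong_dvd_modulus_nat)
  then have ei: "e dvd i" using b(1) by (simp add: cong_dvd_iff)
  have j: "int d dvd j * S e (k div e)" using assms(3) by (simp add: J_def)
  have "[j * S e (i' div e) = j * S e (i div e)] (mod int d)"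
  proof (cases "i \<le> i'")
    case True
    with ii obtain t where "i' = i + k * t" by (rule cong_nat_leE)
    then show ?thesis using S_periodic[OF assms(1,2) ei j] by simp
  next
    case False
    then obtain t where "i = i' + k * t"
      using cong_nat_leE[OF cong_sym[OF ii]] by (meson nat_le_linear)
    then show ?thesis using S_periodic[OF assms(1,2) b(1) j] by (simp add: cong_sym_eq)
  qed
  then show "e dvd i \<and> [a = j * S e (i div e)] (mod int d)"
    using ei ab b(2) by (meson cong_trans)
qed (auto simp: Hsub_def)

lemma E_in_Hsub_0:
  assumes "d dvd m" "e dvd k" "j \<in> J d e"
  shows "E a 0 \<in> Hsub d e j \<longleftrightarrow> int d dvd a"
  using assms by (simp add: E_in_Hsub_iff cong_0_iff)

lemma Hsub_subset: "Hsub d e j \<subseteq> carrier G"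
  by (auto simp: Hsub_def)

lemma inv_E: "inv (E a i) = E (- (r ^ ((k - 1) * i) * a)) ((k - 1) * i)"
proof (rule inv_equality)
  have "E (- (r ^ ((k - 1) * i) * a)) ((k - 1) * i) \<otimes> E a i = E 0 (k * i)"
    using k_pos by (simp add: E_mult) (simp add: algebra_simps)
  also have "\<dots> = E 0 0" by (rule E_cong) (simp_all add: cong_def)
  finally show "E (- (r ^ ((k - 1) * i) * a)) ((k - 1) * i) \<otimes> E a i = \<one>" by (simp add: E_one)
qed simp_all

lemma subgroup_Hsub:
  assumes "d dvd m" "e dvd k" "j \<in> J d e"
  shows "subgroup (Hsub d e j) G"
proof (rule subgroupI)
  note mem = E_in_Hsub_iff[OF assms]
  have e: "e > 0" using assms(2) k_pos by (auto intro: Nat.gr0I)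
  show "Hsub d e j \<noteq> {}" using mem[of 0 0] by auto
  fix g assume g: "g \<in> Hsub d e j"
  then obtain a s where ga: "g = E a (e * s)" and a: "[a = j * S e s] (mod int d)"
    using e by (auto simp: Hsub_def)
  show "inv g \<in> Hsub d e j"
  proof -
    \<comment> \<open>The inverse has \<open>(k - 1) * s\<close> in the role of \<open>- s\<close>.
      By \<open>S_add\<close> the two contributions combine into a sum over \<open>k * s\<close>
      terms, a whole number of periods, which vanishes modulo \<open>d\<close>.\<close>
    have "j * S e ((k - 1) * s) + r ^ (e * ((k - 1) * s)) * (j * S e s) = j * S e ((k - 1) * s + s)"
      by (simp only: S_add distrib_left mult.left_commute)
    also have "\<dots> = j * S e ((0 + k * (e * s)) div e)"
      using e k_pos by (cases k) (simp_all add: mult.left_commute[of _ e] add.commute)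
    also have "[\<dots> = j * S e (0 div e)] (mod int d)"
      using assms by (intro S_periodic) (auto simp: J_def)
    finally have 1: "int d dvd j * S e ((k - 1) * s) + r ^ (e * ((k - 1) * s)) * (j * S e s)"
      by (simp add: cong_0_iff)
    have "[j * S e ((k - 1) * s) + r ^ (e * ((k - 1) * s)) * a =
        j * S e ((k - 1) * s) + r ^ (e * ((k - 1) * s)) * (j * S e s)] (mod int d)"
      using a by (intro cong_add cong_mult cong_refl)
    then have "int d dvd j * S e ((k - 1) * s) + r ^ (e * ((k - 1) * s)) * a"
      using 1 by (simp add: cong_dvd_iff)
    moreover have "- u - v = - (v + u)" for u v :: int by simp
    ultimately have "[- (r ^ (e * ((k - 1) * s)) * a) = j * S e ((k - 1) * s)] (mod int d)"
      by (simp only: cong_iff_dvd_diff dvd_minus_iff)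
    then have "E (- (r ^ (e * ((k - 1) * s)) * a)) (e * ((k - 1) * s)) \<in> Hsub d e j"
      using e by (simp add: mem)
    moreover have "(k - 1) * (e * s) = e * ((k - 1) * s)" by (rule mult.left_commute)
    ultimately show ?thesis unfolding ga inv_E by metis
  qed
  fix h assume "h \<in> Hsub d e j"
  then obtain b u where hb: "h = E b (e * u)" and b: "[b = j * S e u] (mod int d)"
    using e by (auto simp: Hsub_def)
  have "[a + r ^ (e * s) * b = j * S e s + r ^ (e * s) * (j * S e u)] (mod int d)"
    using a b by (intro cong_add cong_mult cong_refl)
  then have "[a + r ^ (e * s) * b = j * S e (s + u)] (mod int d)"
    by (simp only: S_add distrib_left mult.left_commute)
  then show "g \<otimes> h \<in> Hsub d e j"
    using e by (simp add: ga hb E_mult mem flip: add_mult_distrib2)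
qed (rule Hsub_subset)

lemma E_j_e_in_Hsub:
  assumes "d dvd m" "e dvd k" "j \<in> J d e"
  shows "E j e \<in> Hsub d e j"
proof -
  have "e > 0" using assms(2) k_pos by (auto intro: Nat.gr0I)
  then show ?thesis by (simp add: E_in_Hsub_iff[OF assms])
qed

lemma Hsub_inject:
  assumes "d dvd m" "e dvd k" "j \<in> J d e" and "d2 dvd m" "e' dvd k" "j' \<in> J d2 e'"
    and eq: "Hsub d e j = Hsub d2 e' j'"
  shows "d = d2 \<and> e = e' \<and> j = j'"
proof -
  have d: "int d dvd a \<longleftrightarrow> int d2 dvd a" for a
    using E_in_Hsub_0[OF assms(1-3), of a] E_in_Hsub_0[OF assms(4-6), of a] eq by simp
  have dd: "d = d2"
    using d[of "int d"] d[of "int d2"] by (simp add: dvd_antisym)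
  have "E j e \<in> Hsub d2 e' j'" "E j' e' \<in> Hsub d e j"
    using E_j_e_in_Hsub[OF assms(1-3)] E_j_e_in_Hsub[OF assms(4-6)] eq by simp_all
  then have e: "e' dvd e" "e dvd e'" and j: "[j = j' * S e' (e div e')] (mod int d2)"
    by (simp_all add: E_in_Hsub_iff[OF assms(1-3)] E_in_Hsub_iff[OF assms(4-6)])
  have ee: "e = e'" using e by (simp add: dvd_antisym)
  moreover have "e > 0" using assms(2) k_pos by (auto intro: Nat.gr0I)
  ultimately have "[j = j'] (mod int d2)" using j by simp
  then have "j = j'" using assms(3,6) dd by (simp add: J_def cong_def)
  then show ?thesis using dd ee by simp
qed

lemma subgroup_eq_Hsub:
  assumes H: "subgroup H G"
  obtains d e j where "d dvd m" "e dvd k" "j \<in> J d e" "H = Hsub d e j"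
proof -
  note mult = subgroup.m_closed[OF H] and inv = subgroup.m_inv_closed[OF H]
  have one: "E 0 0 \<in> H" using subgroup.one_closed[OF H] by (simp add: E_one)
  have m: "E (int m) 0 \<in> H"
    using one E_cong[of "int m" 0 0 0] by (simp add: cong_def)
  have D: "E (a - b) 0 \<in> H" if "E a i \<in> H" "E b i \<in> H" for a b i
  proof -
    have "E (a - b) 0 \<otimes> E b i = E a i" by (simp add: E_mult)
    then have "E (a - b) 0 = E a i \<otimes> inv (E b i)"
      by (metis E_closed inv_solve_right)
    then show ?thesis using mult inv that by simp
  qed
  obtain d where "d > 0" and d: "{a. E a 0 \<in> H} = {a. int d dvd a}"
    by (rule int_subgroup_dvd[of "int m" "{a. E a 0 \<in> H}"]) (use m m_pos D in auto)
  have d: "E a 0 \<in> H \<longleftrightarrow> int d dvd a" for a using d by blast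
  have dm: "d dvd m" using d[of "int m"] m by simp
  \<comment> \<open>Closing the exponents of \<open>y\<close> under congruence modulo
    \<open>k\<close> turns a set of naturals into a subgroup of the integers that contains
    \<open>k\<close>.\<close>
  let ?I = "{t. \<exists>a i. E a i \<in> H \<and> [int i = t] (mod int k)}"
  have k_I: "int k \<in> ?I" using one by (auto simp: cong_def intro!: exI[of _ 0])
  obtain e where "e > 0" and e: "?I = {t. int e dvd t}"
  proof (rule int_subgroup_dvd[of "int k" ?I])
    fix t t' assume "t \<in> ?I" "t' \<in> ?I"
    then obtain a i b i' where *: "E a i \<in> H" "E b i' \<in> H"
      and i: "[int i = t] (mod int k)" "[int i' = t'] (mod int k)" by blast
    have "E a i \<otimes> inv (E b i') \<in> H" using mult inv * by blast
    then obtain c where "E c (i + (k - 1) * i') \<in> H" unfolding inv_E E_mult by blast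
    moreover have "[int (i + (k - 1) * i') = t - t'] (mod int k)"
    proof -
      have "int (i + (k - 1) * i') = (int i - int i') + int k * int i'"
        using k_pos by (cases k) (simp_all add: algebra_simps)
      then have "[int (i + (k - 1) * i') = int i - int i'] (mod int k)"
        by (simp only: cong_def mod_mult_self2)
      then show ?thesis using cong_diff[OF i] by (rule cong_trans)
    qed
    ultimately show "t - t' \<in> ?I" by blast
  qed (use k_I k_pos in auto)
  have ek: "e dvd k" using k_I e by simp
  have e_dvd: "e dvd i" if "E a i \<in> H" for a i
  proof -
    have "int i \<in> ?I" using that cong_refl by blast
    then show ?thesis using e by simp
  qed
  have "int e \<in> ?I" using e by simp
  then obtain a0 i where "E a0 i \<in> H" "[i = e] (mod k)" by (auto simp: cong_int_iff)
  then have a0: "E a0 e \<in> H" using E_cong[OF cong_refl] by metis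
  \<comment> \<open>\<open>H\<close> determines \<open>a0\<close> only modulo \<open>d\<close>; the
    reduced representative differs from it by an element of \<open>H\<close> that is a power of
    \<open>x\<close>.\<close>
  define j where "j = a0 mod int d"
  have "E (j - a0) 0 \<in> H" unfolding d j_def by (simp add: mod_eq_dvd_iff[symmetric])
  then have "E (j - a0) 0 \<otimes> E a0 e \<in> H" using a0 by (rule mult)
  then have "E j e \<in> H" by (simp add: E_mult)
  have pow: "E (j * S e s) (e * s) \<in> H" for s
  proof (induction s)
    case (Suc s)
    have "E (j * S e s) (e * s) \<otimes> E j e \<in> H" using Suc \<open>E j e \<in> H\<close> by (rule mult)
    then show ?case by (simp add: E_mult S_Suc algebra_simps)
  qed (use one in simp)
  \<comment> \<open>Since \<open>y [^] k\<close> is trivial, the power of \<open>E j e\<close> with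
    exponent \<open>k div e\<close> is a power of \<open>x\<close> lying in \<open>H\<close>. This
    is exactly the condition defining \<open>J\<close>.\<close>
  have "E (j * S e (k div e)) 0 = E (j * S e (k div e)) (e * (k div e))"
    using ek by (intro E_cong) (simp_all add: cong_def)
  then have "int d dvd j * S e (k div e)" using pow d by metis
  then have j: "j \<in> J d e" using \<open>d > 0\<close> by (simp add: J_def j_def)
  have mem: "E a i \<in> H \<longleftrightarrow> e dvd i \<and> [a = j * S e (i div e)] (mod int d)" for a i
  proof (cases "e dvd i")
    case True
    then have i: "E (j * S e (i div e)) i \<in> H" using pow[of "i div e"] by simp
    have "E a i \<in> H \<longleftrightarrow> E (a - j * S e (i div e)) 0 \<in> H"
    proof
      assume "E (a - j * S e (i div e)) 0 \<in> H"
      from mult[OF this i] show "E a i \<in> H" by (simp add: E_mult)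
    qed (use D i in blast)
    then show ?thesis using True d by (simp add: cong_iff_dvd_diff)
  qed (use e_dvd in blast)
  have "H = Hsub d e j"
  proof (intro equalityI subsetI)
    fix g assume g: "g \<in> H"
    then obtain a i where "g = E a i" using subgroup.subset[OF H] by (meson carrierE subsetD)
    then show "g \<in> Hsub d e j" using g mem by (auto simp: Hsub_def)
  qed (auto simp: Hsub_def mem)
  then show ?thesis using that dm ek j by blast
qed

text \<open>The formula for \<open>j'\<close> is the solution of
  \<open>E u v \<otimes> E j e = E j' e \<otimes> E u v\<close>: the left side has first coordinate
  \<open>u + r ^ v * j\<close>, the right side \<open>j' + r ^ e * u\<close>.\<close>

lemma Hsub_conj:
  fixes u :: int and v :: nat
  assumes "d dvd m" "e dvd k" "j \<in> J d e"
  defines "j' \<equiv> (r ^ v * j + u * (1 - r ^ e)) mod int d"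
  shows "j' \<in> J d e" "E u v <# Hsub d e j #> inv (E u v) = Hsub d e j'"
proof -
  have d: "d > 0" using assms(1) m_pos by (auto intro: Nat.gr0I)
  have e: "e > 0" using assms(2) k_pos by (auto intro: Nat.gr0I)
  have rk: "[r ^ (k * n) = 1] (mod int d)" for n
    by (rule cong_dvd_modulus[OF r_pow_k_mult]) (simp add: assms(1))
  \<comment> \<open>The same formula holds for the \<open>s\<close>-th powers, with
    \<open>e * s\<close> in place of \<open>e\<close>; \<open>S_geometric\<close> absorbs the sum
    into \<open>1 - r ^ (e * s)\<close>.\<close>
  have j': "[j' * S e s = r ^ v * (j * S e s) + u * (1 - r ^ (e * s))] (mod int d)" for s
  proof -
    have "[j' * S e s = (r ^ v * j + u * (1 - r ^ e)) * S e s] (mod int d)"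
      unfolding j'_def by (intro cong_mult cong_refl) simp
    also have "(r ^ v * j + u * (1 - r ^ e)) * S e s = r ^ v * (j * S e s) + u * ((1 - r ^ e) * S e s)"
      by (simp add: distrib_right mult.assoc)
    finally show ?thesis by (simp only: S_geometric)
  qed
  have "int d dvd j * S e (k div e)" using assms(3) by (simp add: J_def)
  moreover have "int d dvd 1 - r ^ k" using cong_sym[OF rk[of 1]] by (simp add: cong_iff_dvd_diff)
  ultimately have "int d dvd r ^ v * (j * S e (k div e)) + u * (1 - r ^ k)"
    by (metis dvd_add dvd_mult)
  then show j'J: "j' \<in> J d e"
    using j'[of "k div e"] assms(2) d by (simp add: J_def cong_dvd_iff) (simp add: j'_def)
  show "E u v <# Hsub d e j #> inv (E u v) = Hsub d e j'"
  proof (rule conj_eqI)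
    fix h assume "h \<in> Hsub d e j"
    then obtain a s where h: "h = E a (e * s)" and a: "[a = j * S e s] (mod int d)"
      using e by (auto simp: Hsub_def)
    let ?b = "r ^ v * a + u * (1 - r ^ (e * s))"
    have "[?b = r ^ v * (j * S e s) + u * (1 - r ^ (e * s))] (mod int d)"
      using a by (intro cong_add cong_mult cong_refl)
    then have "[?b = j' * S e s] (mod int d)" using cong_sym[OF j'] by (rule cong_trans)
    then have "E ?b (e * s) \<in> Hsub d e j'"
      using e by (simp add: E_in_Hsub_iff[OF assms(1,2) j'J])
    moreover have "E u v \<otimes> h = E ?b (e * s) \<otimes> E u v"
      by (simp add: h E_mult algebra_simps)
    ultimately show "\<exists>h'\<in>Hsub d e j'. E u v \<otimes> h = h' \<otimes> E u v" by blast
  next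
    fix h' assume "h' \<in> Hsub d e j'"
    then obtain b s where h': "h' = E b (e * s)" and b: "[b = j' * S e s] (mod int d)"
      using e by (auto simp: Hsub_def)
    \<comment> \<open>The formula is solved for the original coordinate;
      \<open>r ^ ((k - 1) * v)\<close> inverts \<open>r ^ v\<close> modulo \<open>m\<close>.\<close>
    let ?a = "r ^ ((k - 1) * v) * (b - u * (1 - r ^ (e * s)))"
    have r: "r ^ v * (r ^ ((k - 1) * v) * c) = r ^ (k * v) * c" for c
      using k_pos by (cases k) (simp_all add: power_add)
    have "[b - u * (1 - r ^ (e * s)) = r ^ v * (j * S e s) + u * (1 - r ^ (e * s)) - u * (1 - r ^ (e * s))] (mod int d)"
      using cong_trans[OF b j'] by (intro cong_diff cong_refl)
    then have "[b - u * (1 - r ^ (e * s)) = r ^ v * (j * S e s)] (mod int d)" by simp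
    then have "[?a = r ^ ((k - 1) * v) * (r ^ v * (j * S e s))] (mod int d)"
      by (intro cong_mult cong_refl)
    also have "r ^ ((k - 1) * v) * (r ^ v * (j * S e s)) = r ^ (k * v) * (j * S e s)"
      by (simp only: mult.left_commute r)
    also have "[\<dots> = 1 * (j * S e s)] (mod int d)"
      using rk by (intro cong_mult cong_refl)
    finally have "E ?a (e * s) \<in> Hsub d e j"
      using e by (simp add: E_in_Hsub_iff[OF assms(1-3)])
    moreover have "E u v \<otimes> E ?a (e * s) = h' \<otimes> E u v"
    proof -
      have "[u + r ^ (k * v) * (b - u * (1 - r ^ (e * s))) = u + 1 * (b - u * (1 - r ^ (e * s)))] (mod int m)"
        using r_pow_k_mult by (intro cong_add cong_mult cong_refl)
      then have "[u + r ^ v * ?a = b + r ^ (e * s) * u] (mod int m)"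
        unfolding r by (simp add: algebra_simps)
      then show ?thesis unfolding h' E_mult by (intro E_cong) (simp_all add: add.commute)
    qed
    ultimately show "\<exists>h\<in>Hsub d e j. E u v \<otimes> h = h' \<otimes> E u v" by blast
  qed (simp_all add: Hsub_subset)
qed

section \<open>Counting formulas for metacyclic groups\<close>

definition params :: "((nat \<times> nat) \<times> int) set" where
  "params = (SIGMA (d, e) : {d. d dvd m} \<times> {e. e dvd k}. J d e)"

lemma bij_betw_params: "bij_betw (\<lambda>((d, e), j). Hsub d e j) params {H. subgroup H G}"
  unfolding bij_betw_def
proof (intro conjI inj_onI equalityI subsetI)
  fix t t' assume "t \<in> params" "t' \<in> params"
    and "(\<lambda>((d, e), j). Hsub d e j) t = (\<lambda>((d, e), j). Hsub d e j) t'"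
  then show "t = t'" using Hsub_inject by (auto simp: params_def)
next
  fix H assume "H \<in> {H. subgroup H G}"
  then obtain d e j where "d dvd m" "e dvd k" "j \<in> J d e" "H = Hsub d e j"
    using subgroup_eq_Hsub by blast
  then show "H \<in> (\<lambda>((d, e), j). Hsub d e j) ` params"
    by (intro image_eqI[of _ _ "((d, e), j)"]) (auto simp: params_def)
qed (auto simp: params_def subgroup_Hsub)

lemma card_params:
  assumes "\<And>d e. finite (A d e)"
  shows "card (SIGMA (d, e) : {d. d dvd m} \<times> {e. e dvd k}. A d e) =
    (\<Sum>d | d dvd m. \<Sum>e | e dvd k. card (A d e))"
  using m_pos k_pos assms by (subst card_SigmaI) (auto simp: sum.cartesian_product case_prod_unfold)

lemma card_subgroup_lattice:
  "card (subgroup_lattice G) = (\<Sum>d | d dvd m. \<Sum>e | e dvd k. card (J d e))"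
  using bij_betw_same_card[OF bij_betw_params] card_params[of J, OF finite_J]
  by (simp add: subgroup_lattice_def params_def)

text \<open>Conjugation never changes \<open>d\<close> and \<open>e\<close>, so for each such pair
  it suffices that \<open>c d e\<close> separates the orbits of the affine maps acting on the
  residues \<open>j\<close>.\<close>

lemma num_subgroup_classes:
  assumes c: "\<And>d e j j'. d dvd m \<Longrightarrow> e dvd k \<Longrightarrow> j \<in> J d e \<Longrightarrow> j' \<in> J d e \<Longrightarrow>
    c d e j = c d e j' \<longleftrightarrow> (\<exists>u v. [j' = r ^ v * j + u * (1 - r ^ e)] (mod int d))"
  shows "num_subgroup_classes G = (\<Sum>d | d dvd m. \<Sum>e | e dvd k. card (c d e ` J d e))"
proof -
  define C where "C = (\<lambda>((d, e), j). ((d, e), c d e j))"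
  have "num_subgroup_classes G = card (C ` params)"
  proof (rule num_subgroup_classes_eq[OF bij_betw_params])
    fix t t' assume "t \<in> params" "t' \<in> params"
    then obtain d e j d2 e' j' where t: "t = ((d, e), j)" "d dvd m" "e dvd k" "j \<in> J d e"
      and t': "t' = ((d2, e'), j')" "d2 dvd m" "e' dvd k" "j' \<in> J d2 e'"
      by (auto simp: params_def)
    have "(\<exists>g\<in>carrier G. Hsub d2 e' j' = g <# Hsub d e j #> inv g) \<longleftrightarrow>
        (\<exists>u v. Hsub d2 e' j' = Hsub d e ((r ^ v * j + u * (1 - r ^ e)) mod int d))"
      using Hsub_conj(2)[OF t(2-4)] by (metis E_closed carrierE)
    also have "\<dots> \<longleftrightarrow> (\<exists>u v. d = d2 \<and> e = e' \<and> j' = (r ^ v * j + u * (1 - r ^ e)) mod int d)"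
      using Hsub_inject[OF t'(2-4) t(2,3) Hsub_conj(1)[OF t(2-4)]] by metis
    also have "\<dots> \<longleftrightarrow> d = d2 \<and> e = e' \<and> (\<exists>u v. [j' = r ^ v * j + u * (1 - r ^ e)] (mod int d))"
    proof (cases "d = d2")
      case True
      then have "j' mod int d = j'" using t'(4) by (simp add: J_def)
      then show ?thesis using True by (simp add: cong_def)
    qed simp
    also have "\<dots> \<longleftrightarrow> C t = C t'"
    proof (cases "d = d2 \<and> e = e'")
      case True
      then have "j' \<in> J d e" using t'(4) by simp
      from c[OF t(2-4) this] show ?thesis using True by (simp add: C_def t t')
    qed (auto simp: C_def t t')
    finally show "C t = C t' \<longleftrightarrow> (\<exists>g\<in>carrier G. (\<lambda>((d, e), j). Hsub d e j) t' =
        g <# (\<lambda>((d, e), j). Hsub d e j) t #> inv g)"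
      by (simp add: t t')
  qed
  also have "C ` params = (SIGMA (d, e) : {d. d dvd m} \<times> {e. e dvd k}. c d e ` J d e)"
    by (force simp: C_def params_def image_iff)
  also have "card \<dots> = (\<Sum>d | d dvd m. \<Sum>e | e dvd k. card (c d e ` J d e))"
    by (rule card_params) (simp add: finite_J)
  finally show ?thesis .
qed

end

section \<open>Counting in the three metacyclic families\<close>

lemma sum_dvd_prime_power:
  fixes p :: nat
  assumes "prime p"
  shows "(\<Sum>d | d dvd p ^ a. f d) = (\<Sum>i\<le>a. f (p ^ i))"
proof -
  have "{d. d dvd p ^ a} = (\<lambda>i. p ^ i) ` {..a}"
    using divides_primepow_nat[OF assms] by auto
  moreover have "inj_on (\<lambda>i. p ^ i) {..a}"
    using prime_gt_1_nat[OF assms] by (intro inj_onI) simp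
  ultimately show ?thesis by (simp add: sum.reindex)
qed

lemma sum_dvd_prime:
  fixes p :: nat
  assumes "prime p"
  shows "(\<Sum>d | d dvd p. f d) = f 1 + f p"
  using sum_dvd_prime_power[OF assms, of f 1] by simp

text \<open>Every term of the binomial expansion beyond the linear one contains the factor
  \<open>c * c\<close>.\<close>

lemma one_plus_power_cong:
  fixes c M :: int
  assumes "M dvd c * c"
  shows "[(1 + c) ^ l = 1 + int l * c] (mod M)"
proof (induction l)
  case (Suc l)
  have "[(1 + c) ^ Suc l = (1 + c) * (1 + int l * c)] (mod M)"
    using Suc by (simp add: cong_scalar_left)
  moreover have "(1 + c) * (1 + int l * c) = 1 + int (Suc l) * c + int l * (c * c)"
    by (simp add: algebra_simps)
  moreover have "[1 + int (Suc l) * c + int l * (c * c) = 1 + int (Suc l) * c + 0] (mod M)"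
    using assms by (intro cong_add cong_refl) (simp add: cong_0_iff)
  ultimately show ?case by (metis add_0_right cong_trans)
qed simp

lemma multiples_eq_image:
  fixes P n :: int
  assumes "P > 0"
  shows "{j. 0 \<le> j \<and> j < n * P \<and> P dvd j} = (\<lambda>t. t * P) ` {0..<n}"
proof (intro equalityI subsetI)
  fix j assume j: "j \<in> {j. 0 \<le> j \<and> j < n * P \<and> P dvd j}"
  then obtain t where "j = t * P" by (auto simp: dvd_def mult.commute)
  then show "j \<in> (\<lambda>t. t * P) ` {0..<n}"
    using j assms by (auto simp: zero_le_mult_iff)
qed (use assms in auto)

context metacyclic
begin

lemma J_1: "J 1 e = {0}" "J (Suc 0) e = {0}"
  by (auto simp: J_def)

text \<open>The case \<open>e = k\<close> describes the subgroups of <x>: the geometric sum has the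
  single term 1, so \<open>d\<close> divides \<open>j\<close>.\<close>

lemma J_k:
  assumes "d > 0"
  shows "J d k = {0}"
  using assms k_pos by (auto simp: J_def dest: zdvd_imp_le)

text \<open>The geometric sum with \<open>p\<close> terms is divisible by \<open>p\<close> exactly
  once. For odd \<open>p\<close> it is congruent to p + p^b * p * (p - 1) / 2, and the second
  summand vanishes modulo \<open>m\<close> because (p - 1) / 2 is an integer. For
  \<open>p = 2\<close> it equals 2 * (1 + 2^(b - 1)), whose cofactor is odd only if b >= 2.\<close>

lemma modular_S:
  assumes p: "prime p" and b: "b \<ge> 1" "p = 2 \<Longrightarrow> b \<ge> 2"
    and m: "m = p ^ (b + 1)" and k: "k = p" and r: "r = 1 + int (p ^ b)"
  obtains w :: int where "coprime w (int p)" "[S 1 p = int p * w] (mod int m)"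
proof (cases "p = 2")
  case True
  then obtain b' where b': "b = Suc (Suc b')" using b by (metis add_2_eq_Suc le_Suc_ex)
  have "S 1 p = 1 + r" by (simp add: True S_def numeral_2_eq_2)
  then have "S 1 p = 2 + 2 ^ b" using r True by simp
  then have "S 1 p = int p * (1 + 2 ^ (b - 1))" by (simp add: b' True)
  moreover have "coprime (1 + 2 ^ (b - 1)) (int p)" by (simp add: True b')
  ultimately show ?thesis using that by simp
next
  case False
  let ?c = "int (p ^ b)"
  have "b + 1 \<le> b + b" using b by simp
  then have "int m dvd ?c * ?c" unfolding m
    by (simp add: le_imp_power_dvd flip: power_add del: power_Suc)
  then have "[S 1 p = (\<Sum>l<p. 1 + int l * ?c)] (mod int m)"
    unfolding S_def unfolding r by (intro cong_sum) (simp add: one_plus_power_cong)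
  also have "(\<Sum>l<p. 1 + int l * ?c) = int p + ?c * int (\<Sum>l<p. l)"
    by (simp add: sum.distrib mult.commute[of "int p ^ b"] flip: sum_distrib_right)
  also have "[int p + ?c * int (\<Sum>l<p. l) = int p + 0] (mod int m)"
  proof (intro cong_add cong_refl)
    have "odd p" using p False by (simp add: prime_odd_nat prime_ge_2_nat le_neq_implies_less)
    then obtain h where h: "p = 2 * h + 1" by (elim oddE)
    have "(\<Sum>l<p. l) = \<Sum>{0..2 * h}" by (simp add: h lessThan_Suc_atMost atLeast0AtMost)
    also have "\<dots> = p * h" using gauss_sum_nat[of "2 * h"] by (simp add: h algebra_simps)
    finally have "(\<Sum>l<p. l) = p * h" .
    then have "?c * int (\<Sum>l<p. l) = int m * int h" by (simp add: m)
    then show "[?c * int (\<Sum>l<p. l) = 0] (mod int m)" by (simp add: cong_def)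
  qed
  finally show ?thesis using that[of 1] by simp
qed

text \<open>For \<open>e = 1\<close> and \<open>d = p ^ Suc i\<close> the admissible
  \<open>j\<close> are the multiples of p^i, hence \<open>p\<close> of them, because the geometric
  sum supplies one factor \<open>p\<close>. If \<open>d\<close> divides p^b then \<open>r\<close> is
  1 modulo \<open>d\<close> and conjugation fixes every \<open>j\<close>. For \<open>d = m\<close>,
  conjugation by \<open>x\<close> shifts \<open>j\<close> by -p^b and fuses all \<open>p\<close>
  values.\<close>

lemma modular_counts:
  assumes p: "prime p" and b: "b \<ge> 1" "p = 2 \<Longrightarrow> b \<ge> 2"
    and m: "m = p ^ (b + 1)" and k: "k = p" and r: "r = 1 + int (p ^ b)"
  shows "card (subgroup_lattice G) = (b + 1) * (p + 1) + 2"
    and "num_subgroup_classes G = b * (p + 1) + 4"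
proof -
  have p0: "p > 0" using prime_gt_1_nat[OF p] by simp
  have Jp: "J (p ^ i) p = {0}" for i
    using J_k[of "p ^ i"] p0 by (simp add: k)
  have J1: "J (p ^ Suc i) 1 = (\<lambda>t. t * int p ^ i) ` {0..<int p}" if i: "i \<le> b" for i
  proof -
    obtain w where w: "coprime w (int p)" "[S 1 p = int p * w] (mod int m)"
      using modular_S[OF p b m k r] by blast
    have "int (p ^ Suc i) dvd int m"
      unfolding m int_dvd_int_iff using i by (intro le_imp_power_dvd) simp
    then have S: "[S 1 p = int p * w] (mod int (p ^ Suc i))"
      using w(2) by (rule cong_dvd_modulus[rotated])
    have "int (p ^ Suc i) dvd j * S 1 p \<longleftrightarrow> int p ^ i dvd j" for j
    proof -
      have "[j * S 1 p = j * (int p * w)] (mod int (p ^ Suc i))"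
        using S by (intro cong_mult cong_refl)
      then have "int (p ^ Suc i) dvd j * S 1 p \<longleftrightarrow> int (p ^ Suc i) dvd j * (int p * w)"
        by (rule cong_dvd_iff)
      also have "\<dots> \<longleftrightarrow> int p * int p ^ i dvd int p * (j * w)"
        by (simp add: mult.left_commute)
      also have "\<dots> \<longleftrightarrow> int p ^ i dvd j * w"
        using p0 by simp
      also have "\<dots> \<longleftrightarrow> int p ^ i dvd j"
        using w(1) by (simp add: coprime_dvd_mult_left_iff coprime_commute)
      finally show ?thesis .
    qed
    then have "J (p ^ Suc i) 1 = {j. 0 \<le> j \<and> j < int p * int p ^ i \<and> int p ^ i dvd j}"
      unfolding J_def by (simp add: k)
    also have "\<dots> = (\<lambda>t. t * int p ^ i) ` {0..<int p}"
      using p0 by (intro multiples_eq_image) simp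
    finally show ?thesis .
  qed
  have inj: "inj_on (\<lambda>t. t * int p ^ i) A" for i A
    using p0 by (auto intro!: inj_onI)
  have card_J1: "card (J (p ^ Suc i) 1) = p" if "i \<le> b" for i
    unfolding J1[OF that] by (simp add: card_image[OF inj])
  \<comment> \<open>The upper limit is left free: \<open>a = b + 1\<close> counts all subgroups, and
    \<open>a = b\<close> counts the classes with \<open>d \<noteq> m\<close>.\<close>
  have sub: "(\<Sum>i\<le>a. card (J (p ^ i) 1) + card (J (p ^ i) p)) = a * (p + 1) + 2" if "a \<le> b + 1" for a
    using that
  proof (induction a)
    case (Suc a)
    then show ?case using card_J1[of a] by (simp add: Jp)
  qed (simp add: Jp J_1)
  have sums: "(\<Sum>d | d dvd m. \<Sum>e | e dvd k. f d e) = (\<Sum>i\<le>b + 1. f (p ^ i) 1 + f (p ^ i) p)"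
    for f :: "nat \<Rightarrow> nat \<Rightarrow> nat"
    unfolding m k sum_dvd_prime_power[OF p] sum_dvd_prime[OF p] ..
  show "card (subgroup_lattice G) = (b + 1) * (p + 1) + 2"
    unfolding card_subgroup_lattice sums by (rule sub) simp
  define c where "c d e j = (if d = m \<and> e = 1 then 0 else j)" for d e :: nat and j :: int
  have "num_subgroup_classes G = (\<Sum>d | d dvd m. \<Sum>e | e dvd k. card (c d e ` J d e))"
  proof (rule num_subgroup_classes)
    fix d e j j'
    assume d: "d dvd m" and e: "e dvd k" and j: "j \<in> J d e" and j': "j' \<in> J d e"
    obtain i where i: "i \<le> b + 1" "d = p ^ i" using d p by (auto simp: m divides_primepow_nat simp del: power_Suc)
    have "e = 1 \<or> e = p" using e p unfolding k prime_nat_iff by blast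
    then consider "e = p" | "e = 1" "i = b + 1" | "e = 1" "i \<le> b"
      using i(1) by linarith
    then show "c d e j = c d e j' \<longleftrightarrow> (\<exists>u v. [j' = r ^ v * j + u * (1 - r ^ e)] (mod int d))"
    proof cases
      case 1
      then have "j = 0" "j' = 0" using j j' by (simp_all add: i Jp)
      then show ?thesis by (auto intro: exI[of _ 0])
    next
      case 2
      then obtain t t' where t: "j = t * int p ^ b" "j' = t' * int p ^ b"
        using j j' J1[of b] by (auto simp: i)
      \<comment> \<open>The witness is \<open>t - t'\<close> rather than \<open>t' - t\<close>
        because \<open>1 - r\<close> is minus p^b.\<close>
      have "j' = r ^ 0 * j + (t - t') * (1 - r ^ e)"
        by (simp add: t r 2 algebra_simps)
      then have "\<exists>u v. [j' = r ^ v * j + u * (1 - r ^ e)] (mod int d)"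
        by (metis cong_refl)
      then show ?thesis by (simp add: c_def 2 i m)
    next
      case 3
      have "int d dvd int (p ^ b)" unfolding i int_dvd_int_iff using 3 by (intro le_imp_power_dvd) simp
      then have "[1 + int (p ^ b) = 1 + 0] (mod int d)"
        by (intro cong_add cong_refl) (simp add: cong_0_iff del: of_nat_power)
      then have r1: "[r = 1] (mod int d)" by (simp add: r)
      have "[r ^ v * j + u * (1 - r ^ e) = 1 ^ v * j + u * (1 - 1 ^ e)] (mod int d)" for u v
        using r1 by (intro cong_add cong_mult cong_diff cong_pow cong_refl)
      then have "[j' = r ^ v * j + u * (1 - r ^ e)] (mod int d) \<longleftrightarrow> [j' = j] (mod int d)" for u v
        by (simp add: cong_def)
      moreover have "[j' = j] (mod int d) \<longleftrightarrow> j = j'"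
        using j j' by (auto simp: J_def cong_def)
      moreover have "d \<noteq> m" using 3 p0 prime_gt_1_nat[OF p] unfolding i m by (simp add: power_inject_exp del: power_Suc)
      ultimately show ?thesis by (simp add: c_def)
    qed
  qed
  also have "\<dots> = (\<Sum>i\<le>b + 1. card (c (p ^ i) 1 ` J (p ^ i) 1) + card (c (p ^ i) p ` J (p ^ i) p))"
    unfolding sums ..
  also have "\<dots> = (\<Sum>i\<le>b. card (c (p ^ i) 1 ` J (p ^ i) 1) + card (c (p ^ i) p ` J (p ^ i) p)) +
      (card (c m 1 ` J m 1) + card (c m p ` J m p))"
    by (simp add: m)
  also have "card (c m 1 ` J m 1) = 1"
  proof -
    have "J m 1 \<noteq> {}" using card_J1[of b] p0 by (auto simp: m)
    then have "c m 1 ` J m 1 = {0}" by (auto simp: c_def)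
    then show ?thesis by simp
  qed
  also have "c m p ` J m p = {c m p 0}" using Jp[of "b + 1"] by (simp add: m)
  also have "(\<Sum>i\<le>b. card (c (p ^ i) 1 ` J (p ^ i) 1) + card (c (p ^ i) p ` J (p ^ i) p)) =
      (\<Sum>i\<le>b. card (J (p ^ i) 1) + card (J (p ^ i) p))"
  proof (rule sum.cong)
    fix i assume "i \<in> {..b}"
    then have "p ^ i \<noteq> m" using prime_gt_1_nat[OF p] unfolding m by (simp add: power_inject_exp del: power_Suc)
    then have "c (p ^ i) e = (\<lambda>j. j)" for e by (auto simp: c_def)
    then show "card (c (p ^ i) 1 ` J (p ^ i) 1) + card (c (p ^ i) p ` J (p ^ i) p) =
        card (J (p ^ i) 1) + card (J (p ^ i) p)" by simp
  qed simp
  finally show "num_subgroup_classes G = b * (p + 1) + 4"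
    using sub[of b] by simp
qed

text \<open>For \<open>e = 1\<close> the sum 1 + r vanishes, so all \<open>d\<close> residues are
  admissible, and conjugation sends \<open>j\<close> to one of j + 2u, -j + 2u. Thus parity is the
  complete invariant, with two values except for \<open>d = 1\<close>.\<close>

lemma dihedral_counts:
  assumes m: "m = 2 ^ a" and k: "k = 2" and r: "r = - 1"
  shows "card (subgroup_lattice G) = 2 ^ (a + 1) + a"
    and "num_subgroup_classes G = 3 * a + 2"
proof -
  have J2: "J (2 ^ i) 2 = {0}" for i
    using J_k[of "2 ^ i"] by (simp add: k)
  have "S 1 2 = 1 + r" by (simp add: S_def numeral_2_eq_2)
  then have S: "S 1 2 = 0" using r by simp
  have J1: "J d 1 = {0..<int d}" for d
    using S unfolding J_def by (auto simp: k)
  then have card_J1: "card (J d 1) = d" for d by simp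
  have sums: "(\<Sum>d | d dvd m. \<Sum>e | e dvd k. f d e) = (\<Sum>i\<le>a. f (2 ^ i) 1 + f (2 ^ i) 2)"
    for f :: "nat \<Rightarrow> nat \<Rightarrow> nat"
    unfolding m k sum_dvd_prime_power[OF two_is_prime_nat] sum_dvd_prime[OF two_is_prime_nat] ..
  have "(\<Sum>i\<le>a. (2::nat) ^ i + 1) = 2 ^ (a + 1) + a" for a
    by (induction a) simp_all
  from this[of a] show "card (subgroup_lattice G) = 2 ^ (a + 1) + a"
    unfolding card_subgroup_lattice sums card_J1 by (simp add: J2)
  define c where "c d e j = j mod 2" for d e :: nat and j :: int
  have "num_subgroup_classes G = (\<Sum>d | d dvd m. \<Sum>e | e dvd k. card (c d e ` J d e))"
  proof (rule num_subgroup_classes)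
    fix d e j j'
    assume d: "d dvd m" and e: "e dvd k" and j: "j \<in> J d e" and j': "j' \<in> J d e"
    obtain i where i: "d = 2 ^ i" using d by (auto simp: m divides_primepow_nat)
    consider "e = 2" | "e = 1"
      using e two_is_prime_nat unfolding k prime_nat_iff by blast
    then show "c d e j = c d e j' \<longleftrightarrow> (\<exists>u v. [j' = r ^ v * j + u * (1 - r ^ e)] (mod int d))"
    proof cases
      case 1
      then have "j = 0" "j' = 0" using j j' by (simp_all add: i J2)
      then show ?thesis by (auto intro: exI[of _ 0])
    next
      case 2
      show ?thesis
      proof
        assume "c d e j = c d e j'"
        then have "2 dvd j' - j" by (simp add: c_def mod_eq_dvd_iff)
        then obtain u where "j' - j = 2 * u" by (elim dvdE)
        then have "j' = r ^ 0 * j + u * (1 - r ^ e)" by (simp add: 2 r)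
        then show "\<exists>u v. [j' = r ^ v * j + u * (1 - r ^ e)] (mod int d)" by (metis cong_refl)
      next
        assume "\<exists>u v. [j' = r ^ v * j + u * (1 - r ^ e)] (mod int d)"
        then obtain u v where uv: "[j' = r ^ v * j + u * (1 - r ^ e)] (mod int d)" by blast
        show "c d e j = c d e j'"
        \<comment> \<open>A congruence modulo \<open>d\<close> preserves parity only if
          \<open>d\<close> is even; for \<open>d = 1\<close> both residues are 0.\<close>
        proof (cases i)
          case 0
          then show ?thesis using j j' by (simp add: 2 J_1 i)
        next
          case (Suc i')
          have "2 dvd int d" by (simp add: i Suc)
          with uv have "[j' = r ^ v * j + u * (1 - r ^ e)] (mod 2)" by (rule cong_dvd_modulus)
          then have "even (j' - (r ^ v * j + u * (1 - r ^ e)))" by (simp add: cong_iff_dvd_diff)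
          then show ?thesis by (auto simp: c_def 2 r mod_eq_dvd_iff)
        qed
      qed
    qed
  qed
  also have "\<dots> = (\<Sum>i\<le>a. (if i = 0 then 1 else 2) + 1)"
    unfolding sums
  proof (rule sum.cong)
    fix i
    have "c (2 ^ i) 1 ` J (2 ^ i) 1 = (if i = 0 then {0} else {0, 1})"
    proof (cases i)
      case (Suc i')
      have "(1::int) \<le> 2 ^ i'" by simp
      then have "(1::int) < 2 * 2 ^ i'" by linarith
      then have "{0, 1} \<subseteq> {0..<int (2 ^ i)}" by (auto simp: Suc)
      then have "(\<lambda>j. j mod 2) ` {0, 1} \<subseteq> c (2 ^ i) 1 ` J (2 ^ i) 1"
        unfolding J1 c_def by (rule image_mono)
      moreover have "c (2 ^ i) 1 ` J (2 ^ i) 1 \<subseteq> {0, 1}" by (auto simp: c_def)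
      ultimately show ?thesis by (auto simp: Suc)
    qed (simp add: J_1 c_def)
    then show "card (c (2 ^ i) 1 ` J (2 ^ i) 1) + card (c (2 ^ i) 2 ` J (2 ^ i) 2) =
        (if i = 0 then 1 else 2) + 1"
      by (simp add: J2)
  qed simp
  also have "\<dots> = 3 * a + 2" by (induction a) simp_all
  finally show "num_subgroup_classes G = 3 * a + 2" .
qed

text \<open>Here \<open>1 - r\<close> is a unit modulo \<open>p\<close>. For \<open>e = 1\<close>
  the product of \<open>1 - r\<close> with the geometric sum is 1 - r^k, hence zero modulo
  \<open>p\<close>, and all \<open>p\<close> residues occur. If \<open>q\<close> divides
  \<open>e\<close> then r^e is 1 modulo \<open>p\<close>, so the sum is congruent to its number of
  terms, a power of \<open>q\<close> prime to \<open>p\<close>, and only \<open>j = 0\<close>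
  survives.\<close>

lemma Gpqn_counts:
  assumes p: "prime p" and q: "prime q" and "q \<noteq> p"
    and m: "m = p" and k: "k = q ^ a" and r: "[r ^ q = 1] (mod int p)" "\<not> [r = 1] (mod int p)"
  shows "card (subgroup_lattice G) = 2 * a + 1 + p"
    and "num_subgroup_classes G = 2 * a + 2"
proof -
  have p0: "p > 1" using prime_gt_1_nat[OF p] by simp
  have pr: "coprime (1 - r) (int p)"
    using p r(2) by (metis cong_iff_dvd_diff coprime_commute dvd_minus_iff minus_diff_eq prime_imp_coprime prime_nat_int_transfer)
  have Jp: "J p (q ^ Suc i) = {0}" if i: "Suc i \<le> a" for i
  proof -
    have "[r ^ q ^ Suc i = 1] (mod int p)"
      using cong_pow[OF r(1), of "q ^ i"] by (simp add: power_mult)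
    then have "[r ^ (q ^ Suc i * l) = 1] (mod int p)" for l
      using cong_pow[of "r ^ q ^ Suc i" 1 "int p" l] by (simp add: power_mult del: power_Suc)
    then have "[S (q ^ Suc i) s = (\<Sum>l<s. 1)] (mod int p)" for s
      unfolding S_def by (intro cong_sum)
    moreover have "k div q ^ Suc i = q ^ (a - Suc i)"
      using i prime_gt_0_nat[OF q] by (simp add: k power_diff del: power_Suc)
    ultimately have S: "[S (q ^ Suc i) (k div q ^ Suc i) = int (q ^ (a - Suc i))] (mod int p)"
      by (metis sum_constant card_lessThan mult.right_neutral)
    have "coprime p q" using p q \<open>q \<noteq> p\<close> by (simp add: primes_coprime)
    then have cop: "coprime (int p) (int (q ^ (a - Suc i)))" by simp
    have "int p dvd j * S (q ^ Suc i) (k div q ^ Suc i) \<longleftrightarrow> int p dvd j" for j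
    proof -
      have "[j * S (q ^ Suc i) (k div q ^ Suc i) = j * int (q ^ (a - Suc i))] (mod int p)"
        using S by (intro cong_mult cong_refl)
      then have "int p dvd j * S (q ^ Suc i) (k div q ^ Suc i) \<longleftrightarrow> int p dvd j * int (q ^ (a - Suc i))"
        by (rule cong_dvd_iff)
      also have "\<dots> \<longleftrightarrow> int p dvd j" using cop by (rule coprime_dvd_mult_left_iff)
      finally show ?thesis .
    qed
    then show ?thesis using p0 by (auto simp: J_def dest: zdvd_imp_le simp del: power_Suc)
  qed
  have Jp1: "J p 1 = {0..<int p}"
  proof -
    have "(1 - r) * S 1 k = 1 - r ^ k" using S_geometric[of 1 k] by simp
    moreover have "int p dvd 1 - r ^ k"
      using cong_sym[OF r_pow_k] by (simp only: m cong_iff_dvd_diff)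
    moreover have "coprime (int p) (1 - r)" using pr by (rule coprime_imp_coprime) blast+
    ultimately have "int p dvd S 1 k" by (metis coprime_dvd_mult_right_iff)
    then show ?thesis unfolding J_def by auto
  qed
  have sums: "(\<Sum>d | d dvd m. \<Sum>e | e dvd k. f d e) =
      (\<Sum>i\<le>a. f 1 (q ^ i)) + (f p 1 + (\<Sum>i<a. f p (q ^ Suc i)))"
    for f :: "nat \<Rightarrow> nat \<Rightarrow> nat"
    unfolding m k sum_dvd_prime_power[OF q] sum_dvd_prime[OF p]
    by (simp add: sum.atMost_shift del: power_Suc)
  have Jps: "(\<Sum>i<a. card (f i ` J p (q ^ Suc i))) = a" for f :: "nat \<Rightarrow> int \<Rightarrow> int"
    using Jp by (simp add: Suc_le_eq del: power_Suc)
  show "card (subgroup_lattice G) = 2 * a + 1 + p"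
    unfolding card_subgroup_lattice sums using Jps[of "\<lambda>_ j. j"]
    by (simp add: J_1 Jp1[unfolded One_nat_def] del: power_Suc)
  define c where "c d e j = (if d = p \<and> e = 1 then 0 else j)" for d e :: nat and j :: int
  have "num_subgroup_classes G = (\<Sum>d | d dvd m. \<Sum>e | e dvd k. card (c d e ` J d e))"
  proof (rule num_subgroup_classes)
    fix d e j j'
    assume d: "d dvd m" and e: "e dvd k" and j: "j \<in> J d e" and j': "j' \<in> J d e"
    obtain i where i: "i \<le> a" "e = q ^ i" using e q by (auto simp: k divides_primepow_nat)
    show "c d e j = c d e j' \<longleftrightarrow> (\<exists>u v. [j' = r ^ v * j + u * (1 - r ^ e)] (mod int d))"
    proof (cases "d = p \<and> e = 1")
      case True
      \<comment> \<open>With \<open>z\<close> inverse to \<open>1 - r\<close>, conjugation by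
        \<open>x\<close> to the power \<open>(j' - j) * z\<close> moves \<open>j\<close> to
        \<open>j'\<close>.\<close>
      obtain z where z: "[(1 - r) * z = 1] (mod int p)" using cong_solve_coprime_int[OF pr] by blast
      have "[j + (j' - j) * ((1 - r) * z) = j + (j' - j) * 1] (mod int p)"
        using z by (intro cong_add cong_mult cong_refl)
      then have "[j' = r ^ 0 * j + ((j' - j) * z) * (1 - r ^ e)] (mod int d)"
        using True by (simp add: cong_sym_eq mult.assoc mult.commute[of z])
      then have "\<exists>u v. [j' = r ^ v * j + u * (1 - r ^ e)] (mod int d)" by blast
      then show ?thesis using True by (simp add: c_def)
    next
      case False
      have "J d e = {0}"
      proof (cases "d = 1")
        case False
        then have "d = p" using d p by (auto simp: m prime_nat_iff)
        moreover from this have "i \<noteq> 0" using \<open>\<not> (d = p \<and> e = 1)\<close> i by (auto intro: Nat.gr0I)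
        ultimately show ?thesis using Jp[of "i - 1"] i by simp
      qed (simp add: J_1)
      then have "j = 0" "j' = 0" using j j' by simp_all
      then show ?thesis by (auto intro: exI[of _ 0])
    qed
  qed
  also have "\<dots> = 2 * a + 2"
  proof -
    have "c p 1 ` J p 1 = {0}" unfolding Jp1 using p0 by (simp add: c_def image_constant_conv)
    then show ?thesis unfolding sums using Jps[of "\<lambda>i. c p (q ^ Suc i)"] by (simp add: J_1 del: power_Suc)
  qed
  finally show "num_subgroup_classes G = 2 * a + 2" .
qed

end

section \<open>Presentations of the modular and dihedral groups\<close>

text \<open>Left multiplication by the generators in the coordinates of \<open>E a i\<close>: moving
  \<open>y\<close> past a power of \<open>x\<close> multiplies the exponent by
  \<open>r\<close>.\<close>

definition metacyclic_step :: "nat \<Rightarrow> nat \<Rightarrow> int \<Rightarrow> gen2 \<Rightarrow> int \<times> int \<Rightarrow> int \<times> int" where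
  "metacyclic_step m k r g = (\<lambda>(a, i). case g of
     gx \<Rightarrow> ((a + 1) mod int m, i) | gy \<Rightarrow> ((r * a) mod int m, (i + 1) mod int k))"

lemma metacyclic_step_simps [simp]:
  "metacyclic_step m k r gx (a, i) = ((a + 1) mod int m, i)"
  "metacyclic_step m k r gy (a, i) = ((r * a) mod int m, (i + 1) mod int k)"
  by (simp_all add: metacyclic_step_def)

lemma mod_add_1_inj:
  assumes "(a + 1) mod n = (b + 1) mod n" "0 \<le> a" "a < n" "0 \<le> b" "b < (n::int)"
  shows "a = b"
proof -
  have "[a + 1 = b + 1] (mod n)" using assms(1) by (simp add: cong_def)
  then have "[a = b] (mod n)" by (simp add: cong_add_rcancel)
  then show ?thesis using assms by (simp add: cong_def)
qed

text \<open>\<open>r\<close> is a unit modulo \<open>m\<close> because a positive power of it is 1,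
  so the maps are injective, and the box is finite.\<close>

lemma bij_metacyclic_step:
  assumes "m > 0" "k > 0" and r: "[r ^ k = 1] (mod int m)"
  shows "bij_betw (metacyclic_step m k r g) ({0..<int m} \<times> {0..<int k}) ({0..<int m} \<times> {0..<int k})"
proof -
  let ?X = "{0..<int m} \<times> {0..<int k}"
  have "coprime (r ^ k) (int m)"
    using cong_imp_coprime[OF cong_sym[OF r]] by simp
  then have cop: "coprime r (int m)" using assms(2) by simp
  have "inj_on (metacyclic_step m k r g) ?X"
  proof (rule inj_onI)
    fix s t assume s: "s \<in> ?X" and t: "t \<in> ?X" and eq: "metacyclic_step m k r g s = metacyclic_step m k r g t"
    obtain a i b j where st: "s = (a, i)" "t = (b, j)" by fastforce
    show "s = t"
    proof (cases g)
      case gx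
      then show ?thesis using s t eq mod_add_1_inj[of a "int m" b] by (simp add: st)
    next
      case gy
      then have ra: "[r * a = r * b] (mod int m)" and ij: "(i + 1) mod int k = (j + 1) mod int k"
        using eq by (simp_all add: st cong_def)
      have "[a = b] (mod int m)" using ra cop by (simp add: cong_mult_lcancel)
      then have "a = b" using s t by (simp add: st cong_def)
      then show ?thesis using s t mod_add_1_inj[OF ij] by (simp add: st)
    qed
  qed
  moreover have "metacyclic_step m k r g ` ?X \<subseteq> ?X"
    using assms by (cases g) auto
  ultimately show ?thesis by (simp add: bij_betw_def endo_inj_surj)
qed

lemma metacyclic_step_gx_pow:
  assumes "a \<in> {0..<int m}"
  shows "(metacyclic_step m k r gx ^^ t) (a, i) = ((a + int t) mod int m, i)"
  using assms by (induction t) (simp_all add: mod_add_left_eq add.assoc add.commute[of 1] mod_simps)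

lemma metacyclic_step_gy_pow:
  assumes "a \<in> {0..<int m}" "i \<in> {0..<int k}"
  shows "(metacyclic_step m k r gy ^^ t) (a, i) = ((r ^ t * a) mod int m, (i + int t) mod int k)"
  using assms by (induction t) (simp_all add: mod_mult_right_eq mult.assoc add.assoc add.commute[of 1] mod_simps)

text \<open>The normal forms are stable under left multiplication by the generators and their
  inverses, hence exhaust the group. A normal form that is trivial in the group must fix
  \<open>(0, 0)\<close>, yet it moves this point to its own reduced coordinates.\<close>

lemma metacyclic_presented_group:
  fixes R :: "(gen2 word \<times> gen2 word) set" and r :: int
  defines "X \<equiv> word_class R (gen gx)" and "Y \<equiv> word_class R (gen gy)"
  assumes m: "m > 0" and k: "k > 0" and r: "[r ^ k = 1] (mod int m)"
    and x_pow: "X [^]\<^bsub>presented_group R\<^esub> m = \<one>\<^bsub>presented_group R\<^esub>"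
    and y_pow: "Y [^]\<^bsub>presented_group R\<^esub> k = \<one>\<^bsub>presented_group R\<^esub>"
    and yx: "Y \<otimes>\<^bsub>presented_group R\<^esub> X = X [^]\<^bsub>presented_group R\<^esub> r \<otimes>\<^bsub>presented_group R\<^esub> Y"
    and act: "\<And>u v s. (u, v) \<in> R \<Longrightarrow> s \<in> {0..<int m} \<times> {0..<int k} \<Longrightarrow>
      word_act (metacyclic_step m k r) ({0..<int m} \<times> {0..<int k}) u s =
      word_act (metacyclic_step m k r) ({0..<int m} \<times> {0..<int k}) v s"
  shows "metacyclic (presented_group R) X Y m k r"
proof -
  let ?G = "presented_group R" and ?X = "{0..<int m} \<times> {0..<int k}"
  interpret metacyclic_relations ?G X Y m k r
    using m k x_pow y_pow yx
    by (intro metacyclic_relations.intro metacyclic_relations_axioms.intro group_presented_group)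
      (simp_all add: X_def Y_def)
  show ?thesis
  proof
    show "carrier ?G \<subseteq> range (\<lambda>(a, i). E a i)"
    proof
      fix A assume "A \<in> carrier ?G"
      then show "A \<in> range (\<lambda>(a, i). E a i)"
      proof (rule presented_group_induct)
        show "\<one>\<^bsub>?G\<^esub> \<in> range (\<lambda>(a, i). E a i)"
          using E_one(1) by (metis (mono_tags, lifting) case_prod_conv rangeI)
      next
        fix g B assume "B \<in> range (\<lambda>(a, i). E a i)"
        then obtain a i where B: "B = E a i" by auto
        have XY: "word_class R (gen gx) = E 1 0" "word_class R (gen gy) = E 0 1"
          by (simp_all add: E_one flip: X_def Y_def)
        show "word_class R (gen g) \<otimes>\<^bsub>?G\<^esub> B \<in> range (\<lambda>(a, i). E a i)"
          by (cases g) (auto simp: B XY E_mult)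
        have "inv\<^bsub>?G\<^esub> word_class R (gen gx) = E (-1) 0" "inv\<^bsub>?G\<^esub> word_class R (gen gy) = E 0 (k - 1)"
          using inv_x inv_y by (simp_all add: X_def Y_def)
        then show "inv\<^bsub>?G\<^esub> word_class R (gen g) \<otimes>\<^bsub>?G\<^esub> B \<in> range (\<lambda>(a, i). E a i)"
          by (cases g) (auto simp: B E_mult)
      qed
    qed
    fix a i assume E: "E a i = \<one>\<^bsub>?G\<^esub>"
    \<comment> \<open>Words have natural powers only, so the exponent of \<open>x\<close> is first
      reduced to a nonnegative residue.\<close>
    define t where "t = nat (a mod int m)"
    have t: "int t = a mod int m" using m by (simp add: t_def)
    have "E a i = E (int t) i" by (rule E_cong) (simp_all add: t)
    also have "\<dots> = word_class R (word_pow (gen gx) t @ word_pow (gen gy) i)"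
      unfolding E_def unfolding X_def Y_def
      by (simp add: int_pow_int word_class_word_pow flip: mult_presented_group)
    finally have "word_class R (word_pow (gen gx) t @ word_pow (gen gy) i) = word_class R []"
      using E by (simp add: one_presented_group)
    then have eq: "pres_eq R (word_pow (gen gx) t @ word_pow (gen gy) i) []"
      by (simp only: word_class_eq_iff)
    have "word_act (metacyclic_step m k r) ?X (word_pow (gen gx) t @ word_pow (gen gy) i) (0, 0) =
        word_act (metacyclic_step m k r) ?X [] (0, 0)"
      by (rule pres_eq_word_act[OF bij_metacyclic_step[OF m k r] act eq]) (use m k in auto)
    moreover have "word_act (metacyclic_step m k r) ?X (gen g) = metacyclic_step m k r g" for g
      by (rule ext) simp
    ultimately have "(int t mod int m, int i mod int k) = (0, 0)"
      using m k by (simp add: word_act_word_pow metacyclic_step_gx_pow metacyclic_step_gy_pow)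
    then show "int m dvd a \<and> k dvd i"
      by (simp add: t flip: zmod_int)
         (auto simp flip: zmod_int of_nat_mod)
  qed
qed

text \<open>Writing \<open>b\<close> for n - 2 avoids truncated subtraction. The congruence of r^p
  with 1 holds because r^p is 1 + p * p^b modulo \<open>m\<close>, and \<open>m\<close> is p^(b +
  1).\<close>

lemma metacyclic_modular_group:
  assumes p: "prime p" and b: "b \<ge> 1"
  obtains x y where "metacyclic (modular_group p (b + 2)) x y (p ^ (b + 1)) p (1 + int (p ^ b))"
proof -
  define R where "R = {(word_pow (gen gx) (p ^ (b + 1)), []),
      (word_pow (gen gy) p, []),
      (gen gy @ gen gx, word_pow (gen gx) (p ^ b + 1) @ gen gy)}"
  have G: "modular_group p (b + 2) = presented_group R"
    by (simp add: modular_group_def R_def)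
  let ?m = "p ^ (b + 1)" and ?r = "1 + int (p ^ b)"
  have p0: "p > 0" using prime_gt_1_nat[OF p] by simp
  interpret group "presented_group R" by (rule group_presented_group)
  have "b + 1 \<le> b + b" using b by simp
  then have "int ?m dvd int (p ^ b) * int (p ^ b)"
    by (simp add: le_imp_power_dvd flip: power_add del: power_Suc)
  then have "[?r ^ p = 1 + int p * int (p ^ b)] (mod int ?m)" by (rule one_plus_power_cong)
  then have r: "[?r ^ p = 1] (mod int ?m)" by (simp add: cong_def)
  have "metacyclic (presented_group R) (word_class R (gen gx)) (word_class R (gen gy)) ?m p ?r"
  proof (rule metacyclic_presented_group[OF _ p0 r])
    show "?m > 0" using p0 by simp
    show "word_class R (gen gx) [^]\<^bsub>presented_group R\<^esub> ?m = \<one>\<^bsub>presented_group R\<^esub>"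
      unfolding word_class_word_pow[symmetric] one_presented_group by (rule word_class_rel) (simp add: R_def)
    show "word_class R (gen gy) [^]\<^bsub>presented_group R\<^esub> p = \<one>\<^bsub>presented_group R\<^esub>"
      unfolding word_class_word_pow[symmetric] one_presented_group by (rule word_class_rel) (simp add: R_def)
    have "?r = int (p ^ b + 1)" by simp
    then show "word_class R (gen gy) \<otimes>\<^bsub>presented_group R\<^esub> word_class R (gen gx) =
        word_class R (gen gx) [^]\<^bsub>presented_group R\<^esub> ?r \<otimes>\<^bsub>presented_group R\<^esub> word_class R (gen gy)"
      unfolding int_pow_int word_class_word_pow[symmetric] mult_presented_group
      by (simp only: int_pow_int word_class_word_pow[symmetric] mult_presented_group)
        (rule word_class_rel, simp add: R_def)
  next
    fix u v s
    let ?X = "{0..<int ?m} \<times> {0..<int p}"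
    assume uv: "(u, v) \<in> R" and "s \<in> ?X"
    then obtain a i where s: "s = (a, i)" "a \<in> {0..<int ?m}" "i \<in> {0..<int p}" by auto
    have gen: "word_act (metacyclic_step ?m p ?r) ?X (gen g) = metacyclic_step ?m p ?r g" for g
      by (rule ext) simp
    note xpow = metacyclic_step_gx_pow[of _ ?m] and ypow = metacyclic_step_gy_pow[of _ ?m _ p]
    consider "u = word_pow (gen gx) ?m" "v = []" | "u = word_pow (gen gy) p" "v = []"
      | "u = gen gy @ gen gx" "v = word_pow (gen gx) (p ^ b + 1) @ gen gy"
      using uv by (auto simp: R_def)
    then show "word_act (metacyclic_step ?m p ?r) ?X u s = word_act (metacyclic_step ?m p ?r) ?X v s"
    proof cases
      case 1
      show ?thesis unfolding 1 word_act_word_pow gen s(1) xpow[OF s(2)] word_act_simps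
        using s(2) by simp
    next
      case 2
      have "[?r ^ p * a = 1 * a] (mod int ?m)" using r by (intro cong_mult cong_refl)
      then have "(?r ^ p * a) mod int ?m = a" using s(2) by (simp add: cong_def)
      moreover have "(i + int p) mod int p = i" using s(3) by simp
      ultimately show ?thesis unfolding 2 word_act_word_pow gen s(1) ypow[OF s(2,3)] word_act_simps
        by simp
    next
      case 3
      have mem: "?r * a mod int ?m \<in> {0..<int ?m}" using p0 by simp
      \<comment> \<open>Both sides of the relation send the first coordinate \<open>a\<close> to r *
        a + r.\<close>
      have "\<rho> * ((a + 1) mod \<mu>) mod \<mu> = (\<rho> * a mod \<mu> + \<rho>) mod \<mu>" for \<rho> \<mu> :: int
        by (simp add: mod_simps distrib_left)
      from this[of ?r "int ?m"]
      have "?r * ((a + 1) mod int ?m) mod int ?m = (?r * a mod int ?m + int (p ^ b + 1)) mod int ?m"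
        by (simp add: add.commute)
      then show ?thesis
        unfolding 3 word_act_simps word_act_word_pow gen s(1) metacyclic_step_simps xpow[OF mem] by simp
    qed
  qed
  then show ?thesis unfolding G[symmetric] by (rule that)
qed

lemma metacyclic_dihedral_group:
  assumes m: "m > 0"
  obtains x y where "metacyclic (dihedral_group m) x y m 2 (-1)"
proof -
  define R where "R = {(word_pow (gen gx) m, []),
      (word_pow (gen gy) 2, []),
      (gen gy @ gen gx @ word_inv (gen gy), word_inv (gen gx))}"
  have G: "dihedral_group m = presented_group R"
    by (simp add: dihedral_group_def R_def)
  interpret group "presented_group R" by (rule group_presented_group)
  let ?x = "word_class R (gen gx)" and ?y = "word_class R (gen gy)"
  have r: "[(-1) ^ 2 = 1] (mod int m)" by simp
  have two: "(2::nat) > 0" by simp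
  have "metacyclic (presented_group R) ?x ?y m 2 (-1)"
  proof (rule metacyclic_presented_group[OF m two r])
    show "?x [^]\<^bsub>presented_group R\<^esub> m = \<one>\<^bsub>presented_group R\<^esub>"
      unfolding word_class_word_pow[symmetric] one_presented_group by (rule word_class_rel) (simp add: R_def)
    show "?y [^]\<^bsub>presented_group R\<^esub> (2::nat) = \<one>\<^bsub>presented_group R\<^esub>"
      unfolding word_class_word_pow[symmetric] one_presented_group by (rule word_class_rel) (simp add: R_def)
    have "?y \<otimes>\<^bsub>presented_group R\<^esub> (?x \<otimes>\<^bsub>presented_group R\<^esub> inv\<^bsub>presented_group R\<^esub> ?y) =
        inv\<^bsub>presented_group R\<^esub> ?x"
      unfolding word_class_word_inv[symmetric] mult_presented_group
      by (rule word_class_rel) (simp add: R_def)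
    then have "(?y \<otimes>\<^bsub>presented_group R\<^esub> ?x) \<otimes>\<^bsub>presented_group R\<^esub> inv\<^bsub>presented_group R\<^esub> ?y =
        inv\<^bsub>presented_group R\<^esub> ?x"
      by (simp add: m_assoc)
    then have "?y \<otimes>\<^bsub>presented_group R\<^esub> ?x = inv\<^bsub>presented_group R\<^esub> ?x \<otimes>\<^bsub>presented_group R\<^esub> ?y"
      by (metis inv_solve_right inv_closed m_closed word_class_in_carrier inv_inv)
    then show "?y \<otimes>\<^bsub>presented_group R\<^esub> ?x =
        ?x [^]\<^bsub>presented_group R\<^esub> (-1::int) \<otimes>\<^bsub>presented_group R\<^esub> ?y"
      by (simp add: int_pow_neg)
  next
    fix u v s
    let ?X = "{0..<int m} \<times> {0..<int 2}" and ?\<pi> = "metacyclic_step m 2 (-1)"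
    assume uv: "(u, v) \<in> R" and "s \<in> ?X"
    then obtain a i where s: "s = (a, i)" "a \<in> {0..<int m}" "i \<in> {0..<int 2}" by auto
    have gen: "word_act ?\<pi> ?X (gen g) = ?\<pi> g" for g
      by (rule ext) simp
    note xpow = metacyclic_step_gx_pow[of _ m] and ypow = metacyclic_step_gy_pow[of _ m _ 2]
    consider "u = word_pow (gen gx) m" "v = []" | "u = word_pow (gen gy) 2" "v = []"
      | "u = gen gy @ gen gx @ word_inv (gen gy)" "v = word_inv (gen gx)"
      using uv by (auto simp: R_def)
    then show "word_act ?\<pi> ?X u s = word_act ?\<pi> ?X v s"
    proof cases
      case 1
      show ?thesis unfolding 1 word_act_word_pow gen s(1) xpow[OF s(2)] word_act_simps
        using s(2) by simp
    next
      case 2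
      show ?thesis unfolding 2 word_act_word_pow gen s(1) ypow[OF s(2,3)] word_act_simps
        using s(2,3) by simp
    next
      case 3
      have bij: "bij_betw (?\<pi> g) ?X ?X" for g by (rule bij_metacyclic_step[OF m two r])
      define t where "t = inv_into ?X (?\<pi> gy) s"
      have t: "t \<in> ?X" "s = ?\<pi> gy t"
        using bij[of gy] \<open>s \<in> ?X\<close> unfolding t_def
        by (auto simp: bij_betw_def inv_into_into f_inv_into_f)
      obtain c j where cj: "t = (c, j)" by fastforce
      have "?\<pi> gx (?\<pi> gy (?\<pi> gx t)) = ?\<pi> gy t"
      proof -
        have "(- ((c + 1) mod int m) mod int m + 1) mod int m = - c mod int m"
          by (simp add: mod_simps)
        then show ?thesis by (simp add: cj)
      qed
      moreover have "?\<pi> gy (?\<pi> gx t) \<in> ?X" using t(1) bij by (metis bij_betwE)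
      ultimately have "inv_into ?X (?\<pi> gx) s = ?\<pi> gy (?\<pi> gx t)"
        using bij[of gx] t(2) by (intro inv_into_f_eq) (auto simp: bij_betw_def)
      then show ?thesis unfolding 3 by (simp only: word_act_simps word_act_inv_gen t_def)
    qed
  qed
  then show ?thesis unfolding G[symmetric] by (rule that)
qed

section \<open>The groups of type G(p,q,n)\<close>

lemma integer_mod_group_generator:
  assumes "group K" "K \<cong> integer_mod_group n" "n > 0"
  obtains x where "x \<in> carrier K" "carrier K = range (\<lambda>a::int. x [^]\<^bsub>K\<^esub> a)"
    "\<And>a::int. x [^]\<^bsub>K\<^esub> a = \<one>\<^bsub>K\<^esub> \<longleftrightarrow> int n dvd a"
proof -
  let ?Z = "integer_mod_group n"
  interpret K: group K by fact
  interpret Z: group ?Z by simp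
  obtain h where h: "h \<in> iso ?Z K"
    using K.iso_sym[OF assms(2)] by (auto simp: is_iso_def)
  interpret h: group_hom ?Z K h
    by unfold_locales (use h in \<open>simp add: iso_def\<close>)
  have bij: "bij_betw h (carrier ?Z) (carrier K)" using h by (simp add: iso_def)
  have car: "carrier ?Z = {0..<int n}" using assms(3) by (simp add: carrier_integer_mod_group)
  \<comment> \<open>The reduction matters for \<open>n = 1\<close>, where 1 itself lies outside the
    carrier.\<close>
  let ?x = "h (1 mod int n)"
  have one: "1 mod int n \<in> carrier ?Z" using assms(3) by (simp add: car)
  have pow: "?x [^]\<^bsub>K\<^esub> a = h (a mod int n)" for a :: int
    using h.hom_int_pow[OF one, of a] by (simp add: int_pow_integer_mod_group mod_mult_right_eq)
  have "carrier K = h ` carrier ?Z" using bij by (simp add: bij_betw_def)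
  also have "\<dots> = range (\<lambda>a::int. ?x [^]\<^bsub>K\<^esub> a)"
  proof -
    have "carrier ?Z = range (\<lambda>a. a mod int n)"
    proof (intro equalityI subsetI)
      fix a assume "a \<in> carrier ?Z"
      then have "a = a mod int n" by (simp add: car)
      then show "a \<in> range (\<lambda>a. a mod int n)" by (rule range_eqI)
    qed (use assms(3) in \<open>auto simp: car\<close>)
    then show ?thesis by (simp add: pow image_image)
  qed
  finally have "carrier K = range (\<lambda>a::int. ?x [^]\<^bsub>K\<^esub> a)" .
  moreover have "?x [^]\<^bsub>K\<^esub> a = \<one>\<^bsub>K\<^esub> \<longleftrightarrow> int n dvd a" for a :: int
  proof -
    have "0 \<in> carrier ?Z" "a mod int n \<in> carrier ?Z" using assms(3) by (simp_all add: car)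
    then have "h (a mod int n) = h 0 \<longleftrightarrow> a mod int n = 0"
      using bij by (metis bij_betw_inv_into_left)
    moreover have "h 0 = \<one>\<^bsub>K\<^esub>" using h.hom_one by simp
    ultimately show ?thesis by (simp add: pow dvd_eq_mod_eq_0)
  qed
  moreover have "?x \<in> carrier K" using one by simp
  ultimately show ?thesis using that by blast
qed

text \<open>The multiples of \<open>q\<close> in the exponent form the only maximal subgroup
  \<open>K\<close> of a cyclic \<open>q\<close>-group. A maximal \<open>M\<close> consists of the
  powers with exponent divisible by some d > 1 dividing q^k, so \<open>q\<close> divides d and
  \<open>M\<close> lies in \<open>K\<close>; as \<open>y\<close> is not in \<open>K\<close>,
  maximality gives equality.\<close>

lemma (in group) pow_in_frattini:
  assumes y: "y \<in> carrier G" and gen: "carrier G = range (\<lambda>a::int. y [^] a)"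
    and ord: "\<And>a::int. y [^] a = \<one> \<longleftrightarrow> int (q ^ k) dvd a"
    and q: "prime q" and "k \<ge> 1"
  shows "y [^] q \<in> frattini G"
proof -
  have q1: "q > 1" using q by (rule prime_gt_1_nat)
  define K where "K = {y [^] a | a::int. int q dvd a}"
  have K: "subgroup K G"
  proof (rule subgroupI)
    show "K \<noteq> {}" by (auto simp: K_def)
    fix g assume "g \<in> K"
    then obtain a where a: "g = y [^] (a::int)" "int q dvd a" by (auto simp: K_def)
    then have "inv g = y [^] (- a)" using y by (simp add: int_pow_neg)
    then show "inv g \<in> K" using a(2) by (auto simp: K_def intro!: exI[of _ "- a"])
    fix g' assume "g' \<in> K"
    then obtain b where b: "g' = y [^] (b::int)" "int q dvd b" by (auto simp: K_def)
    then have "g \<otimes> g' = y [^] (a + b)" using y a by (simp add: int_pow_mult)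
    then show "g \<otimes> g' \<in> K" using a b by (auto simp: K_def intro!: exI[of _ "a + b"])
  qed (use y in \<open>auto simp: K_def\<close>)
  have "y \<notin> K"
  proof
    assume "y \<in> K"
    then obtain a where a: "y = y [^] (a::int)" "int q dvd a" by (auto simp: K_def)
    have "y [^] (1 - a) = \<one>" using y a(1) by (metis int_pow_1 int_pow_diff r_inv)
    then have "int (q ^ k) dvd 1 - a" by (simp only: ord)
    moreover have "int q dvd int (q ^ k)" using \<open>k \<ge> 1\<close> by (simp add: dvd_power)
    ultimately have "int q dvd 1 - a" by (metis dvd_trans)
    then have "int q dvd 1" using a(2) by (metis dvd_add_right_iff diff_add_cancel)
    then show False using q1 by simp
  qed
  have "y [^] q \<in> M" if M: "maximal_subgroup M G" for M
  proof -
    have sub: "subgroup M G" and ne: "M \<noteq> carrier G"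
      and max: "\<And>L. subgroup L G \<Longrightarrow> M \<subseteq> L \<Longrightarrow> L = M \<or> L = carrier G"
      using M by (auto simp: maximal_subgroup_def)
    have diff: "y [^] (a - b) \<in> M" if "y [^] a \<in> M" "y [^] b \<in> M" for a b :: int
      using y that sub by (simp add: int_pow_diff subgroup.m_closed subgroup.m_inv_closed)
    have yM: "y [^] int (q ^ k) \<in> M" using ord subgroup.one_closed[OF sub] by (metis dvd_refl)
    have "int (q ^ k) > 0" using q1 by simp
    then obtain d where d: "{a::int. y [^] a \<in> M} = {a. int d dvd a}"
      using yM int_subgroup_dvd[of "int (q ^ k)" "{a. y [^] a \<in> M}"] diff
      by (metis (no_types, lifting) mem_Collect_eq)
    then have d: "y [^] a \<in> M \<longleftrightarrow> int d dvd a" for a :: int by blast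
    have "d dvd q ^ k" using d yM by (simp only: int_dvd_int_iff)
    then obtain i where i: "d = q ^ i" using divides_primepow_nat[OF q] by blast
    have "i \<noteq> 0"
    proof
      assume "i = 0"
      then have "y [^] a \<in> M" for a :: int using d i by simp
      then have "carrier G \<subseteq> M" using gen by auto
      then show False using ne subgroup.subset[OF sub] by blast
    qed
    then have "int q dvd int d" by (simp add: i dvd_power)
    then have "M \<subseteq> K"
    proof (intro subsetI)
      fix g assume "g \<in> M"
      moreover then obtain a where "g = y [^] (a::int)" using gen subgroup.subset[OF sub] by blast
      ultimately have "g = y [^] a" "int q dvd a"
        using d dvd_trans[OF \<open>int q dvd int d\<close>] by simp_all
      then show "g \<in> K" by (auto simp: K_def)
    qed
    then have "K = M" using max[OF K] \<open>y \<notin> K\<close> y by blast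
    moreover have "y [^] int q \<in> K" by (auto simp: K_def)
    ultimately show ?thesis by (simp add: int_pow_int)
  qed
  then show ?thesis using y by (auto simp: frattini_def)
qed

lemma metacyclic_Gpqn:
  fixes G (structure)
  assumes p: "prime p" and q: "prime q" and n: "n \<ge> 2" and G: "is_Gpqn p q n G"
  obtains x y r where "metacyclic G x y p (q ^ (n - 1)) r"
    "[r ^ q = 1] (mod int p)" "\<not> [r = 1] (mod int p)"
proof -
  let ?k = "q ^ (n - 1)"
  have p0: "p > 0" and q0: "q > 0" using p q by (simp_all add: prime_gt_0_nat)
  obtain N P where group: "group G" and nc: "\<not> comm_group G" and split: "split_extension G N P"
    and isoN: "G\<lparr>carrier := N\<rparr> \<cong> integer_mod_group p" and isoP: "G\<lparr>carrier := P\<rparr> \<cong> integer_mod_group ?k"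
    and comm: "commutator_subgroup G N (frattini (G\<lparr>carrier := P\<rparr>)) = {\<one>}"
    using G by (auto simp: is_Gpqn_def)
  interpret group G by (rule group)
  have normal: "N \<lhd> G" and P: "subgroup P G" and NP: "N \<inter> P = {\<one>}" "N <#> P = carrier G"
    using split by (auto simp: split_extension_def)
  have N: "subgroup N G" using normal by (rule normal_imp_subgroup)
  note Npow = int_pow_consistent[OF N] and Ppow = int_pow_consistent[OF P]
  have gN: "group (G\<lparr>carrier := N\<rparr>)" and gP: "group (G\<lparr>carrier := P\<rparr>)"
    using N P by (simp_all add: subgroup.subgroup_is_group[OF _ group])
  have k0: "?k > 0" using q0 by simp
  obtain x where x0: "x \<in> carrier (G\<lparr>carrier := N\<rparr>)"
    "carrier (G\<lparr>carrier := N\<rparr>) = range (\<lambda>a::int. x [^]\<^bsub>G\<lparr>carrier := N\<rparr>\<^esub> a)"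
    "\<And>a::int. x [^]\<^bsub>G\<lparr>carrier := N\<rparr>\<^esub> a = \<one>\<^bsub>G\<lparr>carrier := N\<rparr>\<^esub> \<longleftrightarrow> int p dvd a"
    by (rule integer_mod_group_generator[OF gN isoN p0]) blast
  have xN: "x \<in> N" "N = range (\<lambda>a::int. x [^] a)" "\<And>a::int. x [^] a = \<one> \<longleftrightarrow> int p dvd a"
    using x0 Npow[of x] by simp_all
  obtain y where y0: "y \<in> carrier (G\<lparr>carrier := P\<rparr>)"
    "carrier (G\<lparr>carrier := P\<rparr>) = range (\<lambda>a::int. y [^]\<^bsub>G\<lparr>carrier := P\<rparr>\<^esub> a)"
    "\<And>a::int. y [^]\<^bsub>G\<lparr>carrier := P\<rparr>\<^esub> a = \<one>\<^bsub>G\<lparr>carrier := P\<rparr>\<^esub> \<longleftrightarrow> int ?k dvd a"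
    by (rule integer_mod_group_generator[OF gP isoP k0]) blast
  have yP: "y \<in> P" using y0(1) by simp
  have yG': "P = range (\<lambda>a::int. y [^] a)" "\<And>a::int. y [^] a = \<one> \<longleftrightarrow> int ?k dvd a"
    using y0(2,3) Ppow[OF yP] by (simp_all del: of_nat_power)
  have xG: "x \<in> carrier G" and yG: "y \<in> carrier G"
    using xN yP N P by (auto dest: subgroup.mem_carrier)
  have "y \<otimes> x \<otimes> inv y \<in> N" using normal.inv_op_closed2[OF normal yG xN(1)] .
  then obtain r where "y \<otimes> x \<otimes> inv y = x [^] (r::int)" using xN(2) by blast
  then have yx: "y \<otimes> x = x [^] r \<otimes> y" using xG yG by (metis int_pow_closed inv_solve_right m_closed)
  interpret metacyclic_relations G x y p ?k r
  proof
    show "x [^] p = \<one>" "y [^] ?k = \<one>"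
      using xN(3)[of "int p"] yG'(2)[of "int ?k"] by (simp_all only: int_pow_int dvd_refl)
  qed (use xG yG p0 q0 yx in auto)
  interpret metacyclic G x y p ?k r
  proof
    show "carrier G \<subseteq> range (\<lambda>(a, i). E a i)"
    proof
      fix g assume "g \<in> carrier G"
      then obtain a b where g: "g = x [^] (a::int) \<otimes> y [^] (b::int)"
        unfolding NP(2)[symmetric] set_mult_def using xN(2) yG'(1) by blast
      let ?i = "nat (b mod int ?k)"
      have "int ?k dvd b - int ?i" using q0 by (simp add: minus_mod_eq_mult_div)
      then have "y [^] (b - int ?i) = \<one>" by (simp only: yG'(2))
      then have "y [^] b = y [^] ?i"
        using yG by (metis int_pow_closed int_pow_diff int_pow_int inv_closed inv_equality inv_inv)
      then have "g = E a ?i" by (simp add: g E_def)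
      then show "g \<in> range (\<lambda>(a, i). E a i)" by auto
    qed
    fix a i assume "E a i = \<one>"
    \<comment> \<open>A trivial normal form puts a power of \<open>x\<close> into the intersection
      of \<open>N\<close> and \<open>P\<close>.\<close>
    then have eq: "x [^] a = inv (y [^] i)" unfolding E_def
      using xG yG by (metis int_pow_closed inv_equality nat_pow_closed)
    have "x [^] a \<in> N" using xN(2) by blast
    moreover have "inv (y [^] i) \<in> P"
      using yG'(1) by (metis P int_pow_int rangeI subgroup.m_inv_closed)
    ultimately have "x [^] a \<in> N \<inter> P" unfolding eq by blast
    then have xa: "x [^] a = \<one>" by (simp only: NP(1) singleton_iff)
    then have "inv (y [^] i) = \<one>" using eq by simp
    then have "y [^] int i = \<one>" using yG by (metis int_pow_int inv_inv inv_one nat_pow_closed)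
    then show "int p dvd a \<and> ?k dvd i" using xa unfolding xN(3) yG'(2) int_dvd_int_iff by simp
  qed
  \<comment> \<open>The commutator condition enters through the element \<open>y [^] q\<close>: it
    commutes with \<open>x\<close>, while conjugation by it raises \<open>x\<close> to the power
    r^q.\<close>
  have "y [^]\<^bsub>G\<lparr>carrier := P\<rparr>\<^esub> q \<in> frattini (G\<lparr>carrier := P\<rparr>)"
    by (rule group.pow_in_frattini[OF gP _ _ _ q, of y "n - 1"]) (use y0 n in auto)
  then have yq: "y [^] q \<in> frattini (G\<lparr>carrier := P\<rparr>)"
    by (simp add: nat_pow_def)
  have "x \<otimes> y [^] q \<otimes> inv x \<otimes> inv (y [^] q) \<in> commutator_subgroup G N (frattini (G\<lparr>carrier := P\<rparr>))"
    unfolding commutator_subgroup_def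
    by (rule generate.incl) (use xN(1) yq in blast)
  then have "x \<otimes> y [^] q \<otimes> inv x \<otimes> inv (y [^] q) = \<one>" by (simp add: comm)
  then have "x \<otimes> y [^] q = y [^] q \<otimes> x"
    using xG yG by (metis inv_solve_right' inv_closed l_one m_closed nat_pow_closed one_closed)
  then have "E 1 0 \<otimes> E 0 q = E 0 q \<otimes> E 1 0" by (simp add: E_one)
  then have rq: "[r ^ q = 1] (mod int p)" by (simp add: E_mult E_eq_iff cong_sym_eq)
  have "\<not> [r = 1] (mod int p)"
  proof
    assume r1: "[r = 1] (mod int p)"
    have comm: "E a i \<otimes> E b j = E (a + b) (i + j)" for a b i j
      unfolding E_mult
    proof (intro E_cong cong_add cong_refl)
      have "[r ^ i * b = 1 ^ i * b] (mod int p)" using r1 by (intro cong_mult cong_pow cong_refl)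
      then show "[r ^ i * b = b] (mod int p)" by simp
    qed
    have "comm_group G"
    proof (rule group_comm_groupI)
      fix g h assume "g \<in> carrier G" "h \<in> carrier G"
      then obtain a i b j where "g = E a i" "h = E b j" by (metis carrierE)
      then show "g \<otimes> h = h \<otimes> g" by (simp add: comm add.commute)
    qed
    then show False using nc by simp
  qed
  with rq show ?thesis using that metacyclic_axioms by blast
qed

section \<open>Subgroups of the Heisenberg group\<close>

text \<open>The lines outside the centre have a unique direction vector (1, \<beta>, \<gamma>) or
  (0, 1, \<gamma>). The planes are those spanned by the central vector (0, 0, 1) and by (1, \<beta>,
  0) or (0, 1, 0).\<close>

datatype heis_param = Triv | Whole | Cent | LineX int int | LineY int | PlaneX int | PlaneY

text \<open>\<open>h\<close> is an inverse of 2 modulo \<open>p\<close>, and the product law is the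
  Baker-Campbell-Hausdorff formula in nilpotency class 2. Its correction term is alternating, so it
  vanishes for parallel vectors.\<close>

locale heisenberg = group G for G (structure) +
  fixes F :: "int \<Rightarrow> int \<Rightarrow> int \<Rightarrow> 'a" and p :: nat and h :: int
  assumes p: "prime p" and h: "int p dvd 2 * h - 1"
    and F_closed [simp]: "F a b c \<in> carrier G"
    and F_surj: "g \<in> carrier G \<Longrightarrow> \<exists>a b c. g = F a b c"
    and F_mult: "F a b c \<otimes> F a' b' c' = F (a + a') (b + b') (c + c' + h * (a * b' - b * a'))"
    and F_eq_iff: "F a b c = F a' b' c' \<longleftrightarrow>
      int p dvd a - a' \<and> int p dvd b - b' \<and> int p dvd c - c'"
begin

section \<open>The listed subspaces as distinct subgroups\<close>

definition hmem :: "heis_param \<Rightarrow> int \<Rightarrow> int \<Rightarrow> int \<Rightarrow> bool" where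
  "hmem t a b c = (case t of
     Triv \<Rightarrow> int p dvd a \<and> int p dvd b \<and> int p dvd c
   | Whole \<Rightarrow> True
   | Cent \<Rightarrow> int p dvd a \<and> int p dvd b
   | LineX \<beta> \<gamma> \<Rightarrow> int p dvd b - \<beta> * a \<and> int p dvd c - \<gamma> * a
   | LineY \<gamma> \<Rightarrow> int p dvd a \<and> int p dvd c - \<gamma> * b
   | PlaneX \<beta> \<Rightarrow> int p dvd b - \<beta> * a
   | PlaneY \<Rightarrow> int p dvd a)"

definition Hs :: "heis_param \<Rightarrow> 'a set" where
  "Hs t = {F a b c | a b c. hmem t a b c}"

definition params :: "heis_param set" where
  "params = {Triv, Whole, Cent, PlaneY} \<union> (\<lambda>(\<beta>, \<gamma>). LineX \<beta> \<gamma>) ` ({0..<int p} \<times> {0..<int p})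
     \<union> LineY ` {0..<int p} \<union> PlaneX ` {0..<int p}"

lemma in_params [simp]:
  "Triv \<in> params" "Whole \<in> params" "Cent \<in> params" "PlaneY \<in> params"
  "LineX \<beta> \<gamma> \<in> params \<longleftrightarrow> \<beta> \<in> {0..<int p} \<and> \<gamma> \<in> {0..<int p}"
  "LineY \<gamma> \<in> params \<longleftrightarrow> \<gamma> \<in> {0..<int p}"
  "PlaneX \<beta> \<in> params \<longleftrightarrow> \<beta> \<in> {0..<int p}"
  by (auto simp: params_def)

lemma hmem_shift:
  assumes "int p dvd a - a'" "int p dvd b - b'" "int p dvd c - c'" "hmem t a b c"
  shows "hmem t a' b' c'"
proof -
  have *: "int p dvd u'" if "int p dvd u" "int p dvd u - u'" for u u' :: int
    using that by (metis dvd_diff_commute dvd_diff_right_iff dvd_add_right_iff diff_add_cancel)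
  have lin: "int p dvd v' - w * u'" if "int p dvd v - w * u" "int p dvd u - u'" "int p dvd v - v'" for u u' v v' w :: int
  proof -
    have "v' - w * u' = (v - w * u) + w * (u - u') - (v - v')" by (simp add: algebra_simps)
    then show ?thesis using that by (simp only: dvd_add dvd_diff dvd_mult)
  qed
  show ?thesis
    using assms by (cases t) (auto simp: hmem_def intro: * lin)
qed

lemma F_in_Hs_iff: "F a b c \<in> Hs t \<longleftrightarrow> hmem t a b c"
proof
  assume "F a b c \<in> Hs t"
  then obtain a' b' c' where "F a b c = F a' b' c'" "hmem t a' b' c'" by (auto simp: Hs_def)
  then show "hmem t a b c"
    using hmem_shift[of a' a b' b c' c t] by (simp add: F_eq_iff dvd_diff_commute)
qed (auto simp: Hs_def)

lemma F_0: "F 0 0 0 = \<one>"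
proof -
  have "F 0 0 0 \<otimes> F 0 0 0 = F 0 0 0" by (simp add: F_mult)
  then show ?thesis by (metis F_closed r_cancel_one)
qed

lemma inv_F: "inv (F a b c) = F (- a) (- b) (- c)"
  by (rule inv_equality) (simp_all add: F_mult F_0)

text \<open>The conditions are linear, so only the correction term matters. It vanishes modulo
  \<open>p\<close> on \<open>Triv\<close> and on the lines, and the remaining cases put no condition
  on the third coordinate.\<close>

lemma hmem_mult:
  assumes "hmem t a b c" "hmem t a' b' c'"
  shows "hmem t (a + a') (b + b') (c + c' + h * (a * b' - b * a'))"
proof -
  have lin: "int p dvd (v + v') - w * (u + u')" if "int p dvd v - w * u" "int p dvd v' - w * u'" for u u' v v' w :: int
  proof -
    have "(v + v') - w * (u + u') = (v - w * u) + (v' - w * u')" by (simp add: algebra_simps)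
    then show ?thesis using that by (simp only: dvd_add)
  qed
  have X: "int p dvd (c + c' + h * (a * b' - b * a')) - \<gamma> * (a + a')"
    if "int p dvd b - \<beta> * a" "int p dvd b' - \<beta> * a'" "int p dvd c - \<gamma> * a" "int p dvd c' - \<gamma> * a'" for \<beta> \<gamma>
  proof -
    have "(c + c' + h * (a * b' - b * a')) - \<gamma> * (a + a') =
        (c - \<gamma> * a) + (c' - \<gamma> * a') + (h * a) * (b' - \<beta> * a') - (h * a') * (b - \<beta> * a)"
      by (simp add: algebra_simps)
    then show ?thesis using that by (simp only: dvd_add dvd_diff dvd_mult)
  qed
  have Y: "int p dvd (c + c' + h * (a * b' - b * a')) - \<gamma> * (b + b')"
    if "int p dvd a" "int p dvd a'" "int p dvd c - \<gamma> * b" "int p dvd c' - \<gamma> * b'" for \<gamma>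
  proof -
    have "(c + c' + h * (a * b' - b * a')) - \<gamma> * (b + b') =
        (c - \<gamma> * b) + (c' - \<gamma> * b') + (h * b') * a - (h * b) * a'"
      by (simp add: algebra_simps)
    then show ?thesis using that by (simp only: dvd_add dvd_diff dvd_mult)
  qed
  show ?thesis
    using assms lin X Y by (cases t) (auto simp: hmem_def)
qed

lemma hmem_minus:
  assumes "hmem t a b c"
  shows "hmem t (- a) (- b) (- c)"
proof -
  have "int p dvd - v - w * - u" if "int p dvd v - w * u" for u v w :: int
    using that dvd_minus_iff[of "int p" "v - w * u"] by (simp add: algebra_simps)
  then show ?thesis using assms by (cases t) (auto simp: hmem_def)
qed

lemma subgroup_Hs: "subgroup (Hs t) G"
proof (rule subgroupI)
  have "hmem t 0 0 0" by (cases t) (simp_all add: hmem_def)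
  then show "Hs t \<noteq> {}" by (auto simp: Hs_def)
  fix g assume "g \<in> Hs t"
  then obtain a b c where g: "g = F a b c" "hmem t a b c" by (auto simp: Hs_def)
  then show "inv g \<in> Hs t" by (simp add: inv_F F_in_Hs_iff hmem_minus)
  fix g' assume "g' \<in> Hs t"
  then obtain a' b' c' where g': "g' = F a' b' c'" "hmem t a' b' c'" by (auto simp: Hs_def)
  then show "g \<otimes> g' \<in> Hs t" using g by (simp add: F_mult F_in_Hs_iff hmem_mult)
qed (auto simp: Hs_def)

lemma not_p_dvd_1 [simp]: "\<not> int p dvd 1" "p \<noteq> Suc 0" "\<not> int p dvd - 1"
  using p prime_gt_1_nat[OF p] by auto

text \<open>Two parameters are told apart by test vectors: the three unit vectors and the direction
  vectors of the lines and planes concerned.\<close>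

lemma Hs_inject:
  assumes t: "t \<in> params" and t': "t' \<in> params" and eq: "Hs t = Hs t'"
  shows "t = t'"
proof -
  have e: "hmem t a b c \<longleftrightarrow> hmem t' a b c" for a b c
    using eq F_in_Hs_iff by metis
  have small: "u = v" if "int p dvd u - v" "0 \<le> u" "u < int p" "0 \<le> v" "v < int p" for u v :: int
  proof -
    have "[u = v] (mod int p)" using that(1) by (simp add: cong_iff_dvd_diff)
    then show ?thesis using that by (simp add: cong_def)
  qed
  note pts = e[of 0 0 1] e[of 1 0 0] e[of 0 1 0]
  note X = e[of 1 \<beta> \<gamma> for \<beta> \<gamma>] and Y = e[of 0 1 \<gamma> for \<gamma>]
  have nd: "\<not> int p dvd 1" by simp
  show ?thesis
  proof (cases t)
    case (LineX \<beta> \<gamma>)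
    show ?thesis using t t' pts X[of \<beta> \<gamma>] nd unfolding LineX
      by (cases t') (auto simp: hmem_def dvd_diff_commute intro: small)
  next
    case (LineY \<gamma>)
    show ?thesis using t t' pts Y[of \<gamma>] nd unfolding LineY
      by (cases t') (auto simp: hmem_def dvd_diff_commute intro: small)
  next
    case (PlaneX \<beta>)
    show ?thesis using t t' pts X[of \<beta> 0] nd unfolding PlaneX
      by (cases t') (auto simp: hmem_def dvd_diff_commute intro: small)
  next
    case Triv
    show ?thesis
    proof (cases t')
      case (LineX \<beta> \<gamma>)
      then show ?thesis using X[of \<beta> \<gamma>] nd by (simp add: Triv hmem_def)
    next
      case (LineY \<gamma>)
      then show ?thesis using Y[of \<gamma>] nd by (simp add: Triv hmem_def)
    qed (use pts nd in \<open>simp_all add: Triv hmem_def\<close>)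
  next
    case Whole
    then show ?thesis using pts nd by (cases t') (simp_all add: hmem_def)
  next
    case Cent
    show ?thesis
    proof (cases t')
      case (PlaneX \<beta>)
      then show ?thesis using X[of \<beta> 0] nd by (simp add: Cent hmem_def)
    qed (use pts nd in \<open>simp_all add: Cent hmem_def\<close>)
  next
    case PlaneY
    then show ?thesis using pts nd by (cases t') (simp_all add: hmem_def)
  qed
qed

text \<open>If the central vector lies in \<open>H\<close>, the third coordinate is free and
  \<open>H\<close> is determined by its projection to the first two coordinates: zero, a line, or
  everything. Otherwise \<open>H\<close> is commutative, its projection is at most a line, and the
  third coordinate is a linear function on that projection.\<close>

lemma subgroup_eq_Hs:
  assumes H: "subgroup H G"
  obtains t where "t \<in> params" "H = Hs t"
proof -
  have p0: "int p > 0" using prime_gt_0_nat[OF p] by simp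
  define M where "M a b c \<longleftrightarrow> F a b c \<in> H" for a b c
  have shift: "M a' b' c'" if "M a b c" "int p dvd a - a'" "int p dvd b - b'" "int p dvd c - c'" for a b c a' b' c'
  proof -
    have "F a b c = F a' b' c'" using that by (simp add: F_eq_iff)
    then show ?thesis using that(1) by (simp add: M_def)
  qed
  have zero: "M 0 0 0" unfolding M_def F_0 by (rule subgroup.one_closed[OF H])
  have add: "M (a + a') (b + b') (c + c' + h * (a * b' - b * a'))" if "M a b c" "M a' b' c'" for a b c a' b' c'
    using subgroup.m_closed[OF H, of "F a b c" "F a' b' c'"] that by (simp add: M_def F_mult)
  have neg: "M (- a) (- b) (- c)" if "M a b c" for a b c
    using subgroup.m_inv_closed[OF H, of "F a b c"] that by (simp add: M_def inv_F)
  have scale_nat: "M (int n * a) (int n * b) (int n * c)" if "M a b c" for n a b c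
  proof (induction n)
    case (Suc n)
    \<comment> \<open>The correction term cancels because the two vectors are parallel.\<close>
    from add[OF Suc that] show ?case by (simp add: algebra_simps)
  qed (simp add: zero)
  have scale: "M (s * a) (s * b) (s * c)" if "M a b c" for s a b c
  proof (cases "s \<ge> 0")
    case True
    then show ?thesis using scale_nat[OF that, of "nat s"] by simp
  next
    case False
    then show ?thesis using neg[OF scale_nat[OF that, of "nat (- s)"]] by simp
  qed
  have inverse: "\<exists>s. int p dvd s * a - 1" if "\<not> int p dvd a" for a
  proof -
    have "coprime (int p) a" using p that by (intro prime_imp_coprime) simp_all
    then have "coprime a (int p)" by (simp only: coprime_commute)
    then obtain s where "[a * s = 1] (mod int p)" using cong_solve_coprime_int by blast
    then show ?thesis by (auto simp: cong_iff_dvd_diff mult.commute)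
  qed
  have mod_p: "int p dvd u - u mod int p" "int p dvd u mod int p - u" for u :: int
    by (simp_all add: mod_eq_dvd_iff[symmetric])
  have mod_range: "u mod int p \<in> {0..<int p}" for u :: int using p0 by simp
  have normalize_X: "\<exists>\<beta>\<in>{0..<int p}. \<exists>\<gamma>\<in>{0..<int p}. M 1 \<beta> \<gamma>"
    if abc: "M a b c" "\<not> int p dvd a" for a b c
  proof -
    obtain s where "int p dvd s * a - 1" using inverse abc(2) by blast
    then have "M 1 (s * b mod int p) (s * c mod int p)"
      by (rule shift[OF scale[OF abc(1), of s]]) (rule mod_p)+
    then show ?thesis using mod_range by blast
  qed
  have normalize_Y: "\<exists>\<gamma>\<in>{0..<int p}. M 0 1 \<gamma>"
    if abc: "M a b c" "int p dvd a" "\<not> int p dvd b" for a b c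
  proof -
    obtain s where s: "int p dvd s * b - 1" using inverse abc(3) by blast
    have "M 0 1 (s * c mod int p)"
      by (rule shift[OF scale[OF abc(1), of s] _ s mod_p(1)]) (simp add: abc(2))
    then show ?thesis using mod_range by blast
  qed
  have "\<exists>t\<in>params. \<forall>a b c. M a b c \<longleftrightarrow> hmem t a b c"
  proof (cases "M 0 0 1")
    case True
    have Z: "M a b c'" if "M a b c" for a b c c'
      using add[OF that scale[OF True, of "c' - c"]] by simp
    have planar: "M (a + a') (b + b') c" if "M a b d" "M a' b' d'" for a b c a' b' d d'
      using Z[OF add[OF that]] .
    show ?thesis
    proof (cases "\<forall>a b c. M a b c \<longrightarrow> int p dvd a")
      case all_a: True
      show ?thesis
      proof (cases "\<forall>a b c. M a b c \<longrightarrow> int p dvd b")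
        case True
        have "M a b c" if "int p dvd a" "int p dvd b" for a b c
          by (rule shift[OF Z[OF zero, of c]]) (use that in simp_all)
        then have "\<forall>a b c. M a b c \<longleftrightarrow> hmem Cent a b c"
          using all_a True unfolding hmem_def heis_param.case by metis
        then show ?thesis by (rule bexI) simp
      next
        case False
        then obtain \<gamma> where "M 0 1 \<gamma>" using normalize_Y all_a by blast
        have "M a b c" if "int p dvd a" for a b c
          by (rule shift[OF Z[OF scale[OF \<open>M 0 1 \<gamma>\<close>, of b], of c]]) (use that in simp_all)
        then have "\<forall>a b c. M a b c \<longleftrightarrow> hmem PlaneY a b c"
          using all_a unfolding hmem_def heis_param.case by metis
        then show ?thesis by (rule bexI) simp
      qed
    next
      case False
      then obtain \<beta> \<gamma> where \<beta>: "\<beta> \<in> {0..<int p}" and M1: "M 1 \<beta> \<gamma>" using normalize_X by blast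
      show ?thesis
      proof (cases "\<forall>a b c. M a b c \<longrightarrow> int p dvd b - \<beta> * a")
        case True
        have "M a b c" if "int p dvd b - \<beta> * a" for a b c
          by (rule shift[OF Z[OF scale[OF M1, of a], of c]]) (use that in \<open>simp_all add: dvd_diff_commute mult.commute\<close>)
        then have "\<forall>a b c. M a b c \<longleftrightarrow> hmem (PlaneX \<beta>) a b c"
          using True unfolding hmem_def heis_param.case by metis
        then show ?thesis by (rule bexI) (use \<beta> in simp)
      next
        case False
        then obtain a b c where abc: "M a b c" "\<not> int p dvd b - \<beta> * a" by blast
        \<comment> \<open>Subtracting \<open>a\<close> times the normalised vector leaves a nonzero
          second coordinate, so the projection is two-dimensional.\<close>
        have "M 0 (b - \<beta> * a) 0" using planar[OF abc(1) scale[OF M1, of "- a"]] by (simp add: mult.commute)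
        then obtain \<gamma>' where "M 0 1 \<gamma>'" using normalize_Y abc(2) by (metis dvd_0_right)
        have "M a b c" for a b c
          using planar[OF scale[OF M1, of a] scale[OF \<open>M 0 1 \<gamma>'\<close>, of "b - \<beta> * a"]]
          by (simp add: mult.commute)
        then have "\<forall>a b c. M a b c \<longleftrightarrow> hmem Whole a b c" by (simp add: hmem_def)
        then show ?thesis by (rule bexI) simp
      qed
    qed
  next
    case False
    have Z: "int p dvd c" if "M 0 0 c" for c
    proof (rule ccontr)
      assume "\<not> int p dvd c"
      then obtain s where s: "int p dvd s * c - 1" using inverse by blast
      have "M 0 0 1" by (rule shift[OF scale[OF that, of s] _ _ s]) simp_all
      then show False using False by simp
    qed
    \<comment> \<open>The product of two elements times the inverse of the reversed product is
      central with third coordinate \<open>2 * h\<close> times the form; by \<open>Z\<close> this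
      vanishes modulo \<open>p\<close>, and \<open>2 * h\<close> is 1 modulo
      \<open>p\<close>.\<close>
    have comm: "int p dvd a * b' - b * a'" if "M a b c" "M a' b' c'" for a b c a' b' c'
    proof -
      let ?\<delta> = "a * b' - b * a'"
      have "M (a + a') (b + b') (c + c' + h * ?\<delta>)" using add[OF that] .
      moreover have "M (- (a + a')) (- (b + b')) (- (c + c' - h * ?\<delta>))"
        using neg[OF add[OF that(2,1)]] by (simp add: algebra_simps)
      ultimately have "M 0 0 (2 * h * ?\<delta>)"
        using add[of "a + a'" "b + b'" "c + c' + h * ?\<delta>" "- (a + a')" "- (b + b')" "- (c + c' - h * ?\<delta>)"]
        by (simp add: algebra_simps)
      then have "int p dvd 2 * h * ?\<delta>" by (rule Z)
      moreover have "?\<delta> = 2 * h * ?\<delta> - (2 * h - 1) * ?\<delta>" by (simp add: algebra_simps)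
      moreover have "int p dvd (2 * h - 1) * ?\<delta>" using h by simp
      ultimately show ?thesis by (metis dvd_diff)
    qed
    show ?thesis
    proof (cases "\<forall>a b c. M a b c \<longrightarrow> int p dvd a")
      case all_a: True
      show ?thesis
      proof (cases "\<forall>a b c. M a b c \<longrightarrow> int p dvd b")
        case True
        have "int p dvd c" if "M a b c" for a b c
        proof (rule Z, rule shift[OF that])
          show "int p dvd a - 0" "int p dvd b - 0" using all_a True that by auto
        qed simp
        moreover have "M a b c" if "int p dvd a" "int p dvd b" "int p dvd c" for a b c
          by (rule shift[OF zero]) (use that in simp_all)
        ultimately have "\<forall>a b c. M a b c \<longleftrightarrow> hmem Triv a b c"
          using all_a True unfolding hmem_def heis_param.case by metis
        then show ?thesis by (rule bexI) simp
      next
        case False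
        then obtain \<gamma> where \<gamma>: "\<gamma> \<in> {0..<int p}" and M1: "M 0 1 \<gamma>" using normalize_Y all_a by blast
        have "int p dvd c - \<gamma> * b" if "M a b c" for a b c
        proof -
          have "int p dvd a" using all_a that by blast
          then have "M 0 b c" by (intro shift[OF that]) simp_all
          from add[OF this scale[OF M1, of "- b"]] show ?thesis
            by (intro Z) (simp add: mult.commute)
        qed
        moreover have "M a b c" if "int p dvd a" "int p dvd c - \<gamma> * b" for a b c
          by (rule shift[OF scale[OF M1, of b]]) (use that in \<open>simp_all add: dvd_diff_commute mult.commute\<close>)
        ultimately have "\<forall>a b c. M a b c \<longleftrightarrow> hmem (LineY \<gamma>) a b c"
          using all_a unfolding hmem_def heis_param.case by metis
        then show ?thesis by (rule bexI) (use \<gamma> in simp)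
      qed
    next
      case False
      then obtain \<beta> \<gamma> where \<beta>: "\<beta> \<in> {0..<int p}" "\<gamma> \<in> {0..<int p}" and M1: "M 1 \<beta> \<gamma>"
        using normalize_X by blast
      \<comment> \<open>Vanishing of the form against (1, \<beta>, \<gamma>) places the projection
        on the line of slope \<beta>.\<close>
      have b: "int p dvd b - \<beta> * a" if "M a b c" for a b c
        using comm[OF M1 that] by simp
      have "int p dvd c - \<gamma> * a" if "M a b c" for a b c
      proof -
        have "M a (\<beta> * a) c" using b[OF that] by (intro shift[OF that]) simp_all
        from add[OF this scale[OF M1, of "- a"]] show ?thesis
          by (intro Z) (simp add: algebra_simps)
      qed
      moreover have "M a b c" if "int p dvd b - \<beta> * a" "int p dvd c - \<gamma> * a" for a b c
        by (rule shift[OF scale[OF M1, of a]]) (use that in \<open>simp_all add: dvd_diff_commute mult.commute\<close>)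
      ultimately have "\<forall>a b c. M a b c \<longleftrightarrow> hmem (LineX \<beta> \<gamma>) a b c"
        using b unfolding hmem_def heis_param.case by metis
      then show ?thesis by (rule bexI) (use \<beta> in simp)
    qed
  qed
  then obtain t where t: "t \<in> params" "\<And>a b c. M a b c \<longleftrightarrow> hmem t a b c" by blast
  have "H = Hs t"
  proof (intro equalityI subsetI)
    fix g assume "g \<in> H"
    moreover then obtain a b c where "g = F a b c" using F_surj subgroup.subset[OF H] by blast
    ultimately show "g \<in> Hs t" using t(2) by (simp add: M_def F_in_Hs_iff)
  next
    fix g assume "g \<in> Hs t"
    then obtain a b c where "g = F a b c" "hmem t a b c" by (auto simp: Hs_def)
    then show "g \<in> H" using t(2) M_def by simp
  qed
  then show ?thesis using that t(1) by blast
qed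

lemma bij_betw_Hs: "bij_betw Hs params {H. subgroup H G}"
  unfolding bij_betw_def
proof (intro conjI inj_onI equalityI subsetI)
  fix H assume "H \<in> {H. subgroup H G}"
  then show "H \<in> Hs ` params" using subgroup_eq_Hs by blast
qed (auto simp: subgroup_Hs intro: Hs_inject)

lemma card_subgroup_lattice: "card (subgroup_lattice G) = p ^ 2 + 2 * p + 4"
proof -
  let ?R = "{0..<int p}"
  have "card params = card {Triv, Whole, Cent, PlaneY} +
      card ((\<lambda>(\<beta>, \<gamma>). LineX \<beta> \<gamma>) ` (?R \<times> ?R)) + card (LineY ` ?R) + card (PlaneX ` ?R)"
    unfolding params_def by (subst card_Un_disjoint; (subst card_Un_disjoint)?; (subst card_Un_disjoint)?; auto)
  also have "card ((\<lambda>(\<beta>, \<gamma>). LineX \<beta> \<gamma>) ` (?R \<times> ?R)) = p * p"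
    by (subst card_image) (auto intro!: inj_onI)
  also have "card (LineY ` ?R) = p" by (subst card_image) (auto intro!: inj_onI)
  also have "card (PlaneX ` ?R) = p" by (subst card_image) (auto intro!: inj_onI)
  finally have "card params = p ^ 2 + 2 * p + 4" by (simp add: power2_eq_square)
  then show ?thesis using bij_betw_same_card[OF bij_betw_Hs] by (simp add: subgroup_lattice_def)
qed

section \<open>Conjugation of the subspaces\<close>

definition conj_param :: "int \<Rightarrow> int \<Rightarrow> heis_param \<Rightarrow> heis_param" where
  "conj_param u v t = (case t of
     LineX \<beta> \<gamma> \<Rightarrow> LineX \<beta> ((\<gamma> + u * \<beta> - v) mod int p)
   | LineY \<gamma> \<Rightarrow> LineY ((\<gamma> + u) mod int p)
   | _ \<Rightarrow> t)"

lemma conj_param_in_params: "t \<in> params \<Longrightarrow> conj_param u v t \<in> params"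
  using prime_gt_0_nat[OF p] by (cases t) (auto simp: conj_param_def)

text \<open>The linear form \<open>u * b - v * a\<close> takes the value
  \<open>u * \<beta> - v\<close> on (1, \<beta>, \<gamma>) and \<open>u\<close> on (0, 1, \<gamma>),
  which are the shifts in \<open>conj_param\<close>. Planes, the centre and the trivial group are
  invariant.\<close>

lemma hmem_conj_param: "hmem (conj_param u v t) a b (c + (u * b - v * a)) \<longleftrightarrow> hmem t a b c"
proof -
  have mod: "int p dvd c - (w mod int p) * d \<longleftrightarrow> int p dvd c - w * d" for c w d :: int
  proof -
    have "c - (w mod int p) * d = (c - w * d) + int p * (w div int p * d)"
      by (simp add: minus_mult_div_eq_mod[symmetric] algebra_simps)
    then show ?thesis by (simp only: dvd_add_left_iff dvd_triv_left)
  qed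
  have "int p dvd c + (u * b - v * a) - (\<gamma> + u * \<beta> - v) * a \<longleftrightarrow> int p dvd c - \<gamma> * a"
    if "int p dvd b - \<beta> * a" for \<beta> \<gamma>
  proof -
    have "c + (u * b - v * a) - (\<gamma> + u * \<beta> - v) * a = (c - \<gamma> * a) + u * (b - \<beta> * a)"
      by (simp add: algebra_simps)
    then show ?thesis using that by (metis dvd_add_left_iff dvd_mult)
  qed
  moreover have "int p dvd c + (u * b - v * a) - (\<gamma> + u) * b \<longleftrightarrow> int p dvd c - \<gamma> * b"
    if "int p dvd a" for \<gamma>
  proof -
    have "c + (u * b - v * a) - (\<gamma> + u) * b = (c - \<gamma> * b) - v * a"
      by (simp add: algebra_simps)
    then show ?thesis using that by (metis dvd_diff_left_iff dvd_mult)
  qed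
  moreover have "int p dvd c + (u * b - v * a) \<longleftrightarrow> int p dvd c" if "int p dvd a" "int p dvd b"
    using that by (metis dvd_add_left_iff dvd_diff dvd_mult)
  ultimately show ?thesis
    by (cases t) (auto simp: hmem_def conj_param_def mod)
qed

lemma conj_Hs: "F u v w <# Hs t #> inv (F u v w) = Hs (conj_param u v t)"
proof (rule conj_eqI)
  \<comment> \<open>The alternating term enters the two products with opposite signs, which makes a
    difference of \<open>2 * h\<close> times the form, that is, the form itself modulo
    \<open>p\<close>.\<close>
  have swap: "F u v w \<otimes> F a b c = F a b (c + (u * b - v * a)) \<otimes> F u v w" for a b c
  proof -
    have "(w + c + h * (u * b - v * a)) - (c + (u * b - v * a) + w + h * (a * v - b * u)) =
        (2 * h - 1) * (u * b - v * a)"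
      by (simp add: algebra_simps)
    then show ?thesis unfolding F_mult F_eq_iff using h by (simp add: add.commute)
  qed
  {
    fix g assume "g \<in> Hs t"
    then obtain a b c where g: "g = F a b c" "hmem t a b c" by (auto simp: Hs_def)
    then have "F a b (c + (u * b - v * a)) \<in> Hs (conj_param u v t)"
      by (simp add: F_in_Hs_iff hmem_conj_param)
    then show "\<exists>g'\<in>Hs (conj_param u v t). F u v w \<otimes> g = g' \<otimes> F u v w"
      using swap g(1) by blast
  next
    fix g' assume "g' \<in> Hs (conj_param u v t)"
    then obtain a b c where g': "g' = F a b c" "hmem (conj_param u v t) a b c" by (auto simp: Hs_def)
    then have "F a b (c - (u * b - v * a)) \<in> Hs t"
      using hmem_conj_param[of u v t a b "c - (u * b - v * a)"] by (simp add: F_in_Hs_iff)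
    then show "\<exists>g\<in>Hs t. F u v w \<otimes> g = g' \<otimes> F u v w"
      using swap[of a b "c - (u * b - v * a)"] g'(1) by auto
  }
qed (auto simp: Hs_def)

text \<open>The shifts take every value, so a noncentral line is conjugate to exactly those lines
  with the same projection; the one with \<gamma> = 0 serves as representative.\<close>

definition class_inv :: "heis_param \<Rightarrow> heis_param" where
  "class_inv t = (case t of LineX \<beta> \<gamma> \<Rightarrow> LineX \<beta> 0 | LineY \<gamma> \<Rightarrow> LineY 0 | _ \<Rightarrow> t)"

lemma num_subgroup_classes: "num_subgroup_classes G = 2 * p + 5"
proof -
  let ?R = "{0..<int p}"
  have p0: "p > 0" using prime_gt_0_nat[OF p] .
  have "num_subgroup_classes G = card (class_inv ` params)"
  proof (rule num_subgroup_classes_eq[OF bij_betw_Hs])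
    fix t t' assume t: "t \<in> params" and t': "t' \<in> params"
    have "(\<exists>g\<in>carrier G. Hs t' = g <# Hs t #> inv g) \<longleftrightarrow> (\<exists>u v. Hs t' = Hs (conj_param u v t))"
      using F_surj conj_Hs by (metis F_closed)
    also have "\<dots> \<longleftrightarrow> (\<exists>u v. t' = conj_param u v t)"
      using Hs_inject[OF t' conj_param_in_params[OF t]] by metis
    also have "\<dots> \<longleftrightarrow> class_inv t = class_inv t'"
    proof
      assume "\<exists>u v. t' = conj_param u v t"
      then show "class_inv t = class_inv t'"
        by (auto simp: class_inv_def conj_param_def split: heis_param.splits)
    next
      assume eq: "class_inv t = class_inv t'"
      show "\<exists>u v. t' = conj_param u v t"
      proof (cases t)
        case (LineX \<beta> \<gamma>)
        then obtain \<gamma>' where \<gamma>': "t' = LineX \<beta> \<gamma>'"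
          using eq by (cases t') (auto simp: class_inv_def)
        then have "t' = conj_param 0 (\<gamma> - \<gamma>') t" using t' \<gamma>' by (simp add: LineX conj_param_def)
        then show ?thesis by blast
      next
        case (LineY \<gamma>)
        then obtain \<gamma>' where \<gamma>': "t' = LineY \<gamma>'"
          using eq by (cases t') (auto simp: class_inv_def)
        then have "t' = conj_param (\<gamma>' - \<gamma>) 0 t" using t' \<gamma>' by (simp add: LineY conj_param_def)
        then show ?thesis by blast
      qed (use eq in \<open>cases t'; simp add: class_inv_def conj_param_def\<close>)+
    qed
    finally show "class_inv t = class_inv t' \<longleftrightarrow> (\<exists>g\<in>carrier G. Hs t' = g <# Hs t #> inv g)" by blast
  qed
  also have "class_inv ` params = {Triv, Whole, Cent, PlaneY, LineY 0} \<union> (\<lambda>\<beta>. LineX \<beta> 0) ` ?R \<union> PlaneX ` ?R"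
    (is "_ = ?A")
  proof (intro equalityI subsetI)
    fix t assume "t \<in> class_inv ` params"
    then obtain t' where "t' \<in> params" "t = class_inv t'" by blast
    then show "t \<in> ?A" by (cases t') (auto simp: class_inv_def)
  next
    fix t assume "t \<in> ?A"
    then have "t \<in> params" "t = class_inv t" using p0 by (auto simp: class_inv_def)
    then show "t \<in> class_inv ` params" by blast
  qed
  also have "card \<dots> = card {Triv, Whole, Cent, PlaneY, LineY 0} + card ((\<lambda>\<beta>. LineX \<beta> 0) ` ?R) + card (PlaneX ` ?R)"
    by (subst card_Un_disjoint; (subst card_Un_disjoint)?; auto)
  also have "card ((\<lambda>\<beta>. LineX \<beta> 0) ` ?R) = p" by (subst card_image) (auto intro!: inj_onI)
  also have "card (PlaneX ` ?R) = p" by (subst card_image) (auto intro!: inj_onI)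
  finally show ?thesis by simp
qed

end

section \<open>The presentation of the Heisenberg group\<close>

lemma (in group) commute_int_pow:
  assumes "u \<in> carrier G" "w \<in> carrier G" "u \<otimes> w = w \<otimes> u"
  shows "u [^] (a::int) \<otimes> w [^] (b::int) = w [^] b \<otimes> u [^] a"
proof -
  have "w [^] b \<otimes> u = u \<otimes> w [^] b"
    using intertwine_int_pow[OF assms(1,2,2,3), of b] by simp
  then show ?thesis
    using intertwine_int_pow[of "w [^] b" u u a] assms(1,2) by simp
qed

text \<open>Each exchange of a \<open>y\<close> with an \<open>x\<close> costs one central factor
  \<open>inv z\<close>; moving \<open>b\<close> copies past \<open>a\<close> copies costs a * b of
  them.\<close>

lemma (in group) heisenberg_commutation:
  assumes x: "x \<in> carrier G" and y: "y \<in> carrier G" and z: "z \<in> carrier G"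
    and xz: "x \<otimes> z = z \<otimes> x" and yz: "y \<otimes> z = z \<otimes> y" and xy: "x \<otimes> y = z \<otimes> y \<otimes> x"
  shows "y [^] (b::int) \<otimes> x [^] (a::int) = x [^] a \<otimes> y [^] b \<otimes> z [^] (- (a * b))"
proof -
  note [simp] = x y z
  have zx: "z [^] i \<otimes> x [^] j = x [^] j \<otimes> z [^] i" and zy: "z [^] i \<otimes> y [^] j = y [^] j \<otimes> z [^] i"
    for i j :: int
    using commute_int_pow[of z x i j] commute_int_pow[of z y i j] xz yz by simp_all
  have "x \<otimes> y [^] b = (z \<otimes> y) [^] b \<otimes> x"
    using intertwine_int_pow[of x y "z \<otimes> y" b] xy by simp
  then have "x \<otimes> y [^] b = z [^] b \<otimes> y [^] b \<otimes> x"
    using yz by (simp add: int_pow_mult_distrib)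
  then have "z [^] (- b) \<otimes> (x \<otimes> y [^] b) = y [^] b \<otimes> x"
    by (simp add: int_pow_neg m_assoc[symmetric])
  then have "y [^] b \<otimes> x = (z [^] (- b) \<otimes> x) \<otimes> y [^] b"
    by (simp add: m_assoc)
  then have "y [^] b \<otimes> x [^] a = (z [^] (- b) \<otimes> x) [^] a \<otimes> y [^] b"
    by (intro intertwine_int_pow) simp_all
  also have "(z [^] (- b) \<otimes> x) [^] a = z [^] (- (a * b)) \<otimes> x [^] a"
  proof -
    have c: "z [^] (- b) \<otimes> x = x \<otimes> z [^] (- b)" using zx[of "- b" 1] by simp
    have "(z [^] (- b) \<otimes> x) [^] a = (z [^] (- b)) [^] a \<otimes> x [^] a"
      by (rule int_pow_mult_distrib[OF c]) simp_all
    also have "(z [^] (- b)) [^] a = z [^] (- (a * b))"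
      by (simp only: int_pow_pow z) (simp add: mult.commute)
    finally show ?thesis .
  qed
  also have "z [^] (- (a * b)) \<otimes> x [^] a \<otimes> y [^] b = x [^] a \<otimes> (z [^] (- (a * b)) \<otimes> y [^] b)"
    by (simp add: zx m_assoc)
  also have "\<dots> = x [^] a \<otimes> y [^] b \<otimes> z [^] (- (a * b))"
    by (simp add: zy m_assoc)
  finally show ?thesis .
qed

text \<open>The coordinates \<open>(a, b, c)\<close> stand for \<open>x\<^sup>a y\<^sup>b z\<^sup>c\<close>, acted upon by left multiplication.\<close>

definition heis_step :: "nat \<Rightarrow> gen3 \<Rightarrow> int \<times> int \<times> int \<Rightarrow> int \<times> int \<times> int" where
  "heis_step p g = (\<lambda>(a, b, c). case g of
     hx \<Rightarrow> ((a + 1) mod int p, b, c)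
   | hy \<Rightarrow> (a, (b + 1) mod int p, (c - a) mod int p)
   | hz \<Rightarrow> (a, b, (c + 1) mod int p))"

lemma heis_step_simps [simp]:
  "heis_step p hx (a, b, c) = ((a + 1) mod int p, b, c)"
  "heis_step p hy (a, b, c) = (a, (b + 1) mod int p, (c - a) mod int p)"
  "heis_step p hz (a, b, c) = (a, b, (c + 1) mod int p)"
  by (simp_all add: heis_step_def)

abbreviation heis_box :: "nat \<Rightarrow> (int \<times> int \<times> int) set" where
  "heis_box p \<equiv> {0..<int p} \<times> {0..<int p} \<times> {0..<int p}"

lemma bij_heis_step:
  assumes "p > 0"
  shows "bij_betw (heis_step p g) (heis_box p) (heis_box p)"
proof -
  have shift: "u = v" if "(u + w) mod int p = (v + w) mod int p" "0 \<le> u" "u < int p" "0 \<le> v" "v < int p" for u v w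
  proof -
    have "[u = v] (mod int p)" using that(1) by (metis cong_add_rcancel cong_def)
    then show ?thesis using that by (simp add: cong_def)
  qed
  have "inj_on (heis_step p g) (heis_box p)"
  proof (rule inj_onI)
    fix s t assume s: "s \<in> heis_box p" and t: "t \<in> heis_box p" and eq: "heis_step p g s = heis_step p g t"
    obtain a b c a' b' c' where st: "s = (a, b, c)" "t = (a', b', c')" by (metis prod_cases3)
    show "s = t"
      using s t eq shift[of a 1 a'] shift[of b 1 b'] shift[of c 1 c'] shift[of c "- a" c']
      by (cases g) (auto simp: st)
  qed
  moreover have "heis_step p g ` heis_box p \<subseteq> heis_box p"
    using assms by (cases g) auto
  ultimately show ?thesis by (simp add: bij_betw_def endo_inj_surj)
qed

lemma heis_step_pow:
  assumes "(a, b, c) \<in> heis_box p"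
  shows "(heis_step p hx ^^ t) (a, b, c) = ((a + int t) mod int p, b, c)"
    and "(heis_step p hy ^^ t) (a, b, c) = (a, (b + int t) mod int p, (c - int t * a) mod int p)"
    and "(heis_step p hz ^^ t) (a, b, c) = (a, b, (c + int t) mod int p)"
  using assms by (induction t) (auto simp: mod_simps algebra_simps)

text \<open>Writing \<open>s\<close> as the image of some \<open>w\<close> under
  \<open>\<pi> g\<close> followed by \<open>\<pi> g'\<close> cancels the two inverse letters, so a
  commutator relation is checked on forward maps only.\<close>

lemma word_act_comm:
  assumes bij: "\<And>g. bij_betw (\<pi> g) X X" and s: "s \<in> X"
    and comm: "\<And>s. s \<in> X \<Longrightarrow> \<pi> g (\<pi> g' s) = \<tau> (\<pi> g' (\<pi> g s))"
  shows "word_act \<pi> X (word_comm (gen g) (gen g')) s = \<tau> s"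
proof -
  define t where "t = inv_into X (\<pi> g') s"
  define w where "w = inv_into X (\<pi> g) t"
  have img: "\<pi> f ` X = X" for f using bij by (simp add: bij_betw_def)
  have t: "t \<in> X" "\<pi> g' t = s"
    using s img[of g'] by (auto simp: t_def inv_into_into f_inv_into_f)
  have w: "w \<in> X" "\<pi> g w = t"
    using t(1) img[of g] by (auto simp: w_def inv_into_into f_inv_into_f)
  show ?thesis
    using comm[OF w(1)] by (simp add: word_comm_def word_act_inv_gen w(2) t(2) flip: t_def w_def)
qed

lemma heisenberg_heisenberg_group:
  assumes p: "prime p" "odd p"
  obtains F h where "heisenberg (heisenberg_group p) F p h"
proof -
  define R where "R =
     {(word_pow (gen hx) p, []),
      (word_pow (gen hy) p, []),
      (word_pow (gen hz) p, []),
      (word_comm (gen hx) (gen hz), []),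
      (word_comm (gen hy) (gen hz), []),
      (word_comm (gen hx) (gen hy), gen hz)}"
  let ?G = "presented_group R"
  have G: "heisenberg_group p = ?G" by (simp add: heisenberg_group_def R_def)
  have p0: "p > 0" using p by (simp add: prime_gt_0_nat)
  interpret group ?G by (rule group_presented_group)
  define x where "x = word_class R (gen hx)"
  define y where "y = word_class R (gen hy)"
  define z where "z = word_class R (gen hz)"
  have [simp]: "x \<in> carrier ?G" "y \<in> carrier ?G" "z \<in> carrier ?G"
    by (simp_all add: x_def y_def z_def)
  have pow: "x [^]\<^bsub>?G\<^esub> p = \<one>\<^bsub>?G\<^esub>" "y [^]\<^bsub>?G\<^esub> p = \<one>\<^bsub>?G\<^esub>" "z [^]\<^bsub>?G\<^esub> p = \<one>\<^bsub>?G\<^esub>"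
    unfolding x_def y_def z_def word_class_word_pow[symmetric] one_presented_group
    by (rule word_class_rel, simp add: R_def)+
  have comm: "u \<otimes>\<^bsub>?G\<^esub> v = w \<otimes>\<^bsub>?G\<^esub> v \<otimes>\<^bsub>?G\<^esub> u"
    if "u \<otimes>\<^bsub>?G\<^esub> (v \<otimes>\<^bsub>?G\<^esub> (inv\<^bsub>?G\<^esub> u \<otimes>\<^bsub>?G\<^esub> inv\<^bsub>?G\<^esub> v)) = w"
      "u \<in> carrier ?G" "v \<in> carrier ?G" "w \<in> carrier ?G" for u v w
    using that(2-4) by (simp add: that(1)[symmetric] m_assoc)
  have "x \<otimes>\<^bsub>?G\<^esub> (z \<otimes>\<^bsub>?G\<^esub> (inv\<^bsub>?G\<^esub> x \<otimes>\<^bsub>?G\<^esub> inv\<^bsub>?G\<^esub> z)) = \<one>\<^bsub>?G\<^esub>"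
    "y \<otimes>\<^bsub>?G\<^esub> (z \<otimes>\<^bsub>?G\<^esub> (inv\<^bsub>?G\<^esub> y \<otimes>\<^bsub>?G\<^esub> inv\<^bsub>?G\<^esub> z)) = \<one>\<^bsub>?G\<^esub>"
    "x \<otimes>\<^bsub>?G\<^esub> (y \<otimes>\<^bsub>?G\<^esub> (inv\<^bsub>?G\<^esub> x \<otimes>\<^bsub>?G\<^esub> inv\<^bsub>?G\<^esub> y)) = z"
    unfolding x_def y_def z_def one_presented_group word_class_word_inv[symmetric] mult_presented_group
    by (rule word_class_rel, simp add: R_def word_comm_def)+
  then have xz: "x \<otimes>\<^bsub>?G\<^esub> z = z \<otimes>\<^bsub>?G\<^esub> x" and yz: "y \<otimes>\<^bsub>?G\<^esub> z = z \<otimes>\<^bsub>?G\<^esub> y"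
    and xy: "x \<otimes>\<^bsub>?G\<^esub> y = z \<otimes>\<^bsub>?G\<^esub> y \<otimes>\<^bsub>?G\<^esub> x"
    using comm[of x z "\<one>\<^bsub>?G\<^esub>"] comm[of y z "\<one>\<^bsub>?G\<^esub>"] comm[of x y z] by simp_all
  define E where "E a b c = x [^]\<^bsub>?G\<^esub> a \<otimes>\<^bsub>?G\<^esub> y [^]\<^bsub>?G\<^esub> b \<otimes>\<^bsub>?G\<^esub> z [^]\<^bsub>?G\<^esub> c" for a b c :: int
  have E_closed [simp]: "E a b c \<in> carrier ?G" for a b c by (simp add: E_def)
  have zx: "z [^]\<^bsub>?G\<^esub> i \<otimes>\<^bsub>?G\<^esub> x [^]\<^bsub>?G\<^esub> j = x [^]\<^bsub>?G\<^esub> j \<otimes>\<^bsub>?G\<^esub> z [^]\<^bsub>?G\<^esub> i"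
    and zy: "z [^]\<^bsub>?G\<^esub> i \<otimes>\<^bsub>?G\<^esub> y [^]\<^bsub>?G\<^esub> j = y [^]\<^bsub>?G\<^esub> j \<otimes>\<^bsub>?G\<^esub> z [^]\<^bsub>?G\<^esub> i" for i j :: int
    using commute_int_pow[of z x i j] commute_int_pow[of z y i j] xz yz by simp_all
  have E_mult: "E a b c \<otimes>\<^bsub>?G\<^esub> E a' b' c' = E (a + a') (b + b') (c + c' - b * a')" for a b c a' b' c'
  proof -
    have "E a b c \<otimes>\<^bsub>?G\<^esub> E a' b' c' = x [^]\<^bsub>?G\<^esub> a \<otimes>\<^bsub>?G\<^esub> (y [^]\<^bsub>?G\<^esub> b \<otimes>\<^bsub>?G\<^esub>
        (z [^]\<^bsub>?G\<^esub> c \<otimes>\<^bsub>?G\<^esub> x [^]\<^bsub>?G\<^esub> a')) \<otimes>\<^bsub>?G\<^esub> y [^]\<^bsub>?G\<^esub> b' \<otimes>\<^bsub>?G\<^esub> z [^]\<^bsub>?G\<^esub> c'"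
      by (simp add: E_def m_assoc)
    also have "\<dots> = x [^]\<^bsub>?G\<^esub> a \<otimes>\<^bsub>?G\<^esub> (y [^]\<^bsub>?G\<^esub> b \<otimes>\<^bsub>?G\<^esub> x [^]\<^bsub>?G\<^esub> a') \<otimes>\<^bsub>?G\<^esub>
        (z [^]\<^bsub>?G\<^esub> c \<otimes>\<^bsub>?G\<^esub> y [^]\<^bsub>?G\<^esub> b') \<otimes>\<^bsub>?G\<^esub> z [^]\<^bsub>?G\<^esub> c'"
      by (simp add: zx m_assoc)
    also have "\<dots> = x [^]\<^bsub>?G\<^esub> a \<otimes>\<^bsub>?G\<^esub> (x [^]\<^bsub>?G\<^esub> a' \<otimes>\<^bsub>?G\<^esub> y [^]\<^bsub>?G\<^esub> b \<otimes>\<^bsub>?G\<^esub> z [^]\<^bsub>?G\<^esub> (- (a' * b))) \<otimes>\<^bsub>?G\<^esub>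
        (y [^]\<^bsub>?G\<^esub> b' \<otimes>\<^bsub>?G\<^esub> z [^]\<^bsub>?G\<^esub> c) \<otimes>\<^bsub>?G\<^esub> z [^]\<^bsub>?G\<^esub> c'"
      by (subst heisenberg_commutation[of x y z b a']) (simp_all add: xz yz xy zy)
    also have "\<dots> = x [^]\<^bsub>?G\<^esub> a \<otimes>\<^bsub>?G\<^esub> x [^]\<^bsub>?G\<^esub> a' \<otimes>\<^bsub>?G\<^esub> y [^]\<^bsub>?G\<^esub> b \<otimes>\<^bsub>?G\<^esub>
        (z [^]\<^bsub>?G\<^esub> (- (a' * b)) \<otimes>\<^bsub>?G\<^esub> y [^]\<^bsub>?G\<^esub> b') \<otimes>\<^bsub>?G\<^esub> (z [^]\<^bsub>?G\<^esub> c \<otimes>\<^bsub>?G\<^esub> z [^]\<^bsub>?G\<^esub> c')"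
      by (simp add: m_assoc)
    also have "\<dots> = (x [^]\<^bsub>?G\<^esub> a \<otimes>\<^bsub>?G\<^esub> x [^]\<^bsub>?G\<^esub> a') \<otimes>\<^bsub>?G\<^esub> (y [^]\<^bsub>?G\<^esub> b \<otimes>\<^bsub>?G\<^esub> y [^]\<^bsub>?G\<^esub> b') \<otimes>\<^bsub>?G\<^esub>
        (z [^]\<^bsub>?G\<^esub> (- (a' * b)) \<otimes>\<^bsub>?G\<^esub> z [^]\<^bsub>?G\<^esub> c \<otimes>\<^bsub>?G\<^esub> z [^]\<^bsub>?G\<^esub> c')"
      by (simp add: zy m_assoc)
    finally show ?thesis by (simp add: E_def int_pow_mult[symmetric] algebra_simps)
  qed
  have E_cong: "E a b c = E a' b' c'" if "int p dvd a - a'" "int p dvd b - b'" "int p dvd c - c'" for a b c a' b' c'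
  proof -
    have "g [^]\<^bsub>?G\<^esub> i = g [^]\<^bsub>?G\<^esub> j" if d: "int p dvd i - j" and g: "g [^]\<^bsub>?G\<^esub> p = \<one>\<^bsub>?G\<^esub>" "g \<in> carrier ?G"
      for g and i j :: int
    proof -
      from d obtain t where "i - j = int p * t" by (elim dvdE)
      then have "i = j + int p * t" by simp
      then show ?thesis using g by (simp add: int_pow_mult int_pow_pow[symmetric] int_pow_int)
    qed
    then show ?thesis using that pow by (simp add: E_def)
  qed
  have gens: "x = E 1 0 0" "y = E 0 1 0" "z = E 0 0 1"
    "inv\<^bsub>?G\<^esub> x = E (-1) 0 0" "inv\<^bsub>?G\<^esub> y = E 0 (-1) 0" "inv\<^bsub>?G\<^esub> z = E 0 0 (-1)" "\<one>\<^bsub>?G\<^esub> = E 0 0 0"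
    by (simp_all add: E_def int_pow_neg)
  have E_surj: "\<exists>a b c. g = E a b c" if "g \<in> carrier ?G" for g
    using that
  proof (rule presented_group_induct)
    show "\<exists>a b c. \<one>\<^bsub>?G\<^esub> = E a b c" unfolding gens by blast
    fix f B assume "\<exists>a b c. B = E a b c"
    then obtain a b c where B: "B = E a b c" by blast
    show "\<exists>a b c. word_class R (gen f) \<otimes>\<^bsub>?G\<^esub> B = E a b c"
      by (cases f) (auto simp: B gens E_mult simp flip: x_def y_def z_def)
    show "\<exists>a b c. inv\<^bsub>?G\<^esub> word_class R (gen f) \<otimes>\<^bsub>?G\<^esub> B = E a b c"
      by (cases f) (auto simp: B gens(4-6) E_mult simp flip: x_def y_def z_def)
  qed
  have kernel: "int p dvd a \<and> int p dvd b \<and> int p dvd c" if E1: "E a b c = \<one>\<^bsub>?G\<^esub>" for a b c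
  proof -
    define i j k where "i = nat (a mod int p)" and "j = nat (b mod int p)" and "k = nat (c mod int p)"
    have ijk: "int i = a mod int p" "int j = b mod int p" "int k = c mod int p"
      using p0 by (simp_all add: i_def j_def k_def)
    let ?w = "word_pow (gen hx) i @ word_pow (gen hy) j @ word_pow (gen hz) k"
    have gen: "word_act (heis_step p) (heis_box p) (gen g) = heis_step p g" for g
      by (rule ext) simp
    have "E a b c = E (int i) (int j) (int k)"
      by (rule E_cong) (simp_all add: ijk minus_mod_eq_mult_div)
    also have "\<dots> = word_class R ?w"
      unfolding E_def x_def y_def z_def
      by (simp add: int_pow_int m_assoc word_class_word_pow flip: mult_presented_group)
    finally have "word_class R ?w = word_class R []" using E1 by (simp add: one_presented_group)
    then have eq: "pres_eq R ?w []" by (simp only: word_class_eq_iff)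
    have "word_act (heis_step p) (heis_box p) ?w (0, 0, 0) = word_act (heis_step p) (heis_box p) [] (0, 0, 0)"
    proof (rule pres_eq_word_act[OF bij_heis_step[OF p0] _ eq])
      fix u v s assume uv: "(u, v) \<in> R" and s: "s \<in> heis_box p"
      obtain a b c where abc: "s = (a, b, c)" by (metis prod_cases3)
      have comm: "word_act (heis_step p) (heis_box p) (word_comm (gen g) (gen g')) s = \<tau> s"
        if "\<And>s. s \<in> heis_box p \<Longrightarrow> heis_step p g (heis_step p g' s) = \<tau> (heis_step p g' (heis_step p g s))"
        for g g' \<tau>
        by (rule word_act_comm[where g = g and g' = g' and \<tau> = \<tau>, OF bij_heis_step[OF p0] s]) (rule that)
      consider "u = word_pow (gen hx) p" "v = []" | "u = word_pow (gen hy) p" "v = []"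
        | "u = word_pow (gen hz) p" "v = []" | "u = word_comm (gen hx) (gen hz)" "v = []"
        | "u = word_comm (gen hy) (gen hz)" "v = []" | "u = word_comm (gen hx) (gen hy)" "v = gen hz"
        using uv unfolding R_def insert_iff empty_iff prod.inject by blast
      then show "word_act (heis_step p) (heis_box p) u s = word_act (heis_step p) (heis_box p) v s"
      proof cases
        case 4
        show ?thesis unfolding 4 word_act_simps by (rule comm[where \<tau> = "\<lambda>s. s"]) auto
      next
        case 5
        show ?thesis unfolding 5 word_act_simps by (rule comm[where \<tau> = "\<lambda>s. s"]) (auto simp: mod_simps algebra_simps)
      next
        case 6
        show ?thesis unfolding 6 word_act_simps by (rule comm) (auto simp: mod_simps algebra_simps)
      next
        case 2
        \<comment> \<open>Each application of \<open>hy\<close> also subtracts \<open>a\<close> from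
          the third coordinate, in total a multiple of \<open>p\<close>.\<close>
        have "(c - int p * a) mod int p = c mod int p" by (simp add: mod_eq_dvd_iff)
        then show ?thesis using s by (auto simp: 2 word_act_word_pow gen abc heis_step_pow)
      qed (use s in \<open>auto simp: word_act_word_pow gen abc heis_step_pow\<close>)
    qed (use p0 in simp)
    then have "(int i mod int p, int j mod int p, int k mod int p) = (0, 0, 0)"
      using p0 by (simp add: word_act_word_pow gen heis_step_pow)
    then show ?thesis by (simp add: ijk mod_eq_0_iff_dvd)
  qed
  define h where "h = (int p + 1) div 2"
  have h: "2 * h - 1 = int p" using p(2) unfolding h_def by (elim oddE) simp
  \<comment> \<open>The shift by \<open>h * (a * b)\<close> is the coboundary that replaces the
    cocycle \<open>- b * a'\<close> of the product law for \<open>E\<close> by its alternating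
    form.\<close>
  define F where "F a b c = E a b (c - h * (a * b))" for a b c
  have F_mult: "F a b c \<otimes>\<^bsub>?G\<^esub> F a' b' c' = F (a + a') (b + b') (c + c' + h * (a * b' - b * a'))" for a b c a' b' c'
  proof -
    have "(c - h * (a * b) + (c' - h * (a' * b')) - b * a') -
        (c + c' + h * (a * b' - b * a') - h * ((a + a') * (b + b'))) = (2 * h - 1) * (b * a')"
      by (simp add: algebra_simps)
    then show ?thesis unfolding F_def E_mult by (intro E_cong) (simp_all add: h)
  qed
  have "heisenberg ?G F p h"
  proof
    show "\<exists>a b c. g = F a b c" if "g \<in> carrier ?G" for g
    proof -
      obtain a b c where "g = E a b c" using E_surj \<open>g \<in> carrier ?G\<close> by blast
      then have "g = F a b (c + h * (a * b))" by (simp add: F_def)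
      then show ?thesis by blast
    qed
    show "F a b c = F a' b' c' \<longleftrightarrow> int p dvd a - a' \<and> int p dvd b - b' \<and> int p dvd c - c'" for a b c a' b' c'
    proof
      assume eq: "F a b c = F a' b' c'"
      have "F (- a') (- b') (- c') \<otimes>\<^bsub>?G\<^esub> F a' b' c' = \<one>\<^bsub>?G\<^esub>"
        unfolding F_mult unfolding gens(7) F_def by simp
      then have "F (- a') (- b') (- c') \<otimes>\<^bsub>?G\<^esub> F a b c = \<one>\<^bsub>?G\<^esub>" by (simp only: eq)
      then have *: "int p dvd - a' + a" "int p dvd - b' + b"
        "int p dvd - c' + c + h * (- a' * b - - b' * a) - h * ((- a' + a) * (- b' + b))"
        unfolding F_mult unfolding F_def by (auto dest!: kernel)
      \<comment> \<open>All correction terms are multiples of \<open>- a' + a\<close> or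
        \<open>- b' + b\<close>, which are already known to vanish modulo \<open>p\<close>.\<close>
      have "c - c' = (- c' + c + h * (- a' * b - - b' * a) - h * ((- a' + a) * (- b' + b)))
          - h * b' * (- a' + a) + h * a' * (- b' + b) + h * (- a' + a) * (- b' + b)"
        by (simp add: algebra_simps)
      then have "int p dvd c - c'" using * by (simp only: dvd_add dvd_diff dvd_mult)
      then show "int p dvd a - a' \<and> int p dvd b - b' \<and> int p dvd c - c'"
        using * by simp
    next
      assume *: "int p dvd a - a' \<and> int p dvd b - b' \<and> int p dvd c - c'"
      have "(c - h * (a * b)) - (c' - h * (a' * b')) = (c - c') - h * b * (a - a') - h * a' * (b - b')"
        by (simp add: algebra_simps)
      then have "int p dvd (c - h * (a * b)) - (c' - h * (a' * b'))"
        using * by (simp only: dvd_diff dvd_mult)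
      then show "F a b c = F a' b' c'" unfolding F_def using * by (intro E_cong) simp_all
    qed
  qed (use p h F_mult in \<open>simp_all add: F_def\<close>)
  then show ?thesis unfolding G[symmetric] by (rule that)
qed

section \<open>The ratios and their monotonicity\<close>

lemma d'_modular_group:
  assumes p: "prime p" and n: "if p = 2 then n \<ge> 4 else n \<ge> 3"
  shows "d' (modular_group p n) =
    ((real n - 2) * (real p + 1) + 4) / ((real n - 1) * (real p + 1) + 2)"
proof -
  define b where "b = n - 2"
  have b: "b \<ge> 1" "p = 2 \<Longrightarrow> b \<ge> 2" "n = b + 2"
    using n by (auto simp: b_def split: if_splits)
  obtain x y where "metacyclic (modular_group p (b + 2)) x y (p ^ (b + 1)) p (1 + int (p ^ b))"
    using metacyclic_modular_group[OF p b(1)] .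
  from metacyclic.modular_counts[OF this p b(1,2)] show ?thesis
    by (simp add: d'_def b(3) algebra_simps)
qed

lemma d'_Gpqn:
  assumes p: "prime p" and q: "prime q" and qp: "q dvd p - 1" and n: "n \<ge> 2" and G: "is_Gpqn p q n G"
  shows "d' G = 2 * real n / (2 * real n + real p - 1)"
proof -
  obtain x y r where mc: "metacyclic G x y p (q ^ (n - 1)) r"
    and r: "[r ^ q = 1] (mod int p)" "\<not> [r = 1] (mod int p)"
    using metacyclic_Gpqn[OF p q n G] .
  have "q \<noteq> p"
    using qp prime_gt_1_nat[OF p] by (auto dest: dvd_imp_le)
  from metacyclic.Gpqn_counts[OF mc p q this _ _ r, of "n - 1"] n show ?thesis
    by (simp add: d'_def of_nat_diff algebra_simps)
qed

lemma d'_dihedral_group: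
  assumes "n \<ge> 3"
  shows "d' (dihedral_group (2 ^ (n - 1))) = (3 * real n - 1) / (2 ^ n + real n - 1)"
proof -
  obtain x y where "metacyclic (dihedral_group (2 ^ (n - 1))) x y (2 ^ (n - 1)) 2 (-1)"
    using metacyclic_dihedral_group[of "2 ^ (n - 1)"] by auto
  from metacyclic.dihedral_counts[OF this, of "n - 1"] assms show ?thesis
    by (simp add: d'_def of_nat_diff algebra_simps)
qed

lemma d'_heisenberg_group:
  assumes "prime p" "odd p"
  shows "d' (heisenberg_group p) = (2 * real p + 5) / (real p ^ 2 + 2 * real p + 4)"
proof -
  obtain F h where "heisenberg (heisenberg_group p) F p h"
    using heisenberg_heisenberg_group[OF assms] .
  then show ?thesis
    by (simp add: d'_def heisenberg.card_subgroup_lattice heisenberg.num_subgroup_classes)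
qed

text \<open>Each ratio is 1 minus c - 1 over the denominator: the excess of subgroups over classes
  is p - 1 for every n, while the number of subgroups grows.\<close>

lemma modular_ratio_less:
  fixes a b c :: real
  assumes "a < b" "1 < a" "1 < c"
  shows "((a - 2) * (c + 1) + 4) / ((a - 1) * (c + 1) + 2) < ((b - 2) * (c + 1) + 4) / ((b - 1) * (c + 1) + 2)"
proof -
  have pos: "(t - 1) * (c + 1) + 2 > 0" if "1 < t" for t
    using that assms(3) by (intro add_pos_pos mult_pos_pos) auto
  have eq: "((t - 2) * (c + 1) + 4) / ((t - 1) * (c + 1) + 2) = 1 - (c - 1) / ((t - 1) * (c + 1) + 2)" if "1 < t" for t
    using pos[OF that] by (simp add: field_simps)
  have "(a - 1) * (c + 1) + 2 < (b - 1) * (c + 1) + 2" using assms by simp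
  then have "(c - 1) / ((b - 1) * (c + 1) + 2) < (c - 1) / ((a - 1) * (c + 1) + 2)"
    using pos[of a] pos[of b] assms by (intro divide_strict_left_mono mult_pos_pos) auto
  then show ?thesis using assms by (simp add: eq)
qed

lemma strict_mono_modular_group:
  assumes p: "prime p" and k: "k \<ge> (if p = 2 then 4 else 3)"
  shows "strict_mono_on {k..} (\<lambda>n. d' (modular_group p n))"
proof (rule strict_mono_onI)
  fix n n' assume n: "n \<in> {k..}" "n' \<in> {k..}" "n < n'"
  then have "if p = 2 then n \<ge> 4 else n \<ge> 3" "if p = 2 then n' \<ge> 4 else n' \<ge> 3"
    using k by (auto split: if_splits)
  moreover have "1 < real n" "1 < real p"
    using n k prime_gt_1_nat[OF p] by (auto split: if_splits)
  ultimately show "d' (modular_group p n) < d' (modular_group p n')"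
    using n by (simp add: d'_modular_group[OF p] modular_ratio_less)
qed

lemma strict_mono_Gpqn:
  assumes p: "prime p" and q: "prime q" and qp: "q dvd p - 1" and G: "\<forall>n \<ge> 2. is_Gpqn p q n (G n)"
  shows "strict_mono_on {2..} (\<lambda>n. d' (G n))"
proof (rule strict_mono_onI)
  fix n n' :: nat assume n: "n \<in> {2..}" "n' \<in> {2..}" "n < n'"
  have p1: "real p > 1" using prime_gt_1_nat[OF p] by simp
  then have "2 * real n * (real p - 1) < 2 * real n' * (real p - 1)" using n by simp
  \<comment> \<open>In the cross-multiplied inequality the common term 4 * n * n' cancels.\<close>
  then have "2 * real n * (2 * real n' + real p - 1) < 2 * real n' * (2 * real n + real p - 1)"
    by (simp add: algebra_simps)
  moreover have "2 * real n + real p - 1 > 0" "2 * real n' + real p - 1 > 0"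
    using p1 by simp_all
  ultimately have "2 * real n / (2 * real n + real p - 1) < 2 * real n' / (2 * real n' + real p - 1)"
    by (simp only: pos_divide_less_eq times_divide_eq_left pos_less_divide_eq)
  moreover have "d' (G m) = 2 * real m / (2 * real m + real p - 1)" if "m \<ge> 2" for m
    using d'_Gpqn[OF p q qp that] G that by blast
  ultimately show "d' (G n) < d' (G n')" using n by simp
qed

lemma strict_antimono_dihedral_group:
  "strict_antimono_on {3..} (\<lambda>n :: nat. d' (dihedral_group (2 ^ (n - 1))))"
proof (rule monotone_onI)
  define f :: "nat \<Rightarrow> real" where "f n = (3 * real n - 1) / (2 ^ n + real n - 1)" for n
  have step: "f (Suc n) < f n" if "n \<ge> 3" for n
  proof -
    have pos: "2 ^ n + real n - 1 > 0" "2 ^ Suc n + real (Suc n) - 1 > 0"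
      using that by (auto intro: add_pos_nonneg add_nonneg_pos simp: add_diff_eq[symmetric] simp del: power_Suc)
    \<comment> \<open>This is the cross-multiplied difference of \<open>f n\<close> and
      \<open>f (Suc n)\<close>, in which all terms without a power of 2 collapse to the constant
      2.\<close>
    have "0 < 2 ^ n * (3 * real n - 4) + 2" using that by (intro add_pos_pos mult_pos_pos) auto
    also have "\<dots> = (3 * real n - 1) * (2 ^ Suc n + real (Suc n) - 1) - (3 * real (Suc n) - 1) * (2 ^ n + real n - 1)"
      by (simp add: algebra_simps)
    finally show ?thesis unfolding f_def using pos by (simp only: divide_less_eq less_divide_eq) (simp add: field_simps)
  qed
  have less: "f (Suc (n + k)) < f n" if "n \<ge> 3" for n k
  proof (induction k)
    case (Suc k)
    have "f (Suc (Suc (n + k))) < f (Suc (n + k))" using that by (intro step) simp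
    then show ?case using Suc by simp
  qed (use that step in simp)
  fix n n' :: nat assume n: "n \<in> {3..}" "n' \<in> {3..}" "n < n'"
  then obtain k where "n' = Suc (n + k)" using less_imp_Suc_add by blast
  then have "f n' < f n" using less n by simp
  moreover have "d' (dihedral_group (2 ^ (t - 1))) = f t" if "t \<ge> 3" for t
    unfolding f_def by (rule d'_dihedral_group[OF that])
  ultimately show "d' (dihedral_group (2 ^ (n - 1))) > d' (dihedral_group (2 ^ (n' - 1)))"
    using n by (simp only: atLeast_iff)
qed

lemma strict_antimono_heisenberg_group:
  "strict_antimono_on {p :: nat. prime p \<and> odd p} (\<lambda>p. d' (heisenberg_group p))"
proof (rule monotone_onI)
  fix p q :: nat assume pq: "p \<in> {p. prime p \<and> odd p}" "q \<in> {p. prime p \<and> odd p}" "p < q"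
  let ?f = "\<lambda>t::real. (2 * t + 5) / (t ^ 2 + 2 * t + 4)"
  have pos: "real t ^ 2 + 2 * real t + 4 > 0" for t :: nat by (intro add_nonneg_pos) auto
  \<comment> \<open>The cross-multiplied difference of the two ratios, with its factor q - p
    extracted.\<close>
  have "0 < (real q - real p) * (2 * real p * real q + 5 * (real p + real q) + 2)"
    using pq(3) by (intro mult_pos_pos add_nonneg_pos) auto
  also have "\<dots> = (2 * real p + 5) * (real q ^ 2 + 2 * real q + 4) - (2 * real q + 5) * (real p ^ 2 + 2 * real p + 4)"
    by (simp add: algebra_simps power2_eq_square)
  finally have "?f (real q) < ?f (real p)"
    using pos[of p] pos[of q] by (simp add: divide_less_eq less_divide_eq mult.commute)
  then show "d' (heisenberg_group p) > d' (heisenberg_group q)"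
    using pq by (simp add: d'_heisenberg_group)
qed

theorem proposition2p2:
  shows
   "(\<forall>p n :: nat. prime p \<and> (if p = 2 then n \<ge> 4 else n \<ge> 3) \<longrightarrow>
       d' (modular_group p n) =
         ((real n - 2) * (real p + 1) + 4) / ((real n - 1) * (real p + 1) + 2))
    \<and>
    (\<forall>(p :: nat) (q :: nat) (n :: nat) (G :: ('a, 'b) monoid_scheme).
       prime p \<and> prime q \<and> q dvd p - 1 \<and> n \<ge> 2 \<and> is_Gpqn p q n G \<longrightarrow>
       d' G = 2 * real n / (2 * real n + real p - 1))
    \<and>
    (\<forall>n :: nat. n \<ge> 3 \<longrightarrow>
       d' (dihedral_group (2 ^ (n - 1))) = (3 * real n - 1) / (2 ^ n + real n - 1))
    \<and>
    (\<forall>p :: nat. prime p \<and> odd p \<longrightarrow>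
       d' (heisenberg_group p) = (2 * real p + 5) / (real p ^ 2 + 2 * real p + 4))
    \<and>
    (\<forall>p :: nat. prime p \<and> odd p \<longrightarrow> strict_mono_on {3..} (\<lambda>n. d' (modular_group p n)))
    \<and>
    strict_mono_on {4..} (\<lambda>n. d' (modular_group 2 n))
    \<and>
    (\<forall>(p :: nat) (q :: nat) (G :: nat \<Rightarrow> ('a, 'b) monoid_scheme).
       prime p \<and> prime q \<and> q dvd p - 1 \<and> (\<forall>n \<ge> 2. is_Gpqn p q n (G n)) \<longrightarrow>
       strict_mono_on {2..} (\<lambda>n. d' (G n)))
    \<and>
    strict_antimono_on {3..} (\<lambda>n :: nat. d' (dihedral_group (2 ^ (n - 1))))
    \<and>
    strict_antimono_on {p :: nat. prime p \<and> odd p} (\<lambda>p. d' (heisenberg_group p))"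
proof (intro conjI allI impI, goal_cases)
  case (1 p n)
  then show ?case using d'_modular_group by blast
next
  case (2 p q n G)
  then show ?case using d'_Gpqn by blast
next
  case (3 n)
  then show ?case by (rule d'_dihedral_group)
next
  case (4 p)
  then show ?case using d'_heisenberg_group by blast
next
  case (5 p)
  then have "p \<noteq> 2" by auto
  then show ?case using 5 strict_mono_modular_group[of p 3] by simp
next
  case 6
  show ?case using strict_mono_modular_group[of 2 4] by simp
next
  case (7 p q G)
  then show ?case using strict_mono_Gpqn by blast
next
  case 8
  show ?case by (rule strict_antimono_dihedral_group)
next
  case 9
  show ?case by (rule strict_antimono_heisenberg_group)
qed

end
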